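(* Let $r\ge 1$ be such that for a.a. $x\in\Omega$ the function $(0,\infty)\ni s\mapsto \dfrac{\Phi(x,s)}{s^{r-1}}$ is increasing (non-decreasing). Let $w_1,w_2\in W^{1,p(x)}(\Omega)$ with $w_1,w_2>0$ a.e. on $\Omega$, $\dfrac{w_2}{w_1},\dfrac{w_1}{w_2}\in L^{\infty}(\Omega)$ and $\dfrac{\nabla w_1}{w_1},\dfrac{\nabla w_2}{w_2}\in L^1_{\mathrm{loc}}(\Omega)^N$. Consider the equality $$(\ast)\qquad \int_{\Omega} \mathbf{a}(x,\nabla w_1)\cdot\nabla\left (w_1-\frac{w_2^r}{w_1^{r-1}}\right )dx= \int_{\Omega} \mathbf{a}(x,\nabla w_2)\cdot\nabla\left (\frac{w_1^r}{w_2^{r-1}}-w_2\right )dx .$$ (i) If $r=1$, then $(\ast)$ holds if and only if there is $c\in\mathbb{R}$ such that $w_1-w_2=c$ a.e. on $\Omega$. (ii) If $r>1$ and $(\ast)$ holds, then there is $\lambda>0$ such that $w_2=\lambda w_1$ a.e. on $\Omega$. Conversely, suppose $r>1$ and $w_2=\lambda w_1$ a.e. on $\Omega$ with $\lambda>0$: if $\lambda=1$ then $(\ast)$ holds, and if $\lambda\ne1$ then $(\ast)$ holds if and only if $$\Phi(x,\lambda|\nabla w_1(x)|)=\lambda^{r-1}\Phi(x,|\nabla w_1(x)|)\quad\text{for a.a. }x\in\Omega .$$ If $r>1$ and in addition for a.a. $x\in\Omega$ the function $(0,\infty)\ni s\mapsto \dfrac{\Phi(x,s)}{s^{r-1}}$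 is strictly increasing, then $(\ast)$ holds if and only if $w_1= w_2$ a.e. on $\Omega$ or $w_1,w_2$ are (a.e. equal to) two different constant functions on $\Omega$.
   Context: Setting. $\Omega\subset\mathbb{R}^N$, $N\ge 2$, is an open, bounded, connected Lipschitz domain. $p:\overline\Omega\to(1,\infty)$ is either log-Hölder continuous with $p^-\ge \frac{2N}{N+2}$, or continuous with $p^->\frac{2N}{N+2}$, where $p^-=\min_{\overline\Omega}p$. $p'(x)=\frac{p(x)}{p(x)-1}$. $L^{p(x)}(\Omega)$ and $W^{1,p(x)}(\Omega)$ are the usual variable exponent Lebesgue and Sobolev spaces. $\Psi:\overline\Omega\times(0,\infty)\to(0,\infty)$ satisfies: $\Psi(\cdot,s)$ is measurable for each $s>0$; $\Psi(x,\cdot)$ is locally absolutely continuous on $(0,\infty)$ for a.a. $x\in\Omega$; $\lim_{s\to0^+}\Psi(x,s)s=0$ for each $x\in\Omega$; for a.a. $x\in\Omega$ the map $(0,\infty)\ni s\mapsto\Psi(x,s)s$ is strictly increasing. Define $\mathbf a:\overline\Omega\times\mathbb R^N\to\mathbb R^N$ by $\mathbf a(x,\xi)=\Psi(x,|\xi|)\xi$ for $\xi\ne\mathbf 0$, $\mathbf a(x,\mathbf 0)=\mathbf 0$, and $\Phi:\overline\Omega\times\mathbb R\to[0,\infty)$ by $\Phi(x,s)=\Psi(x,|s|)|s|$ for $s\neq0$, $\Phi(x,0)=0$. There are $a_0\in L^{p'(x)}(\Omega)$, $a_0\ge0$, and a constant $b\ge0$ with $\Phi(x,s)\le a_0(x)+b|s|^{p(x)-1}$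 for all $s\ge0$ and a.a. $x\in\Omega$. With $A(x,\xi)=\int_0^{|\xi|}\Phi(x,s)\,ds$, there are constants $\delta_0>0$, $\tilde\delta_0\ge0$ such that $\int_\Omega A(x,\nabla v)\,dx\ge\delta_0\int_\Omega|\nabla v|^{p(x)}dx-\tilde\delta_0$ for all $v\in W^{1,p(x)}(\Omega)$. *)

theory Defs
  imports "HOL-Analysis.Analysis"
begin

text \<open>
  Functions on a set \<open>\<Omega>\<close> are total functions whose values outside \<open>\<Omega>\<close> (or outside its closure,
  for the exponent and for \<open>\<Psi>\<close>) are irrelevant. Measurability, integrals and ``almost all'' refer
  to the Lebesgue measure on \<open>\<Omega>\<close>, written \<open>lebesgue_on \<Omega>\<close>.
\<close>

text \<open>
  The boundary is locally the graph of a Lipschitz function over the hyperplane orthogonal to a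
  unit vector \<open>e\<close>, with \<open>\<Omega>\<close> lying strictly above it; \<open>y - (e \<bullet> y) *\<^sub>R e\<close> is the projection of \<open>y\<close>
  to that hyperplane.
\<close>

definition lipschitz_boundary :: "'a::euclidean_space set \<Rightarrow> bool" where
  "lipschitz_boundary \<Omega> \<longleftrightarrow>
     (\<forall>z\<in>frontier \<Omega>. \<exists>\<rho>>0. \<exists>e \<gamma> L. norm e = 1 \<and> L-lipschitz_on {v. e \<bullet> v = 0} \<gamma> \<and>
        (\<forall>y\<in>ball z \<rho>. y \<in> \<Omega> \<longleftrightarrow> \<gamma> (y - (e \<bullet> y) *\<^sub>R e) < e \<bullet> y))"

definition bounded_lipschitz_domain :: "'a::euclidean_space set \<Rightarrow> bool" where
  "bounded_lipschitz_domain \<Omega> \<longleftrightarrow>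
     \<Omega> \<noteq> {} \<and> open \<Omega> \<and> bounded \<Omega> \<and> connected \<Omega> \<and> lipschitz_boundary \<Omega>"

text \<open>At \<open>x = y\<close> the inequality is trivial, as \<open>1 / 0 = 0\<close> and \<open>ln (exp 1) = 1\<close>.\<close>

definition log_hoelder_on :: "'a::metric_space set \<Rightarrow> ('a \<Rightarrow> real) \<Rightarrow> bool" where
  "log_hoelder_on S p \<longleftrightarrow>
     (\<exists>C. \<forall>x\<in>S. \<forall>y\<in>S. \<bar>p x - p y\<bar> \<le> C / ln (exp 1 + 1 / dist x y))"

definition conj_exponent :: "('a \<Rightarrow> real) \<Rightarrow> 'a \<Rightarrow> real" where
  "conj_exponent p x = p x / (p x - 1)"

text \<open>
  For the exponents occurring here, which are bounded, finiteness of the modular is the same as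
  finiteness of the Luxemburg norm.
\<close>

definition Lebesgue_var ::
    "'a::euclidean_space set \<Rightarrow> ('a \<Rightarrow> real) \<Rightarrow> ('a \<Rightarrow> 'b::euclidean_space) set" where
  "Lebesgue_var \<Omega> p =
     {f. f \<in> borel_measurable (lebesgue_on \<Omega>) \<and>
         integrable (lebesgue_on \<Omega>) (\<lambda>x. norm (f x) powr p x)}"

definition Lebesgue_infty :: "'a::euclidean_space set \<Rightarrow> ('a \<Rightarrow> real) set" where
  "Lebesgue_infty \<Omega> =
     {f. f \<in> borel_measurable (lebesgue_on \<Omega>) \<and> (\<exists>C. AE x in lebesgue_on \<Omega>. \<bar>f x\<bar> \<le> C)}"

definition Lebesgue_1_loc :: "'a::euclidean_space set \<Rightarrow> ('a \<Rightarrow> 'b::euclidean_space) set" where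
  "Lebesgue_1_loc \<Omega> = {f. \<forall>K. compact K \<and> K \<subseteq> \<Omega> \<longrightarrow> f absolutely_integrable_on K}"

primrec C_k :: "nat \<Rightarrow> ('a::euclidean_space \<Rightarrow> real) \<Rightarrow> bool" where
  "C_k 0 f \<longleftrightarrow> continuous_on UNIV f"
| "C_k (Suc k) f \<longleftrightarrow>
     f differentiable_on UNIV \<and> (\<forall>i\<in>Basis. C_k k (\<lambda>x. frechet_derivative f (at x) i))"

definition test_function :: "'a::euclidean_space set \<Rightarrow> ('a \<Rightarrow> real) \<Rightarrow> bool" where
  "test_function \<Omega> \<phi> \<longleftrightarrow>
     (\<forall>k. C_k k \<phi>) \<and> compact (closure {x. \<phi> x \<noteq> 0}) \<and> closure {x. \<phi> x \<noteq> 0} \<subseteq> \<Omega>"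

definition has_weak_gradient ::
    "'a::euclidean_space set \<Rightarrow> ('a \<Rightarrow> real) \<Rightarrow> ('a \<Rightarrow> 'a) \<Rightarrow> bool" where
  "has_weak_gradient \<Omega> u G \<longleftrightarrow>
     u \<in> Lebesgue_1_loc \<Omega> \<and> G \<in> Lebesgue_1_loc \<Omega> \<and>
     (\<forall>\<phi> i. test_function \<Omega> \<phi> \<and> i \<in> Basis \<longrightarrow>
        (LINT x|lebesgue_on \<Omega>. u x * frechet_derivative \<phi> (at x) i) =
        - (LINT x|lebesgue_on \<Omega>. (G x \<bullet> i) * \<phi> x))"

text \<open>
  The weak gradient is unique up to null sets; one representative is chosen. The value is
  meaningful only for functions that have a weak gradient.
\<close>

definition weak_grad :: "'a::euclidean_space set \<Rightarrow> ('a \<Rightarrow> real) \<Rightarrow> 'a \<Rightarrow> 'a" where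
  "weak_grad \<Omega> u = (SOME G. has_weak_gradient \<Omega> u G)"

definition Sobolev_var ::
    "'a::euclidean_space set \<Rightarrow> ('a \<Rightarrow> real) \<Rightarrow> ('a \<Rightarrow> real) set" where
  "Sobolev_var \<Omega> p =
     {u. u \<in> Lebesgue_var \<Omega> p \<and> (\<exists>G. has_weak_gradient \<Omega> u G \<and> G \<in> Lebesgue_var \<Omega> p)}"

definition absolutely_continuous_on_interval :: "real \<Rightarrow> real \<Rightarrow> (real \<Rightarrow> real) \<Rightarrow> bool" where
  "absolutely_continuous_on_interval a b f \<longleftrightarrow>
     (\<forall>\<epsilon>>0. \<exists>\<delta>>0. \<forall>D. finite D \<and> (\<forall>(u, v)\<in>D. a \<le> u \<and> u \<le> v \<and> v \<le> b) \<and>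
        disjoint_family_on (\<lambda>(u, v). {u<..<v}) D \<and> (\<Sum>(u, v)\<in>D. v - u) < \<delta> \<longrightarrow>
        (\<Sum>(u, v)\<in>D. \<bar>f v - f u\<bar>) < \<epsilon>)"

definition locally_absolutely_continuous_pos :: "(real \<Rightarrow> real) \<Rightarrow> bool" where
  "locally_absolutely_continuous_pos f \<longleftrightarrow>
     (\<forall>a b. 0 < a \<and> a < b \<longrightarrow> absolutely_continuous_on_interval a b f)"

text \<open>In the sequel \<open>flux\<close> is \<open>\<^bold>a\<close>, \<open>flux_mod\<close> is \<open>\<Phi>\<close> and \<open>flux_potential\<close> is \<open>A\<close>.\<close>

definition flux :: "('a::euclidean_space \<Rightarrow> real \<Rightarrow> real) \<Rightarrow> 'a \<Rightarrow> 'a \<Rightarrow> 'a" where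
  "flux \<Psi> x \<xi> = (if \<xi> = 0 then 0 else \<Psi> x (norm \<xi>) *\<^sub>R \<xi>)"

definition flux_mod :: "('a::euclidean_space \<Rightarrow> real \<Rightarrow> real) \<Rightarrow> 'a \<Rightarrow> real \<Rightarrow> real" where
  "flux_mod \<Psi> x s = (if s = 0 then 0 else \<Psi> x \<bar>s\<bar> * \<bar>s\<bar>)"

definition flux_potential :: "('a::euclidean_space \<Rightarrow> real \<Rightarrow> real) \<Rightarrow> 'a \<Rightarrow> 'a \<Rightarrow> real" where
  "flux_potential \<Psi> x \<xi> = (LINT s|lebesgue_on {0..norm \<xi>}. flux_mod \<Psi> x s)"

text \<open>
  The equality \<open>(\<ast>)\<close>. The powers are only evaluated at positive arguments, up to a null set. In the
  situation of the theorem both differences lie in the Sobolev space, because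
  \<open>w\<^sub>2 / w\<^sub>1\<close> and \<open>w\<^sub>1 / w\<^sub>2\<close> are bounded, and both integrals converge by the growth condition.
\<close>

definition picone_equality ::
    "'a::euclidean_space set \<Rightarrow> ('a \<Rightarrow> real \<Rightarrow> real) \<Rightarrow> real \<Rightarrow> ('a \<Rightarrow> real) \<Rightarrow> ('a \<Rightarrow> real) \<Rightarrow> bool" where
  "picone_equality \<Omega> \<Psi> r w\<^sub>1 w\<^sub>2 \<longleftrightarrow>
     (LINT x|lebesgue_on \<Omega>. flux \<Psi> x (weak_grad \<Omega> w\<^sub>1 x) \<bullet>
        weak_grad \<Omega> (\<lambda>y. w\<^sub>1 y - w\<^sub>2 y powr r / w\<^sub>1 y powr (r - 1)) x) =
     (LINT x|lebesgue_on \<Omega>. flux \<Psi> x (weak_grad \<Omega> w\<^sub>2 x) \<bullet>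
        weak_grad \<Omega> (\<lambda>y. w\<^sub>1 y powr r / w\<^sub>2 y powr (r - 1) - w\<^sub>2 y) x)"

end

theory Submission
  imports Defs "HOL-Computational_Algebra.Polynomial"
begin

text \<open>
  Write \<open>t = w\<^sub>2 / w\<^sub>1\<close> and \<open>h s = \<Phi>(x, s) / s powr (r - 1)\<close>. By Young's inequality and the
  monotonicity of \<open>h\<close>, the difference of the two integrands of \<open>(\<ast>)\<close> is nonnegative almost everywhere,
  and for \<open>r > 1\<close> it vanishes only where \<open>\<nabla>w\<^sub>2 = t \<nabla>w\<^sub>1\<close> (for \<open>r = 1\<close>, where \<open>\<nabla>w\<^sub>2 = \<nabla>w\<^sub>1\<close>). Both
  integrands are integrable by the growth condition, hence \<open>(\<ast>)\<close> means that this difference vanishes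
  almost everywhere; then \<open>t\<close> (or \<open>w\<^sub>1 - w\<^sub>2\<close>) has weak gradient zero and is constant.

  Instead of mollification, the calculus of weak gradients uses that a Borel function \<open>u\<close> with weak
  gradient \<open>G\<close> satisfies \<open>u (x + t i) - u x = \<integral>\<^sub>0\<^sup>t G (x + s i) \<bullet> i ds\<close> for almost all \<open>x\<close> and \<open>t\<close>,
  as seen by testing with smooth approximations of indicators of boxes. This property is stable
  under the chain rule in one variable and under limits, which covers \<open>ln w\<close> even when \<open>w\<close> is not
  bounded away from zero, and difference quotients of test functions recover the weak gradient.
\<close>

section \<open>Smooth functions of class C_k\<close>

text \<open>Two features of the statement shape the proof. \<open>weak_grad\<close> is an arbitrary
  choice among representatives, and the functions are only Lebesgue measurable on \<Omega>, while
  exchanging null sets between points and line parameters calls for joint measurability; hence Borel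
  representatives wherever lines enter. Moreover,
  \<open>w\<^sub>2 powr r / w\<^sub>1 powr (r - 1)\<close> depends on two functions that need not be
  bounded or bounded away from zero. Written as
  \<open>exp (r * ln w\<^sub>2 - (r - 1) * ln w\<^sub>1)\<close> it takes only linear combinations
  and chain rules in one variable. The price is the logarithm, and this is where local integrability
  of the logarithmic gradients enters; the bounds on the ratios then make the result and its
  gradient locally integrable. The increment formula is demanded for almost all parameters of the
  same line because the function can then be replaced, under the integral, by a continuous
  indefinite integral, for which an elementary chain rule suffices.\<close>

lemma C_k_SucI:
  assumes "\<And>x. (f has_derivative f' x) (at x)" "\<And>i. i \<in> Basis \<Longrightarrow> C_k k (\<lambda>x. f' x i)"
  shows "C_k (Suc k) f"
proof -
  have "frechet_derivative f (at x) = f' x" for x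
    using frechet_derivative_at[OF assms(1)] by simp
  then show ?thesis
    using assms by (auto simp: differentiable_on_def differentiable_def)
qed

lemma C_k_has_derivative:
  "C_k (Suc k) f \<Longrightarrow> (f has_derivative frechet_derivative f (at x)) (at x)"
  by (simp add: differentiable_on_def frechet_derivative_works)

lemma C_k_Suc_imp: "C_k (Suc k) f \<Longrightarrow> C_k k f"
proof (induction k arbitrary: f)
  case 0
  then show ?case by (simp add: differentiable_imp_continuous_on)
next
  case (Suc k)
  have "C_k k (\<lambda>x. frechet_derivative f (at x) i)" if "i \<in> Basis" for i
    using Suc.prems that by (intro Suc.IH) simp
  then show ?case using Suc.prems by simp
qed

lemma C_k_imp_continuous_on: "C_k k f \<Longrightarrow> continuous_on UNIV f"
  by (induction k) (use C_k_Suc_imp in auto)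

lemma C_k_const: "C_k k (\<lambda>x. c)"
  by (induction k arbitrary: c) (auto simp: differentiable_on_def)

lemma C_k_add: "C_k k f \<Longrightarrow> C_k k g \<Longrightarrow> C_k k (\<lambda>x. f x + g x)"
proof (induction k arbitrary: f g)
  case 0
  then show ?case by (simp add: continuous_on_add continuous_on_mult)
next
  case (Suc k)
  show ?case
    by (rule C_k_SucI[OF has_derivative_add[OF C_k_has_derivative[OF Suc.prems(1)]
          C_k_has_derivative[OF Suc.prems(2)]]], rule Suc.IH) (use Suc.prems in auto)
qed

lemma C_k_mult: "C_k k f \<Longrightarrow> C_k k g \<Longrightarrow> C_k k (\<lambda>x. f x * g x)"
proof (induction k arbitrary: f g)
  case 0
  then show ?case by (simp add: continuous_on_add continuous_on_mult)
next
  case (Suc k)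
  show ?case
    by (rule C_k_SucI[OF has_derivative_mult[OF C_k_has_derivative[OF Suc.prems(1)]
          C_k_has_derivative[OF Suc.prems(2)]]], rule C_k_add; rule Suc.IH)
      (use Suc.prems C_k_Suc_imp in auto)
qed

lemma C_k_prod: "finite I \<Longrightarrow> (\<And>i. i \<in> I \<Longrightarrow> C_k k (f i)) \<Longrightarrow> C_k k (\<lambda>x. \<Prod>i\<in>I. f i x)"
  by (induction I rule: finite_induct) (auto intro: C_k_const C_k_mult)

section \<open>Smooth functions of one real variable and their use along a linear functional\<close>

lemma C_k_Suc_realI:
  fixes f :: "real \<Rightarrow> real"
  assumes "\<And>x. (f has_real_derivative f' x) (at x)" "C_k k f'"
  shows "C_k (Suc k) f"
  by (rule C_k_SucI[where f' = "\<lambda>x h. f' x * h"])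
    (use assms in \<open>auto simp: has_field_derivative_def\<close>)

lemma C_k_Suc_realE:
  fixes f :: "real \<Rightarrow> real"
  assumes "C_k (Suc k) f"
  obtains f' where "\<And>x. (f has_real_derivative f' x) (at x)" "C_k k f'"
proof
  let ?f' = "\<lambda>x. frechet_derivative f (at x) 1"
  show "C_k k ?f'" using assms by simp
  show "(f has_real_derivative ?f' x) (at x)" for x
  proof -
    obtain D where D: "(f has_real_derivative D) (at x)"
      using C_k_has_derivative[OF assms, of x] real_differentiable_def differentiableI by metis
    then have "frechet_derivative f (at x) = (*) D"
      using frechet_derivative_at has_field_derivative_def by metis
    then show ?thesis using D by simp
  qed
qed

text \<open>The cutoffs of boxes are products of functions of one coordinate, so composition with
  affine functionals is the form in which they enter. The derivative has the same shape up to the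
  constant factor \<open>i \<bullet> v\<close>, and the induction closes.\<close>

lemma C_k_compose_affine:
  fixes g :: "real \<Rightarrow> real" and v :: "'a::euclidean_space"
  shows "C_k k g \<Longrightarrow> C_k k (\<lambda>x. g (x \<bullet> v + c))"
proof (induction k arbitrary: g)
  case 0
  then have "continuous_on UNIV g" by simp
  then have "continuous_on UNIV (\<lambda>x. g (x \<bullet> v + c))"
    by (rule continuous_on_compose2) (auto intro!: continuous_intros)
  then show ?case by simp
next
  case (Suc k)
  obtain g' where g': "\<And>x. (g has_real_derivative g' x) (at x)" "C_k k g'"
    using C_k_Suc_realE[OF Suc.prems] by blast
  have "((\<lambda>x. g (x \<bullet> v + c)) has_derivative (\<lambda>h. g' (x \<bullet> v + c) * (h \<bullet> v))) (at x)" for x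
    using g'(1)[of "x \<bullet> v + c"] unfolding has_field_derivative_def
    by (rule has_derivative_compose[rotated]) (auto intro!: derivative_eq_intros)
  then show ?case
    by (rule C_k_SucI) (intro C_k_mult Suc.IH g' C_k_const)
qed

text \<open>This family is closed under differentiation, which gives the smoothness of \<open>exp (- 1 / t)\<close>.\<close>

definition smooth_step :: "real poly \<Rightarrow> real \<Rightarrow> real" where
  "smooth_step P t = (if t > 0 then poly P (1 / t) * exp (- (1 / t)) else 0)"

lemma poly_times_exp_minus_tendsto_0:
  "((\<lambda>y. poly P y * exp (- y)) \<longlongrightarrow> 0) at_top" for P :: "real poly"
proof -
  have "((\<lambda>y. \<Sum>i\<le>degree P. coeff P i * (y ^ i / exp y)) \<longlongrightarrow> (\<Sum>i\<le>degree P. coeff P i * 0)) at_top"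
    by (intro tendsto_intros tendsto_power_div_exp_0)
  then show ?thesis
    by (simp add: poly_altdef sum_divide_distrib exp_minus field_simps)
qed

text \<open>With \<open>y = 1 / t\<close> the polynomial \<open>[:0, 0, 1:]\<close> is
  \<open>y ^ 2\<close>, which comes from the derivative of \<open>y\<close>; the product rule for
  \<open>poly P y * exp (- y)\<close> supplies \<open>P - pderiv P\<close>. At zero the right
  difference quotient is \<open>y * poly P y * exp (- y)\<close>, whence the factor
  \<open>[:0, 1:]\<close> there, and the exponential beats every polynomial.\<close>

lemma smooth_step_has_derivative:
  "(smooth_step P has_real_derivative smooth_step ([:0, 0, 1:] * (P - pderiv P)) t) (at t)"
proof -
  consider "t > 0" | "t < 0" | "t = 0" by linarith
  then show ?thesis
  proof cases
    case 1
    have "((\<lambda>t. poly P (1 / t) * exp (- (1 / t))) has_real_derivative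
        smooth_step ([:0, 0, 1:] * (P - pderiv P)) t) (at t)"
    proof -
      have "((\<lambda>t. 1 / t) has_real_derivative - (1 / t^2)) (at t)"
        using 1 by (auto intro!: derivative_eq_intros simp: power2_eq_square)
      note d = this DERIV_minus[OF this]
      have "((\<lambda>t. poly P (1 / t)) has_real_derivative poly (pderiv P) (1 / t) * (- (1 / t^2))) (at t)"
        by (rule DERIV_chain2[OF poly_DERIV d(1)])
      moreover have "((\<lambda>t. exp (- (1 / t))) has_real_derivative exp (- (1 / t)) * (- (- (1 / t^2)))) (at t)"
        by (rule DERIV_chain2[OF DERIV_exp d(2)])
      ultimately show ?thesis
        by (rule DERIV_mult[THEN DERIV_cong])
          (use 1 in \<open>simp add: smooth_step_def algebra_simps power2_eq_square add_divide_distrib diff_divide_distrib\<close>)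
    qed
    then show ?thesis
      by (rule has_field_derivative_transform_within_open[where S = "{0<..}"])
        (use 1 in \<open>auto simp: smooth_step_def\<close>)
  next
    case 2
    have "((\<lambda>t. 0) has_real_derivative smooth_step ([:0, 0, 1:] * (P - pderiv P)) t) (at t)"
      using 2 by (auto simp: smooth_step_def)
    then show ?thesis
      by (rule has_field_derivative_transform_within_open[where S = "{..<0}"])
        (use 2 in \<open>auto simp: smooth_step_def\<close>)
  next
    case 3
    have "((\<lambda>t. poly ([:0, 1:] * P) (inverse t) * exp (- inverse t)) \<longlongrightarrow> 0) (at_right 0)"
      by (rule filterlim_compose[OF poly_times_exp_minus_tendsto_0 filterlim_inverse_at_top_right])
    then have "((\<lambda>t. smooth_step P t / t) \<longlongrightarrow> 0) (at_right 0)"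
      by (rule Lim_transform_eventually)
        (auto simp: eventually_at_filter smooth_step_def field_simps)
    moreover have "((\<lambda>t. smooth_step P t / t) \<longlongrightarrow> 0) (at_left 0)"
      by (rule Lim_transform_eventually[OF tendsto_const])
        (auto simp: eventually_at_filter smooth_step_def)
    ultimately have "((\<lambda>t. smooth_step P t / t) \<longlongrightarrow> 0) (at 0)"
      using filterlim_split_at by blast
    then show ?thesis
      using 3 by (simp add: DERIV_def smooth_step_def)
  qed
qed

lemma C_k_smooth_step: "C_k k (smooth_step P)"
proof (induction k arbitrary: P)
  case 0
  have "isCont (smooth_step P) t" for t
    using smooth_step_has_derivative DERIV_isCont by blast
  then show ?case by (simp add: continuous_on_eq_continuous_at)
next
  case (Suc k)
  show ?case
    by (rule C_k_Suc_realI[OF smooth_step_has_derivative Suc.IH])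
qed

section \<open>Smooth cutoffs of boxes\<close>

lemma AE_lborel_cbox_box: "AE x in lborel. x \<in> cbox a b \<longrightarrow> x \<in> box a b"
proof -
  have "cbox a b - box a b \<in> null_sets lborel"
    using negligible_frontier_interval[of a b] null_sets_completion_iff[of "cbox a b - box a b" lborel]
    by (simp add: negligible_iff_null_sets)
  from AE_not_in[OF this] show ?thesis by auto
qed

text \<open>An open set is a countable union of closed boxes, so the exceptional null sets can be
  united. This is how integrability on compact subsets yields statements on all of an open
  set.\<close>

lemma AE_on_open_if_cboxes:
  assumes W: "open W"
    and cb: "\<And>a b. cbox a b \<subseteq> W \<Longrightarrow> AE x in lborel. x \<in> cbox a b \<longrightarrow> P x"
  shows "AE x in lborel. x \<in> W \<longrightarrow> P x"
proof -
  obtain \<D> where \<D>: "countable \<D>" "\<D> \<subseteq> Pow W" "\<And>X. X \<in> \<D> \<Longrightarrow> \<exists>a b. X = cbox a b" "\<Union>\<D> = W"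
    by (rule open_countable_Union_open_cbox[OF W]) (rule that)
  have "AE x in lborel. \<forall>X\<in>\<D>. x \<in> X \<longrightarrow> P x"
  proof (subst AE_ball_countable[OF \<D>(1)], intro ballI)
    fix X assume X: "X \<in> \<D>"
    then obtain a b where ab: "X = cbox a b" using \<D>(3) by blast
    with X \<D>(2) show "AE x in lborel. x \<in> X \<longrightarrow> P x" by (simp only: ab) (rule cb, blast)
  qed
  then show ?thesis by eventually_elim (use \<D>(4) in auto)
qed

text \<open>Inside a fixed closed box the sets over which the cut-off function \<open>F\<close> has
  integral zero form a Dynkin system. It contains the open boxes, which are stable under
  intersection and generate the Borel sets, so \<open>F\<close> has integral zero over every Borel
  set and vanishes almost everywhere.\<close>

lemma AE_zero_if_box_integrals_zero:
  fixes f :: "'a::euclidean_space \<Rightarrow> real"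
  assumes W: "open W"
    and int: "\<And>a b. cbox a b \<subseteq> W \<Longrightarrow> set_integrable lborel (cbox a b) f"
    and zero: "\<And>a b. cbox a b \<subseteq> W \<Longrightarrow> (LINT x:box a b|lborel. f x) = 0"
  shows "AE x in lborel. x \<in> W \<longrightarrow> f x = 0"
proof -
  have "AE x in lborel. x \<in> cbox c d \<longrightarrow> f x = 0" if cd: "cbox c d \<subseteq> W" for c d
  proof -
    define F where "F x = indicator (box c d) x * f x" for x
    have F: "integrable lborel F"
      using set_integrable_subset[OF int[OF cd], of "box c d"] box_subset_cbox[of c d]
      by (simp add: set_integrable_def F_def[abs_def])
    have set_int: "set_integrable lborel A F" if "A \<in> sets borel" for A
      using integrable_mult_indicator[of A lborel F] that F by (simp add: set_integrable_def)
    have zero': "(LINT x:A|lborel. F x) = 0" if "A \<in> sigma_sets UNIV (range (\<lambda>(a, b). box a b))" for A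
    proof -
      have "Int_stable (range (\<lambda>(a, b). box a b :: 'a set))" "range (\<lambda>(a, b). box a b :: 'a set) \<subseteq> Pow UNIV"
        by (auto simp: Int_stable_def box_Int_box)
      then show ?thesis using that
    proof (induction A rule: sigma_sets_induct_disjoint)
      case (basic A)
      then obtain a b where A: "A = box a b" by auto
      obtain l u where lu: "box a b \<inter> box c d = box l u"
        by (rule that[OF box_Int_box])
      have "(LINT x:A|lborel. F x) = (LINT x:box l u|lborel. f x)"
        unfolding set_lebesgue_integral_def A F_def lu[symmetric]
        by (intro Bochner_Integration.integral_cong) (auto simp: indicator_def)
      also have "\<dots> = 0"
      \<comment> \<open>If the intersection is empty, its corners \<open>l\<close> and
        \<open>u\<close> are arbitrary and \<open>cbox l u\<close> may leave
        \<open>cbox c d\<close>. Otherwise \<open>cbox l u\<close> is the closure of a set inside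
        \<open>cbox c d\<close>.\<close>
      proof (cases "box l u = {}")
        case True then show ?thesis by (simp add: set_lebesgue_integral_def)
      next
        case False
        have "cbox l u = closure (box l u)" using False by (simp add: closure_box)
        also have "\<dots> \<subseteq> cbox c d"
          using lu box_subset_cbox[of c d] by (intro closure_minimal) auto
        finally show ?thesis using cd by (intro zero) auto
      qed
      finally show ?case .
    next
      case empty then show ?case by (simp add: set_lebesgue_integral_def)
    next
      case (compl A)
      have A: "A \<in> sets lborel" using compl by (simp add: borel_eq_box sets_measure_of)
      have "integral\<^sup>L lborel F = (LINT x:A|lborel. F x) + (LINT x:UNIV - A|lborel. F x)"
      proof -
        have "set_integrable lborel A F" "set_integrable lborel (UNIV - A) F"
          using A by (auto intro!: set_int)
        then have "(LINT x:A \<union> (UNIV - A)|lborel. F x) = (LINT x:A|lborel. F x) + (LINT x:UNIV - A|lborel. F x)"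
          by (intro set_integral_Un) auto
        then show ?thesis by (simp add: set_lebesgue_integral_def)
      qed
      moreover have "integral\<^sup>L lborel F = 0"
        using zero[OF cd] by (simp add: set_lebesgue_integral_def F_def[abs_def])
      ultimately show ?case using compl by simp
    next
      case (union A)
      have A: "A i \<in> sets lborel" for i using union(2) by (auto simp: borel_eq_box sets_measure_of)
      have "(LINT x:(\<Union>i. A i)|lborel. F x) = (\<Sum>i. (LINT x:(A i)|lborel. F x))"
        using union(1) A F
        by (intro lebesgue_integral_countable_add)
          (auto simp: disjoint_family_on_def intro!: set_int)
      then show ?case using union(3) by simp
    qed
    qed
    have "AE x in lborel. F x = 0"
      using F zero' by (intro sigma_finite_measure.density_zero[OF sigma_finite_lborel]) (auto simp: borel_eq_box sets_measure_of)
    with AE_lborel_cbox_box[of c d] show ?thesis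
      by eventually_elim (auto simp: F_def)
  qed
  from AE_on_open_if_cboxes[OF W this] show ?thesis .
qed

text \<open>The function \<open>smooth_step 1\<close> is \<open>exp (- 1 / t)\<close> for positive
  arguments, with values in the unit interval and limit 1 at infinity. Stretching by
  \<open>m\<close> therefore gives smooth functions that converge to the indicator of the open
  interval while all of them vanish outside it, so neither the support nor the bound 1 depends on
  \<open>m\<close>.\<close>

definition bump :: "nat \<Rightarrow> real \<Rightarrow> real \<Rightarrow> real \<Rightarrow> real" where
  "bump m a b t = smooth_step 1 (real m * (t - a)) * smooth_step 1 (real m * (b - t))"

lemma C_k_bump: "C_k k (bump m a b)"
proof -
  have "C_k k (\<lambda>t. smooth_step 1 (t \<bullet> real m + - real m * a) * smooth_step 1 (t \<bullet> (- real m) + real m * b))"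
    by (intro C_k_mult C_k_compose_affine C_k_smooth_step)
  then show ?thesis by (simp add: bump_def[abs_def] algebra_simps)
qed

lemma smooth_step_1: "0 \<le> smooth_step 1 t" "smooth_step 1 t \<le> 1" "t \<le> 0 \<Longrightarrow> smooth_step 1 t = 0"
  by (auto simp: smooth_step_def)

lemma bump_bounds: "0 \<le> bump m a b t" "bump m a b t \<le> 1"
  by (auto simp: bump_def smooth_step_1 mult_le_one)

lemma bump_eq_0: "\<not> (a < t \<and> t < b) \<Longrightarrow> bump m a b t = 0"
proof -
  assume "\<not> (a < t \<and> t < b)"
  then have "real m * (t - a) \<le> 0 \<or> real m * (b - t) \<le> 0"
    by (auto simp: not_less mult_nonneg_nonpos)
  then show ?thesis by (auto simp: bump_def smooth_step_1)
qed

lemma bump_tendsto: "(\<lambda>m. bump m a b t) \<longlonglongrightarrow> indicator {a<..<b} t"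
proof (cases "a < t \<and> t < b")
  case True
  have *: "(\<lambda>m. smooth_step 1 (real m * c)) \<longlonglongrightarrow> 1" if "c > 0" for c
  proof -
    have "(\<lambda>m. exp (- (inverse c * inverse (real m)))) \<longlonglongrightarrow> exp (- (inverse c * 0))"
      by (intro tendsto_intros lim_inverse_n)
    moreover have "\<forall>\<^sub>F m in sequentially. exp (- (inverse c * inverse (real m))) = smooth_step 1 (real m * c)"
      using eventually_gt_at_top[of 0] by eventually_elim (use that in \<open>auto simp: smooth_step_def field_simps\<close>)
    ultimately show ?thesis by (auto intro: Lim_transform_eventually)
  qed
  have "(\<lambda>m. bump m a b t) \<longlonglongrightarrow> 1 * 1"
    unfolding bump_def using True by (intro tendsto_mult *) auto
  then show ?thesis using True by simp
next
  case False
  then show ?thesis using bump_eq_0[OF False] by (auto simp: indicator_def)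
qed

definition box_bump :: "nat \<Rightarrow> 'a::euclidean_space \<Rightarrow> 'a \<Rightarrow> 'a \<Rightarrow> real" where
  "box_bump m a b x = (\<Prod>j\<in>Basis. bump m (a \<bullet> j) (b \<bullet> j) (x \<bullet> j))"

lemma C_k_box_bump: "C_k k (box_bump m a b)"
proof -
  have "C_k k (\<lambda>x. \<Prod>j\<in>Basis. bump m (a \<bullet> j) (b \<bullet> j) (x \<bullet> j + 0))"
    by (intro C_k_prod C_k_compose_affine C_k_bump) auto
  then show ?thesis by (simp add: box_bump_def[abs_def])
qed

lemma box_bump_bounds: "0 \<le> box_bump m a b x" "box_bump m a b x \<le> 1"
  by (auto simp: box_bump_def intro!: prod_nonneg prod_le_1 bump_bounds)

lemma box_bump_eq_0: "x \<notin> box a b \<Longrightarrow> box_bump m a b x = 0"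
  unfolding box_bump_def mem_box by (subst prod_zero_iff) (auto intro: bump_eq_0)

lemma box_bump_eq_0_cbox: "x \<notin> cbox a b \<Longrightarrow> box_bump m a b x = 0"
  using box_bump_eq_0[of x a b m] subsetD[OF box_subset_cbox, of x a b] by blast

lemma box_bump_tendsto: "(\<lambda>m. box_bump m a b x) \<longlonglongrightarrow> indicator (box a b) x"
proof -
  have "(\<lambda>m. box_bump m a b x) \<longlonglongrightarrow> (\<Prod>j\<in>Basis. indicator {a \<bullet> j<..<b \<bullet> j} (x \<bullet> j))"
    unfolding box_bump_def by (intro tendsto_prod bump_tendsto)
  also have "(\<Prod>j\<in>Basis. indicator {a \<bullet> j<..<b \<bullet> j} (x \<bullet> j) :: real) = indicator (box a b) x"
    by (auto simp: indicator_def mem_box prod_zero_iff Ball_def intro!: prod.neutral)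
  finally show ?thesis .
qed

lemma borel_measurable_box_bump [measurable]: "box_bump m a b \<in> borel_measurable borel"
  by (intro borel_measurable_continuous_onI C_k_imp_continuous_on[OF C_k_box_bump])

section \<open>Cutoffs of boxes as test functions\<close>

lemma test_functionI:
  assumes "\<And>k. C_k k \<phi>" "compact K" "K \<subseteq> \<Omega>" "\<And>x. x \<notin> K \<Longrightarrow> \<phi> x = 0"
  shows "test_function \<Omega> \<phi>"
proof -
  have "closure {x. \<phi> x \<noteq> 0} \<subseteq> K"
    using assms by (intro closure_minimal compact_imp_closed) auto
  then show ?thesis
    using assms compact_Int_closed[of K "closure {x. \<phi> x \<noteq> 0}"]
    by (auto simp: test_function_def Int_absorb1 Int_absorb2)
qed

lemma test_function_box_bump: "cbox a b \<subseteq> \<Omega> \<Longrightarrow> test_function \<Omega> (box_bump m a b)"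
  by (rule test_functionI[where K = "cbox a b"])
    (auto intro: C_k_box_bump box_bump_eq_0 dest: subsetD[OF box_subset_cbox])

lemma C_k_antiderivative:
  fixes f :: "real \<Rightarrow> real"
  assumes "\<And>k. C_k k f"
  obtains F where "\<And>x. (F has_real_derivative f x) (at x)" "\<And>k. C_k k F"
proof -
  have "isCont f x" for x
    using C_k_imp_continuous_on[OF assms[of 0]] by (simp add: continuous_on_eq_continuous_at)
  then obtain F where F: "(F has_real_derivative f x) (at x)" for x
    using einterval_antiderivative[of "-\<infinity>" "\<infinity>" f]
    by (simp add: has_real_derivative_iff_has_vector_derivative) blast
  have "C_k k F" for k
    by (rule C_k_Suc_imp, rule C_k_Suc_realI) (use F assms in auto)
  with F show ?thesis by (rule that)
qed

text \<open>
  Only the \<open>i\<close>-th factor of the product depends on the direction of integration. It becomes the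
  increment of an antiderivative, so nothing has to be differentiated under the integral sign.
\<close>

lemma swept_box_bump:
  fixes a b :: "'a::euclidean_space" and t :: real and m :: nat
  assumes i: "i \<in> Basis" and t: "t \<ge> 0" and sub: "cbox a (b + t *\<^sub>R i) \<subseteq> \<Omega>"
  defines "\<phi> \<equiv> \<lambda>x. LINT s:{0..t}|lborel. box_bump m a b (x - s *\<^sub>R i)"
  shows "test_function \<Omega> \<phi>"
    and "x \<notin> cbox a (b + t *\<^sub>R i) \<Longrightarrow> \<phi> x = 0"
    and "frechet_derivative \<phi> (at x) i = box_bump m a b x - box_bump m a b (x - t *\<^sub>R i)"
proof -
  define \<theta> where "\<theta> j = bump m (a \<bullet> j) (b \<bullet> j)" for j
  define P where "P x = (\<Prod>j\<in>Basis-{i}. \<theta> j (x \<bullet> j))" for x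
  have "C_k k (\<theta> i)" for k unfolding \<theta>_def by (rule C_k_bump)
  then obtain S where S: "\<And>x. (S has_real_derivative \<theta> i x) (at x)" "\<And>k. C_k k S"
    by (rule C_k_antiderivative) blast
  have split: "box_bump m a b (x - s *\<^sub>R i) = \<theta> i (x \<bullet> i - s) * P x" for x s
  proof -
    have "box_bump m a b (x - s *\<^sub>R i) = (\<Prod>j\<in>Basis. \<theta> j ((x - s *\<^sub>R i) \<bullet> j))"
      by (simp add: box_bump_def \<theta>_def)
    also have "\<dots> = \<theta> i ((x - s *\<^sub>R i) \<bullet> i) * (\<Prod>j\<in>Basis-{i}. \<theta> j ((x - s *\<^sub>R i) \<bullet> j))"
      using i by (subst prod.remove[of _ i]) auto
    also have "(\<Prod>j\<in>Basis-{i}. \<theta> j ((x - s *\<^sub>R i) \<bullet> j)) = P x"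
      unfolding P_def using i by (intro prod.cong) (auto simp: inner_diff_left inner_not_same_Basis)
    finally show ?thesis using i by (simp add: inner_diff_left)
  qed
  have \<phi>: "\<phi> x = (S (x \<bullet> i) - S (x \<bullet> i - t)) * P x" for x
  proof -
    have "((\<lambda>s. \<theta> i (x \<bullet> i - s)) has_integral (- S (x \<bullet> i - t) - - S (x \<bullet> i - 0))) {0..t}"
    proof (rule fundamental_theorem_of_calculus[OF t])
      fix s :: real
      have "((\<lambda>s. S (x \<bullet> i - s)) has_real_derivative \<theta> i (x \<bullet> i - s) * (0 - 1)) (at s within {0..t})"
        by (rule DERIV_chain2[OF S(1)]) (intro DERIV_diff DERIV_const DERIV_ident)
      from DERIV_minus[OF this]
      show "((\<lambda>s. - S (x \<bullet> i - s)) has_vector_derivative \<theta> i (x \<bullet> i - s)) (at s within {0..t})"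
        by (simp add: has_real_derivative_iff_has_vector_derivative)
    qed
    moreover have "set_integrable lborel {0..t} (\<lambda>s. \<theta> i (x \<bullet> i - s))"
      unfolding \<theta>_def
      by (intro borel_integrable_atLeastAtMost' continuous_on_compose2[OF C_k_imp_continuous_on[OF C_k_bump]]
          continuous_intros) auto
    ultimately have "(LINT s:{0..t}|lborel. \<theta> i (x \<bullet> i - s)) = S (x \<bullet> i) - S (x \<bullet> i - t)"
      by (simp add: set_borel_integral_eq_integral(2) integral_unique)
    then show ?thesis by (simp add: \<phi>_def split)
  qed
  have CP: "C_k k P" for k
  proof -
    have "C_k k (\<lambda>x. \<Prod>j\<in>Basis-{i}. \<theta> j (x \<bullet> j + 0))"
      unfolding \<theta>_def by (intro C_k_prod C_k_compose_affine C_k_bump) auto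
    then show ?thesis by (simp add: P_def[abs_def])
  qed
  have C\<phi>: "C_k k \<phi>" for k
  proof -
    have "C_k k (\<lambda>x. (S (x \<bullet> i + 0) + (-1) * S (x \<bullet> i + - t)) * P x)"
      by (intro C_k_mult C_k_add C_k_const C_k_compose_affine S CP)
    then show ?thesis by (simp add: \<phi>[abs_def])
  qed
  have outside: "\<phi> x = 0" if x: "x \<notin> cbox a (b + t *\<^sub>R i)" for x
  proof -
    have "box_bump m a b (x - s *\<^sub>R i) = 0" if "s \<in> {0..t}" for s
    \<comment> \<open>A nonzero value places \<open>x - s *\<^sub>R i\<close> in the original box;
      moving this point forward by some \<open>s\<close> between 0 and \<open>t\<close> keeps it in
      the box whose upper corner is \<open>b + t *\<^sub>R i\<close>.\<close>
    proof (rule box_bump_eq_0, rule notI)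
      assume *: "x - s *\<^sub>R i \<in> box a b"
      have "x \<in> cbox a (b + t *\<^sub>R i)"
        unfolding mem_box
      proof (intro ballI conjI)
        fix j :: 'a assume j: "j \<in> Basis"
        have "a \<bullet> j < x \<bullet> j - s * (i \<bullet> j)" "x \<bullet> j - s * (i \<bullet> j) < b \<bullet> j"
          using * j by (auto simp: mem_box inner_diff_left)
        moreover have "0 \<le> s * (i \<bullet> j)" "s * (i \<bullet> j) \<le> t * (i \<bullet> j)"
          using that i j by (auto simp: inner_Basis)
        ultimately show "a \<bullet> j \<le> x \<bullet> j" "x \<bullet> j \<le> (b + t *\<^sub>R i) \<bullet> j"
          by (auto simp: inner_add_left)
      qed
      with x show False by simp
    qed
    then have "\<phi> x = (LINT s:{0..t}|lborel. 0)"
      unfolding \<phi>_def by (intro set_lebesgue_integral_cong) auto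
    then show "\<phi> x = 0" by (simp add: set_lebesgue_integral_def)
  qed
  show "x \<notin> cbox a (b + t *\<^sub>R i) \<Longrightarrow> \<phi> x = 0" by (rule outside)
  show "test_function \<Omega> \<phi>"
    by (rule test_functionI[OF C\<phi> _ sub outside]) auto
  \<comment> \<open>The partial derivative is read off from the function of the single variable
    \<open>h\<close>: one expression for its derivative comes from smoothness of \<phi>, the other
    from \<open>S\<close>, and derivatives are unique.\<close>
  have "((\<lambda>h. \<phi> (x + h *\<^sub>R i)) has_derivative (\<lambda>h. frechet_derivative \<phi> (at x) (h *\<^sub>R i))) (at 0)"
  proof (rule has_derivative_compose[of "\<lambda>h. x + h *\<^sub>R i" "\<lambda>h. h *\<^sub>R i"])
    show "((\<lambda>h. x + h *\<^sub>R i) has_derivative (\<lambda>h. h *\<^sub>R i)) (at 0)"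
      by (auto intro!: derivative_eq_intros)
  qed (use C_k_has_derivative[OF C\<phi>[of "Suc 0"], of x] in simp)
  moreover have Pi: "P (x + h *\<^sub>R i) = P x" for h
    unfolding P_def using i by (intro prod.cong) (auto simp: inner_add_left inner_not_same_Basis)
  have "((\<lambda>h. S (x \<bullet> i + h + c)) has_real_derivative \<theta> i (x \<bullet> i + 0 + c) * (0 + 1 + 0)) (at 0)" for c
    by (rule DERIV_chain2[OF S(1)]) (intro DERIV_add DERIV_const DERIV_ident)
  from DERIV_cmult_right[OF DERIV_diff[OF this[of 0] this[of "- t"]], of "P x"]
  have "((\<lambda>h. (S (x \<bullet> i + h) - S (x \<bullet> i + h - t)) * P x) has_real_derivative
      (\<theta> i (x \<bullet> i) - \<theta> i (x \<bullet> i - t)) * P x) (at 0)"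
    by simp
  then have "((\<lambda>h. \<phi> (x + h *\<^sub>R i)) has_derivative (*) ((\<theta> i (x \<bullet> i) - \<theta> i (x \<bullet> i - t)) * P x)) (at 0)"
    unfolding has_field_derivative_def \<phi> Pi using i by (simp add: inner_add_left)
  ultimately have "(\<lambda>h. frechet_derivative \<phi> (at x) (h *\<^sub>R i)) = (*) ((\<theta> i (x \<bullet> i) - \<theta> i (x \<bullet> i - t)) * P x)"
    by (rule has_derivative_unique)
  from fun_cong[OF this, of 1]
  show "frechet_derivative \<phi> (at x) i = box_bump m a b x - box_bump m a b (x - t *\<^sub>R i)"
    using split[of x 0] split[of x t] by (simp add: left_diff_distrib)
qed

section \<open>Weak gradients and Borel representatives\<close>

lemma AE_lebesgue_on_iff:
  "open \<Omega> \<Longrightarrow> (AE x in lebesgue_on \<Omega>. P x) \<longleftrightarrow> (AE x in lborel. x \<in> \<Omega> \<longrightarrow> P x)"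
  by (subst AE_restrict_space_iff) (auto simp: AE_completion_iff)

lemma Lebesgue_1_loc_borel_iff:
  "f \<in> borel_measurable borel \<Longrightarrow>
    f \<in> Lebesgue_1_loc \<Omega> \<longleftrightarrow> (\<forall>K. compact K \<and> K \<subseteq> \<Omega> \<longrightarrow> set_integrable lborel K f)"
proof -
  assume f: "f \<in> borel_measurable borel"
  have "f absolutely_integrable_on K \<longleftrightarrow> set_integrable lborel K f" if "compact K" for K
    unfolding set_integrable_def using f that
    by (intro integrable_completion) (auto dest: compact_imp_closed intro!: borel_measurable_scaleR)
  then show ?thesis by (auto simp: Lebesgue_1_loc_def)
qed

lemma set_integrable_inner:
  "set_integrable M A f \<Longrightarrow> set_integrable M A (\<lambda>x. f x \<bullet> c)"
  using integrable_inner_left[of c M "\<lambda>x. indicator A x *\<^sub>R f x"] by (simp add: set_integrable_def)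

lemma Lebesgue_1_loc_cong_AE:
  assumes "AE x in lborel. x \<in> \<Omega> \<longrightarrow> f x = g x" and f: "f \<in> Lebesgue_1_loc \<Omega>"
  shows "g \<in> Lebesgue_1_loc \<Omega>"
proof -
  have "AE x in lebesgue. x \<in> \<Omega> \<longrightarrow> f x = g x"
    using assms(1) by (simp add: AE_completion_iff)
  then obtain N where N: "N \<in> null_sets lebesgue" "{x. \<not> (x \<in> \<Omega> \<longrightarrow> f x = g x)} \<subseteq> N"
    by (auto simp: eventually_ae_filter)
  have "g absolutely_integrable_on K" if "compact K" "K \<subseteq> \<Omega>" for K
  proof (rule absolutely_integrable_spike)
    show "f absolutely_integrable_on K" using f that by (auto simp: Lebesgue_1_loc_def)
    show "negligible N" using N(1) by (simp add: negligible_iff_null_sets)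
  qed (use N(2) that in auto)
  then show ?thesis by (auto simp: Lebesgue_1_loc_def)
qed

text \<open>Local integrability gives measurability on compact subsets only; countably many closed
  boxes fill \<Omega>, and measurability on each piece is enough.\<close>

lemma Lebesgue_1_loc_measurable:
  assumes "open \<Omega>" and f: "f \<in> Lebesgue_1_loc \<Omega>"
  shows "f \<in> borel_measurable (lebesgue_on \<Omega>)"
proof -
  obtain \<D> where \<D>: "countable \<D>" "\<D> \<subseteq> Pow \<Omega>" "\<And>X. X \<in> \<D> \<Longrightarrow> \<exists>a b. X = cbox a b" "\<Union>\<D> = \<Omega>"
    by (rule open_countable_Union_open_cbox[OF assms(1)]) (rule that)
  show ?thesis
  proof (rule measurable_piecewise_restrict[OF \<D>(1)])
    fix X assume X: "X \<in> \<D>"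
    then obtain a b where ab: "X = cbox a b" using \<D>(3) by blast
    with X \<D>(2) have sub: "cbox a b \<subseteq> \<Omega>" by blast
    show "X \<inter> space (lebesgue_on \<Omega>) \<in> sets (lebesgue_on \<Omega>)"
      using sub assms(1) by (auto simp: ab sets_restrict_space Int_absorb2)
    have "f absolutely_integrable_on cbox a b" using f sub by (auto simp: Lebesgue_1_loc_def)
    then have "f \<in> borel_measurable (lebesgue_on (cbox a b))"
      by (simp add: absolutely_integrable_measurable)
    then show "f \<in> borel_measurable (restrict_space (lebesgue_on \<Omega>) X)"
      using sub assms(1) by (simp add: ab restrict_restrict_space Int_absorb1 Int_absorb2)
  qed (use \<D>(4) in simp)
qed

text \<open>The real-valued case is applied to each of the finitely many coordinates, and the vector
  is reassembled from them.\<close>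

lemma lebesgue_ex_borel_measurable:
  fixes f :: "'a::euclidean_space \<Rightarrow> 'b::euclidean_space"
  assumes "f \<in> borel_measurable lebesgue"
  obtains g where "g \<in> borel_measurable borel" "AE x in lborel. f x = g x"
proof -
  have "\<exists>h\<in>borel_measurable lborel. AE x in lborel. f x \<bullet> b = h x" for b
    by (rule completion_ex_borel_measurable_real) (use assms in \<open>rule borel_measurable_inner, simp\<close>)
  then have "\<forall>b. \<exists>h. h \<in> borel_measurable lborel \<and> (AE x in lborel. f x \<bullet> b = h x)"
    by blast
  from choice[OF this] obtain h where
      h: "\<And>b. h b \<in> borel_measurable lborel" "\<And>b. AE x in lborel. f x \<bullet> b = h b x"
    by blast
  have "AE x in lborel. \<forall>b\<in>Basis. f x \<bullet> b = h b x"
    using h(2) by (simp add: AE_finite_all)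
  then have "AE x in lborel. f x = (\<Sum>b\<in>Basis. h b x *\<^sub>R b)"
  proof eventually_elim
    case (elim x)
    then have "(\<Sum>b\<in>Basis. h b x *\<^sub>R b) = (\<Sum>b\<in>Basis. (f x \<bullet> b) *\<^sub>R b)" by simp
    then show ?case by (simp add: euclidean_representation)
  qed
  moreover have "(\<lambda>x. \<Sum>b\<in>Basis. h b x *\<^sub>R b) \<in> borel_measurable borel"
    using h(1) by simp
  ultimately show ?thesis by (intro that)
qed

lemma lebesgue_on_ex_borel_measurable:
  fixes f :: "'a::euclidean_space \<Rightarrow> 'b::euclidean_space"
  assumes "open \<Omega>" "f \<in> borel_measurable (lebesgue_on \<Omega>)"
  obtains g where "g \<in> borel_measurable borel" "AE x in lborel. x \<in> \<Omega> \<longrightarrow> f x = g x"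
proof -
  have "(\<lambda>x. indicator \<Omega> x *\<^sub>R f x) \<in> borel_measurable lebesgue"
    using assms by (subst (asm) borel_measurable_restrict_space_iff) auto
  then obtain g where g: "g \<in> borel_measurable borel" "AE x in lborel. indicator \<Omega> x *\<^sub>R f x = g x"
    by (rule lebesgue_ex_borel_measurable)
  from g(2) have "AE x in lborel. x \<in> \<Omega> \<longrightarrow> f x = g x"
    by eventually_elim auto
  with g(1) show ?thesis by (rule that)
qed

lemma Lebesgue_1_loc_ex_borel:
  fixes f :: "'a::euclidean_space \<Rightarrow> 'b::euclidean_space"
  assumes "open \<Omega>" "f \<in> Lebesgue_1_loc \<Omega>"
  obtains g where "g \<in> borel_measurable borel" "AE x in lborel. x \<in> \<Omega> \<longrightarrow> f x = g x"
    "g \<in> Lebesgue_1_loc \<Omega>"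
proof -
  obtain g where g: "g \<in> borel_measurable borel" "AE x in lborel. x \<in> \<Omega> \<longrightarrow> f x = g x"
    by (rule lebesgue_on_ex_borel_measurable[OF assms(1) Lebesgue_1_loc_measurable[OF assms]])
  with Lebesgue_1_loc_cong_AE[OF g(2) assms(2)] show ?thesis by (intro that)
qed

text \<open>The defining identity only sees integrals. Replacing an integrand by an almost equal one
  calls for measurability on both sides; it comes from local integrability and from continuity of
  the test function and its partial derivatives.\<close>

lemma has_weak_gradient_cong_AE:
  assumes \<Omega>: "open \<Omega>"
    and u: "AE x in lborel. x \<in> \<Omega> \<longrightarrow> u x = u' x"
    and G: "AE x in lborel. x \<in> \<Omega> \<longrightarrow> G x = G' x"
    and w: "has_weak_gradient \<Omega> u G"
  shows "has_weak_gradient \<Omega> u' G'"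
proof -
  have "u \<in> Lebesgue_1_loc \<Omega>" "G \<in> Lebesgue_1_loc \<Omega>" using w by (auto simp: has_weak_gradient_def)
  note l1 = this Lebesgue_1_loc_cong_AE[OF u this(1)] Lebesgue_1_loc_cong_AE[OF G this(2)]
  note [measurable] = l1[THEN Lebesgue_1_loc_measurable[OF \<Omega>]]
  have eq: "LINT x|lebesgue_on \<Omega>. u x * h x = LINT x|lebesgue_on \<Omega>. u' x * h x"
      "LINT x|lebesgue_on \<Omega>. (G x \<bullet> i) * h x = LINT x|lebesgue_on \<Omega>. (G' x \<bullet> i) * h x"
    if "continuous_on UNIV h" for h :: "'a \<Rightarrow> real" and i
  proof -
    have [measurable]: "h \<in> borel_measurable (lebesgue_on \<Omega>)"
      using that continuous_imp_measurable_on_sets_lebesgue[of \<Omega> h] \<Omega>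
      by (simp add: continuous_on_subset)
    show "LINT x|lebesgue_on \<Omega>. u x * h x = LINT x|lebesgue_on \<Omega>. u' x * h x"
      using u by (intro integral_cong_AE) (auto simp: AE_lebesgue_on_iff[OF \<Omega>])
    show "LINT x|lebesgue_on \<Omega>. (G x \<bullet> i) * h x = LINT x|lebesgue_on \<Omega>. (G' x \<bullet> i) * h x"
      using G by (intro integral_cong_AE) (auto simp: AE_lebesgue_on_iff[OF \<Omega>])
  qed
  show ?thesis
    unfolding has_weak_gradient_def
  proof (intro conjI allI impI)
    fix \<phi> and i :: 'a assume \<phi>: "test_function \<Omega> \<phi> \<and> i \<in> Basis"
    then have "C_k (Suc 0) \<phi>" by (auto simp: test_function_def)
    then have "continuous_on UNIV (\<lambda>x. frechet_derivative \<phi> (at x) i)" "continuous_on UNIV \<phi>"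
      using \<phi> C_k_imp_continuous_on[of "Suc 0" \<phi>] by auto
    from eq(1)[OF this(1)] eq(2)[OF this(2)]
    show "LINT x|lebesgue_on \<Omega>. u' x * frechet_derivative \<phi> (at x) i =
        - (LINT x|lebesgue_on \<Omega>. (G' x \<bullet> i) * \<phi> x)"
      using w \<phi> by (simp add: has_weak_gradient_def)
  qed (use l1 in auto)
qed

section \<open>Weak gradients of Borel functions, tested by integrals over the whole space\<close>

lemma LINT_lebesgue_on_eq_lborel:
  fixes h :: "'a::euclidean_space \<Rightarrow> real"
  assumes "open \<Omega>" "h \<in> borel_measurable borel" "\<And>x. x \<notin> \<Omega> \<Longrightarrow> h x = 0"
  shows "(LINT x|lebesgue_on \<Omega>. h x) = (LINT x|lborel. h x)"
proof -
  have "(LINT x|lebesgue_on \<Omega>. h x) = (LINT x|lebesgue. indicator \<Omega> x *\<^sub>R h x)"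
    using assms(1) by (intro integral_restrict_space) auto
  also have "(\<lambda>x. indicator \<Omega> x *\<^sub>R h x) = h" using assms(3) by (intro ext) (auto split: split_indicator)
  also have "(LINT x|lebesgue. h x) = (LINT x|lborel. h x)"
    using assms(2) by (intro integral_completion) simp
  finally show ?thesis .
qed

lemma test_function_eq_0:
  assumes "test_function \<Omega> \<phi>" "x \<notin> closure {x. \<phi> x \<noteq> 0}"
  shows "\<phi> x = 0" "frechet_derivative \<phi> (at x) = (\<lambda>h. 0)"
proof -
  show "\<phi> x = 0" using assms(2) closure_subset[of "{x. \<phi> x \<noteq> 0}"] by auto
  have "((\<lambda>x. 0) has_derivative (\<lambda>h. 0)) (at x)" by simp
  then have "(\<phi> has_derivative (\<lambda>h. 0)) (at x)"
  proof (rule has_derivative_transform_within_open)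
    show "open (- closure {x. \<phi> x \<noteq> 0})" by auto
    show "0 = \<phi> y" if "y \<in> - closure {x. \<phi> x \<noteq> 0}" for y
      using that closure_subset[of "{x. \<phi> x \<noteq> 0}"] by auto
  qed (use assms in auto)
  from frechet_derivative_at[OF this] show "frechet_derivative \<phi> (at x) = (\<lambda>h. 0)" by simp
qed

lemma test_function_measurable:
  assumes "test_function \<Omega> \<phi>"
  shows "\<phi> \<in> borel_measurable borel"
    and "i \<in> Basis \<Longrightarrow> (\<lambda>x. frechet_derivative \<phi> (at x) i) \<in> borel_measurable borel"
proof -
  have "C_k (Suc 0) \<phi>" using assms by (auto simp: test_function_def)
  then show "\<phi> \<in> borel_measurable borel"
      "i \<in> Basis \<Longrightarrow> (\<lambda>x. frechet_derivative \<phi> (at x) i) \<in> borel_measurable borel"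
    using C_k_imp_continuous_on[of "Suc 0" \<phi>] by (auto intro: borel_measurable_continuous_onI)
qed

lemma weak_gradientD:
  assumes \<Omega>: "open \<Omega>" and w: "has_weak_gradient \<Omega> u G" and \<phi>: "test_function \<Omega> \<phi>" and i: "i \<in> Basis"
    and [measurable]: "u \<in> borel_measurable borel" "G \<in> borel_measurable borel"
  shows "(LINT x|lborel. u x * frechet_derivative \<phi> (at x) i) = - (LINT x|lborel. (G x \<bullet> i) * \<phi> x)"
proof -
  note [measurable] = test_function_measurable(1)[OF \<phi>] test_function_measurable(2)[OF \<phi> i]
  have out: "x \<notin> closure {x. \<phi> x \<noteq> 0}" if "x \<notin> \<Omega>" for x
    using that \<phi> by (auto simp: test_function_def)
  have "(LINT x|lebesgue_on \<Omega>. u x * frechet_derivative \<phi> (at x) i) =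
      (LINT x|lborel. u x * frechet_derivative \<phi> (at x) i)"
    by (rule LINT_lebesgue_on_eq_lborel[OF \<Omega>]) (measurable, simp add: test_function_eq_0[OF \<phi> out])
  moreover have "(LINT x|lebesgue_on \<Omega>. (G x \<bullet> i) * \<phi> x) = (LINT x|lborel. (G x \<bullet> i) * \<phi> x)"
    by (rule LINT_lebesgue_on_eq_lborel[OF \<Omega>]) (measurable, simp add: test_function_eq_0[OF \<phi> out])
  moreover have "(LINT x|lebesgue_on \<Omega>. u x * frechet_derivative \<phi> (at x) i) =
      - (LINT x|lebesgue_on \<Omega>. (G x \<bullet> i) * \<phi> x)"
    using w \<phi> i unfolding has_weak_gradient_def by blast
  ultimately show ?thesis by simp
qed

lemma abs_mult_box_bump_le: "\<bar>c * box_bump m a b x\<bar> \<le> \<bar>c\<bar>"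
  using mult_left_mono[OF box_bump_bounds(2)[of m a b x], of "\<bar>c\<bar>"] box_bump_bounds(1)[of m a b x]
  by (simp add: abs_mult)

lemma LINT_box_bump_tendsto:
  assumes "integrable lborel f"
  shows "(\<lambda>m. LINT x|lborel. f x * box_bump m a b x) \<longlonglongrightarrow> (LINT x:box a b|lborel. f x)"
  unfolding set_lebesgue_integral_def
proof (rule integral_dominated_convergence[where w = "\<lambda>x. norm (f x)"])
  note [measurable] = borel_measurable_integrable[OF assms]
  show "(\<lambda>x. f x * box_bump m a b x) \<in> borel_measurable lborel" for m by measurable
  show "(\<lambda>x. indicator (box a b) x *\<^sub>R f x) \<in> borel_measurable lborel" by measurable
  show "AE x in lborel. (\<lambda>m. f x * box_bump m a b x) \<longlonglongrightarrow> indicator (box a b) x *\<^sub>R f x"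
    by (auto simp: mult.commute[of "indicator _ _"] intro!: tendsto_mult box_bump_tendsto)
  show "AE x in lborel. norm (f x * box_bump m a b x) \<le> norm (f x)" for m
    by (simp add: abs_mult_box_bump_le)
qed (use assms in auto)

text \<open>Both candidates have the same integral against every smooth cutoff of a box. In the
  limit of the cutoffs they have the same integral over every box, coordinate by coordinate, and
  thus agree almost everywhere.\<close>

lemma weak_gradient_unique:
  assumes \<Omega>: "open \<Omega>" and w: "has_weak_gradient \<Omega> u G" "has_weak_gradient \<Omega> u G'"
  shows "AE x in lborel. x \<in> \<Omega> \<longrightarrow> G x = G' x"
proof -
  have l1: "u \<in> Lebesgue_1_loc \<Omega>" "G \<in> Lebesgue_1_loc \<Omega>" "G' \<in> Lebesgue_1_loc \<Omega>"
    using w by (auto simp: has_weak_gradient_def)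
  obtain u0 where u: "u0 \<in> borel_measurable borel" "AE x in lborel. x \<in> \<Omega> \<longrightarrow> u x = u0 x"
    by (rule Lebesgue_1_loc_ex_borel[OF \<Omega> l1(1)]) (rule that)
  obtain G0 where G: "G0 \<in> borel_measurable borel" "AE x in lborel. x \<in> \<Omega> \<longrightarrow> G x = G0 x"
      "G0 \<in> Lebesgue_1_loc \<Omega>"
    by (rule Lebesgue_1_loc_ex_borel[OF \<Omega> l1(2)]) (rule that)
  obtain G0' where G': "G0' \<in> borel_measurable borel" "AE x in lborel. x \<in> \<Omega> \<longrightarrow> G' x = G0' x"
      "G0' \<in> Lebesgue_1_loc \<Omega>"
    by (rule Lebesgue_1_loc_ex_borel[OF \<Omega> l1(3)]) (rule that)
  have w0: "has_weak_gradient \<Omega> u0 G0" "has_weak_gradient \<Omega> u0 G0'"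
    by (rule has_weak_gradient_cong_AE[OF \<Omega> u(2) G(2) w(1)], rule has_weak_gradient_cong_AE[OF \<Omega> u(2) G'(2) w(2)])
  have "AE x in lborel. x \<in> \<Omega> \<longrightarrow> (G0 x - G0' x) \<bullet> i = 0" if i: "i \<in> Basis" for i
  proof (rule AE_zero_if_box_integrals_zero[OF \<Omega>])
    fix a b :: 'a assume ab: "cbox a b \<subseteq> \<Omega>"
    have int: "set_integrable lborel (cbox a b) (\<lambda>x. G0 x \<bullet> i)" "set_integrable lborel (cbox a b) (\<lambda>x. G0' x \<bullet> i)"
      using G(3)[unfolded Lebesgue_1_loc_borel_iff[OF G(1)]] G'(3)[unfolded Lebesgue_1_loc_borel_iff[OF G'(1)]] ab
      by (simp_all add: set_integrable_inner)
    then show int': "set_integrable lborel (cbox a b) (\<lambda>x. (G0 x - G0' x) \<bullet> i)"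
      by (simp add: inner_diff_left set_integral_diff)
    \<comment> \<open>Cutting off at the closed box makes the difference integrable on the whole
      space and leaves its product with the cutoff function unchanged.\<close>
    let ?H = "\<lambda>x. indicator (cbox a b) x * ((G0 x - G0' x) \<bullet> i)"
    have "(LINT x|lborel. ?H x * box_bump m a b x) = 0" for m
    proof -
      have t: "test_function \<Omega> (box_bump m a b)" by (rule test_function_box_bump[OF ab])
      have "(LINT x|lborel. (G0 x \<bullet> i) * box_bump m a b x) = (LINT x|lborel. (G0' x \<bullet> i) * box_bump m a b x)"
        using weak_gradientD[OF \<Omega> w0(1) t i u(1) G(1)] weak_gradientD[OF \<Omega> w0(2) t i u(1) G'(1)] by simp
      moreover have "integrable lborel (\<lambda>x. (g x \<bullet> i) * box_bump m a b x)"
        if "set_integrable lborel (cbox a b) (\<lambda>x. g x \<bullet> i)" "g \<in> borel_measurable borel" for g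
      proof (rule Bochner_Integration.integrable_bound[OF that(1)[unfolded set_integrable_def]])
        show "AE x in lborel. norm ((g x \<bullet> i) * box_bump m a b x) \<le> norm (indicator (cbox a b) x *\<^sub>R (g x \<bullet> i))"
        proof (rule AE_I2)
          show "norm ((g x \<bullet> i) * box_bump m a b x) \<le> norm (indicator (cbox a b) x *\<^sub>R (g x \<bullet> i))" for x
            by (cases "x \<in> cbox a b") (simp_all add: abs_mult_box_bump_le box_bump_eq_0_cbox)
        qed
      qed (use that(2) in simp)
      ultimately have "(LINT x|lborel. (G0 x \<bullet> i) * box_bump m a b x - (G0' x \<bullet> i) * box_bump m a b x) = 0"
        using int G(1) G'(1) by simp
      moreover have "(\<lambda>x. ?H x * box_bump m a b x) =
          (\<lambda>x. (G0 x \<bullet> i) * box_bump m a b x - (G0' x \<bullet> i) * box_bump m a b x)"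
      proof
        show "?H x * box_bump m a b x = (G0 x \<bullet> i) * box_bump m a b x - (G0' x \<bullet> i) * box_bump m a b x" for x
          by (cases "x \<in> cbox a b") (simp_all add: box_bump_eq_0_cbox inner_diff_left left_diff_distrib)
      qed
      ultimately show ?thesis by simp
    qed
    moreover have "(\<lambda>m. LINT x|lborel. ?H x * box_bump m a b x) \<longlonglongrightarrow> (LINT x:box a b|lborel. ?H x)"
      using int' by (intro LINT_box_bump_tendsto) (simp add: set_integrable_def)
    ultimately have "(LINT x:box a b|lborel. ?H x) = 0"
      by (simp add: LIMSEQ_const_iff)
    moreover have "(LINT x:box a b|lborel. ?H x) = (LINT x:box a b|lborel. (G0 x - G0' x) \<bullet> i)"
      by (intro set_lebesgue_integral_cong) (auto dest: subsetD[OF box_subset_cbox])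
    ultimately show "(LINT x:box a b|lborel. (G0 x - G0' x) \<bullet> i) = 0" by simp
  qed
  then have "AE x in lborel. \<forall>i\<in>Basis. x \<in> \<Omega> \<longrightarrow> (G0 x - G0' x) \<bullet> i = 0"
    by (rule AE_finite_allI[OF finite_Basis])
  with G(2) G'(2) show ?thesis
  proof eventually_elim
    case (elim x)
    show ?case
    proof
      assume x: "x \<in> \<Omega>"
      have "G0 x = G0' x"
      proof (rule euclidean_eqI)
        fix j :: 'a assume "j \<in> Basis"
        with elim(3) x have "(G0 x - G0' x) \<bullet> j = 0" by blast
        then show "G0 x \<bullet> j = G0' x \<bullet> j" by (simp add: inner_diff_left)
      qed
      with elim x show "G x = G' x" by simp
    qed
  qed
qed

section \<open>Weakly differentiable functions along coordinate lines\<close>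

lemma lborel_integral_shift:
  fixes f :: "'a::euclidean_space \<Rightarrow> 'b::{banach, second_countable_topology}"
  assumes "f \<in> borel_measurable borel"
  shows "(LINT x|lborel. f (x + c)) = (LINT x|lborel. f x)"
    and "integrable lborel (\<lambda>x. f (x + c)) \<longleftrightarrow> integrable lborel f"
proof -
  have "(LINT x|distr lborel borel ((+) c). f x) = (LINT x|lborel. f (c + x))"
    using assms by (intro integral_distr) auto
  then show "(LINT x|lborel. f (x + c)) = (LINT x|lborel. f x)"
    by (simp add: lborel_distr_plus add.commute)
  have "integrable (distr lborel borel ((+) c)) f \<longleftrightarrow> integrable lborel (\<lambda>x. f (c + x))"
    using assms by (intro integrable_distr_eq) auto
  then show "integrable lborel (\<lambda>x. f (x + c)) \<longleftrightarrow> integrable lborel f"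
    by (simp add: lborel_distr_plus add.commute)
qed

lemma AE_lborel_shift:
  fixes c :: "'a::euclidean_space"
  assumes "AE x in lborel. P x"
  shows "AE x in lborel. P (x + c)"
proof -
  have "AE x in distr lborel borel ((+) c). P x"
    unfolding lborel_distr_plus by (rule assms)
  then have "AE x in lborel. P (c + x)"
    by (rule AE_distrD[rotated]) simp
  then show ?thesis by (simp add: add.commute)
qed

text \<open>By translation invariance the integral of
  \<open>\<bar>f (x + s *\<^sub>R e)\<bar>\<close> over \<open>x\<close> is the same for every
  \<open>s\<close>, hence integrable over a bounded range of \<open>s\<close>. The case
  \<open>e = 0\<close> is also used, for integrands that do not move.\<close>

lemma integrable_shift_along:
  fixes f :: "'a::euclidean_space \<Rightarrow> real"
  assumes f: "integrable lborel f"
  shows "integrable (lborel \<Otimes>\<^sub>M lborel) (\<lambda>(x, s). indicator {0..t} s * f (x + s *\<^sub>R e))"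
proof -
  have [measurable]: "f \<in> borel_measurable borel" using f by auto
  have "integrable (lborel \<Otimes>\<^sub>M lborel) (\<lambda>(s, x). indicator {0..t} s * f (x + s *\<^sub>R e))"
  proof (rule lborel_pair.Fubini_integrable)
    have "(\<lambda>s. indicator {0..t} s * (LINT x|lborel. \<bar>f x\<bar>)) =
        (\<lambda>s. LINT x|lborel. norm (case (s, x) of (s, x) \<Rightarrow> indicator {0..t} s * f (x + s *\<^sub>R e)))"
      using lborel_integral_shift(1)[of "\<lambda>x. \<bar>f x\<bar>"] by (auto simp: abs_mult)
    moreover have "integrable lborel (\<lambda>s. indicator {0..t} s * (LINT x|lborel. \<bar>f x\<bar>))"
      by (auto intro!: integrable_mult_left integrable_real_indicator simp: emeasure_lborel_Icc_eq)
    ultimately show "integrable lborel (\<lambda>s. LINT x|lborel.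
        norm (case (s, x) of (s, x) \<Rightarrow> indicator {0..t} s * f (x + s *\<^sub>R e)))"
      by simp
    show "AE s in lborel. integrable lborel (\<lambda>x. case (s, x) of (s, x) \<Rightarrow> indicator {0..t} s * f (x + s *\<^sub>R e))"
      using f by (simp add: lborel_integral_shift(2))
  qed measurable
  from lborel_pair.integrable_product_swap[OF this] show ?thesis
    by (simp add: case_prod_unfold)
qed

section \<open>Segments that stay inside the domain\<close>

definition line_inside :: "'a::euclidean_space set \<Rightarrow> 'a \<Rightarrow> 'a \<Rightarrow> real \<Rightarrow> bool" where
  "line_inside \<Omega> e x t \<longleftrightarrow> (\<forall>s\<in>{0..t}. x + s *\<^sub>R e \<in> \<Omega>)"

lemma line_inside_mono: "line_inside \<Omega> e x t \<Longrightarrow> s \<le> t \<Longrightarrow> line_inside \<Omega> e x s"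
  by (auto simp: line_inside_def)

text \<open>Rescaling the parameter to the unit interval makes its range independent of
  \<open>t\<close>, so that one compact factor serves all pairs of a point and a length.\<close>

lemma line_inside_scaled:
  assumes "t \<ge> 0"
  shows "line_inside \<Omega> e x t \<longleftrightarrow> (\<forall>\<theta>\<in>{0..1}. x + (\<theta> * t) *\<^sub>R e \<in> \<Omega>)"
proof
  assume *: "\<forall>\<theta>\<in>{0..1}. x + (\<theta> * t) *\<^sub>R e \<in> \<Omega>"
  show "line_inside \<Omega> e x t"
    unfolding line_inside_def
  proof
    fix s assume s: "s \<in> {0..t}"
    show "x + s *\<^sub>R e \<in> \<Omega>"
      using bspec[OF *, of "s / t"] s by (cases "t = 0") auto
  qed
qed (use assms in \<open>auto simp: line_inside_def mult_left_le_one_le\<close>)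

text \<open>The complement is the projection, along the compact parameter interval, of the closed
  set of triples whose moved point leaves \<Omega>; such a projection is closed.\<close>

lemma open_line_inside_scaled:
  fixes \<Omega> :: "'a::euclidean_space set"
  assumes "open \<Omega>"
  shows "open {z. \<forall>\<theta>\<in>{0..1::real}. fst z + (\<theta> * snd z) *\<^sub>R e \<in> \<Omega>}"
proof -
  let ?T = "(\<lambda>(\<theta>, z). fst z + (\<theta> * snd z) *\<^sub>R e) -` (- \<Omega>) :: (real \<times> 'a \<times> real) set"
  have "closed ?T"
    using assms by (intro closed_vimage) (auto simp: case_prod_unfold intro!: continuous_intros)
  then have "closed {z. \<exists>\<theta>. \<theta> \<in> {0..1::real} \<and> (\<theta>, z) \<in> ?T}"
    by (intro closed_compact_projection) auto
  then have "open (- {z. \<exists>\<theta>. \<theta> \<in> {0..1::real} \<and> (\<theta>, z) \<in> ?T})" by (rule open_Compl)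
  also have "- {z. \<exists>\<theta>. \<theta> \<in> {0..1::real} \<and> (\<theta>, z) \<in> ?T} =
      {z. \<forall>\<theta>\<in>{0..1::real}. fst z + (\<theta> * snd z) *\<^sub>R e \<in> \<Omega>}"
    by auto
  finally show ?thesis .
qed

lemma open_line_inside:
  assumes "open \<Omega>"
  shows "open {x. line_inside \<Omega> e x t}"
proof (cases "t \<ge> 0")
  case True
  have "open ((\<lambda>x. (x, t)) -` {z. \<forall>\<theta>\<in>{0..1}. fst z + (\<theta> * snd z) *\<^sub>R e \<in> \<Omega>})"
    by (intro open_vimage open_line_inside_scaled assms continuous_intros)
  then show ?thesis using True by (simp add: line_inside_scaled vimage_def)
\<comment> \<open>For negative \<open>t\<close> there are no parameters, the condition holds
  vacuously and the set is the whole space.\<close>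
qed (auto simp: line_inside_def)

lemma pred_line_inside:
  assumes "open \<Omega>"
  shows "Measurable.pred (borel \<Otimes>\<^sub>M borel) (\<lambda>z. line_inside \<Omega> e (fst z) (snd z))"
proof -
  define A where "A = {z. \<forall>\<theta>\<in>{0..1}. fst z + (\<theta> * snd z) *\<^sub>R e \<in> \<Omega>}"
  have [measurable]: "A \<in> sets (borel \<Otimes>\<^sub>M borel)"
    unfolding borel_prod A_def using open_line_inside_scaled[OF assms, of e] by (rule borel_open)
  have eq: "line_inside \<Omega> e (fst z) (snd z) \<longleftrightarrow> (snd z < 0 \<or> z \<in> A)" for z
    using line_inside_scaled[of "snd z" \<Omega> e "fst z"]
    by (cases "snd z < 0") (auto simp: line_inside_def A_def)
  show ?thesis unfolding eq by measurable
qed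

text \<open>This is absolute continuity on almost all lines, the classical description of Sobolev
  functions, expressed without modifying \<open>u\<close> on a null set. For a good \<open>x\<close>
  the formula may fail on a null set of parameters, which no integral along the line can
  see.\<close>

definition abs_cont_on_lines ::
    "'a::euclidean_space set \<Rightarrow> 'a \<Rightarrow> ('a \<Rightarrow> real) \<Rightarrow> ('a \<Rightarrow> real) \<Rightarrow> bool" where
  "abs_cont_on_lines \<Omega> e u g \<longleftrightarrow>
     (AE x in lborel. AE t in lborel. 0 \<le> t \<and> line_inside \<Omega> e x t \<longrightarrow>
        set_integrable lborel {0..t} (\<lambda>s. g (x + s *\<^sub>R e)) \<and>
        u (x + t *\<^sub>R e) - u x = (LINT s:{0..t}|lborel. g (x + s *\<^sub>R e)))"

lemma indicator_Icc: "indicator {0..t} s = (if 0 \<le> s \<and> s \<le> t then 1 else (0::real))" for s t :: real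
  by (simp add: indicator_def)

text \<open>Weak gradients give the formula for each \<open>t\<close> at almost all
  \<open>x\<close>, whereas the chain rule works on a fixed line with almost all \<open>t\<close>.
  The pairs for which the formula holds form a jointly measurable set, and Fubini's theorem for null
  sets exchanges the two quantifiers.\<close>

lemma abs_cont_on_lines_commute:
  assumes \<Omega>: "open \<Omega>" and [measurable]: "u \<in> borel_measurable borel" "g \<in> borel_measurable borel"
  shows "abs_cont_on_lines \<Omega> e u g \<longleftrightarrow>
     (AE t in lborel. AE x in lborel. 0 \<le> t \<and> line_inside \<Omega> e x t \<longrightarrow>
        set_integrable lborel {0..t} (\<lambda>s. g (x + s *\<^sub>R e)) \<and>
        u (x + t *\<^sub>R e) - u x = (LINT s:{0..t}|lborel. g (x + s *\<^sub>R e)))"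
proof -
  note [measurable] = pred_line_inside[OF \<Omega>]
  define P where "P x t \<longleftrightarrow> (0 \<le> t \<and> line_inside \<Omega> e x t \<longrightarrow>
      integrable lborel (\<lambda>s. (if 0 \<le> s \<and> s \<le> t then 1 else 0) *\<^sub>R g (x + s *\<^sub>R e)) \<and>
      u (x + t *\<^sub>R e) - u x = (LINT s|lborel. (if 0 \<le> s \<and> s \<le> t then 1 else 0) *\<^sub>R g (x + s *\<^sub>R e)))"
    for x t
  have "Measurable.pred (lborel \<Otimes>\<^sub>M lborel) (\<lambda>z. P (fst z) (snd z))"
    unfolding P_def by measurable
  then have "(AE x in lborel. AE t in lborel. P x t) \<longleftrightarrow> (AE t in lborel. AE x in lborel. P x t)"
    unfolding pred_def by (rule lborel_pair.AE_commute)
  then show ?thesis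
    unfolding abs_cont_on_lines_def set_integrable_def set_lebesgue_integral_def indicator_Icc P_def .
qed

lemma cbox_sweep:
  fixes a b i :: "'a::euclidean_space"
  assumes i: "i \<in> Basis" and t: "t \<ge> 0"
  shows "x \<in> cbox a b \<Longrightarrow> s \<in> {0..t} \<Longrightarrow> x + s *\<^sub>R i \<in> cbox a (b + t *\<^sub>R i)"
    and "cbox a b \<noteq> {} \<Longrightarrow> cbox a b \<subseteq> {x. line_inside \<Omega> i x t} \<Longrightarrow> cbox a (b + t *\<^sub>R i) \<subseteq> \<Omega>"
proof -
  assume x: "x \<in> cbox a b" and s: "s \<in> {0..t}"
  have "a \<bullet> j \<le> x \<bullet> j + s * (i \<bullet> j) \<and> x \<bullet> j + s * (i \<bullet> j) \<le> b \<bullet> j + t * (i \<bullet> j)" if "j \<in> Basis" for j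
    using x s i that by (auto simp: mem_box inner_Basis intro: add_increasing2)
  then show "x + s *\<^sub>R i \<in> cbox a (b + t *\<^sub>R i)"
    by (auto simp: mem_box inner_add_left)
next
  assume ne: "cbox a b \<noteq> {}" and sub: "cbox a b \<subseteq> {x. line_inside \<Omega> i x t}"
  show "cbox a (b + t *\<^sub>R i) \<subseteq> \<Omega>"
  proof
    fix y assume y: "y \<in> cbox a (b + t *\<^sub>R i)"
    \<comment> \<open>This is the least displacement that brings \<open>y\<close> back below the
      upper face of \<open>cbox a b\<close>. Nonemptiness gives
      \<open>a \<bullet> i \<le> b \<bullet> i\<close>, so the point brought back does not fall
      below the lower face.\<close>
    define s where "s = max 0 (y \<bullet> i - b \<bullet> i)"
    have yi: "a \<bullet> j \<le> y \<bullet> j" "y \<bullet> j \<le> b \<bullet> j + t * (i \<bullet> j)" if "j \<in> Basis" for j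
      using y that by (auto simp: mem_box inner_add_left)
    have s: "s \<in> {0..t}" using yi[OF i] i t by (auto simp: s_def)
    have "a \<bullet> j \<le> y \<bullet> j - s * (i \<bullet> j) \<and> y \<bullet> j - s * (i \<bullet> j) \<le> b \<bullet> j" if j: "j \<in> Basis" for j
    proof (cases "j = i")
      case True
      then show ?thesis using yi[OF i] i ne by (auto simp: s_def box_ne_empty max_def)
    next
      case False
      then show ?thesis using yi[OF j] i j by (simp add: inner_not_same_Basis)
    qed
    then have "y - s *\<^sub>R i \<in> cbox a b" by (auto simp: mem_box inner_diff_left)
    with sub s have "(y - s *\<^sub>R i) + s *\<^sub>R i \<in> \<Omega>" unfolding line_inside_def by blast
    then show "y \<in> \<Omega>" by simp
  qed
qed

text \<open>Testing with the swept cutoff is an integrated form of the fundamental theorem of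
  calculus: its derivative along \<open>i\<close> is the cutoff minus its translate. Once the
  cutoffs tend to the indicator of the box, translation invariance moves the shifts from the box to
  \<open>u\<close> and \<open>G\<close>, which leaves the increment formula integrated over the
  box.\<close>

lemma weak_gradient_increment_cbox:
  fixes u :: "'a::euclidean_space \<Rightarrow> real"
  assumes \<Omega>: "open \<Omega>" and w: "has_weak_gradient \<Omega> u G"
    and [measurable]: "u \<in> borel_measurable borel" "G \<in> borel_measurable borel"
    and i: "i \<in> Basis" and t: "t \<ge> 0"
    and K: "cbox a (b + t *\<^sub>R i) \<subseteq> \<Omega>"
  defines "D \<equiv> \<lambda>x. u (x + t *\<^sub>R i) - u x - (LINT s:{0..t}|lborel. G (x + s *\<^sub>R i) \<bullet> i)"
  shows "AE x in lborel. x \<in> cbox a b \<longrightarrow> set_integrable lborel {0..t} (\<lambda>s. G (x + s *\<^sub>R i) \<bullet> i)"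
    and "set_integrable lborel (cbox a b) D"
    and "(LINT x:box a b|lborel. D x) = 0"
proof -
  define K where "K = cbox a (b + t *\<^sub>R i)"
  \<comment> \<open>The functions are cut off at the compact set swept by the box, where they are
    integrable; on the segments starting in the box nothing changes.\<close>
  define u1 where "u1 x = indicator K x * u x" for x
  define g1 where "g1 x = indicator K x * (G x \<bullet> i)" for x
  define I where "I x = (LINT s|lborel. indicator {0..t} s * g1 (x + s *\<^sub>R i))" for x
  have K[measurable]: "K \<in> sets borel" "compact K" "K \<subseteq> \<Omega>" using assms(7) by (auto simp: K_def)
  have uG: "set_integrable lborel K u" "set_integrable lborel K G"
    using w K Lebesgue_1_loc_borel_iff[of u \<Omega>] Lebesgue_1_loc_borel_iff[of G \<Omega>]
    by (auto simp: has_weak_gradient_def)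
  have u1: "integrable lborel u1" using uG(1) by (simp add: u1_def[abs_def] set_integrable_def)
  have g1: "integrable lborel g1"
    using set_integrable_inner[OF uG(2)] by (simp add: g1_def[abs_def] set_integrable_def)
  have [measurable]: "u1 \<in> borel_measurable borel" "g1 \<in> borel_measurable borel"
    using u1 g1 by auto
  have inK: "x + s *\<^sub>R i \<in> K" if "x \<in> cbox a b" "s \<in> {0..t}" for x s
    using cbox_sweep(1)[OF i t] that by (auto simp: K_def)
  have inK0: "x \<in> K" if "x \<in> cbox a b" for x using inK[of x 0] that t by simp
  have bb0: "box_bump m a b (x - s *\<^sub>R i) = 0" if "x \<notin> K" "s \<in> {0..t}" for m x s
    using inK[of "x - s *\<^sub>R i" s] that by (intro box_bump_eq_0_cbox) auto
  note sh = integrable_shift_along[OF g1, of t i]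
  have D_eq: "D x = u1 (x + t *\<^sub>R i) - u1 x - I x" if "x \<in> cbox a b" for x
  proof -
    have "I x = (LINT s:{0..t}|lborel. G (x + s *\<^sub>R i) \<bullet> i)"
      unfolding I_def set_lebesgue_integral_def
      by (intro Bochner_Integration.integral_cong) (use that inK in \<open>auto simp: g1_def split: split_indicator\<close>)
    then show ?thesis using that inK[of x t] inK0 t by (simp add: D_def u1_def)
  qed
  have I: "integrable lborel I"
    using lborel_pair.integrable_fst'[OF sh] by (simp add: I_def[abs_def])
  then have [measurable]: "I \<in> borel_measurable borel" by auto
  have D1: "integrable lborel (\<lambda>x. u1 (x + t *\<^sub>R i) - u1 x - I x)"
    using u1 I lborel_integral_shift(2)[of u1] by auto
  show "AE x in lborel. x \<in> cbox a b \<longrightarrow> set_integrable lborel {0..t} (\<lambda>s. G (x + s *\<^sub>R i) \<bullet> i)"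
    using lborel_pair.AE_integrable_fst'[OF sh]
  proof eventually_elim
    case (elim x)
    show ?case
    proof
      assume "x \<in> cbox a b"
      then have "(\<lambda>s. indicator {0..t} s * g1 (x + s *\<^sub>R i)) = (\<lambda>s. indicator {0..t} s *\<^sub>R (G (x + s *\<^sub>R i) \<bullet> i))"
        using inK by (auto simp: g1_def split: split_indicator)
      with elim show "set_integrable lborel {0..t} (\<lambda>s. G (x + s *\<^sub>R i) \<bullet> i)"
        by (simp add: set_integrable_def)
    qed
  qed
  have "set_integrable lborel (cbox a b) (\<lambda>x. u1 (x + t *\<^sub>R i) - u1 x - I x)"
    unfolding set_integrable_def using D1 by (intro integrable_mult_indicator) auto
  then show "set_integrable lborel (cbox a b) D"
    by (rule set_integrable_cong[THEN iffD1, rotated -1]) (auto simp: D_eq)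
  \<comment> \<open>The swept cutoff is inserted into the definition of the weak gradient.
    Everything is supported in \<open>K\<close>, so \<open>u\<close> and \<open>G\<close> may be
    replaced by their cut-off versions, and the sweep becomes an integral over pairs.\<close>
  have weak: "(LINT x|lborel. u1 x * (box_bump m a b x - box_bump m a b (x - t *\<^sub>R i))) =
      - (LINT z|(lborel \<Otimes>\<^sub>M lborel). indicator {0..t} (snd z) * g1 (fst z) * box_bump m a b (fst z - snd z *\<^sub>R i))" for m
  proof -
    let ?\<phi> = "\<lambda>x. LINT s:{0..t}|lborel. box_bump m a b (x - s *\<^sub>R i)"
    note \<phi> = swept_box_bump[OF i t assms(7), where m = m]
    have "(LINT x|lborel. u x * frechet_derivative ?\<phi> (at x) i) = - (LINT x|lborel. (G x \<bullet> i) * ?\<phi> x)"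
      by (rule weak_gradientD[OF \<Omega> w \<phi>(1) i]) measurable
    also have "(\<lambda>x. u x * frechet_derivative ?\<phi> (at x) i) =
        (\<lambda>x. u1 x * (box_bump m a b x - box_bump m a b (x - t *\<^sub>R i)))"
      using bb0[of _ 0] bb0[of _ t] t by (auto simp: \<phi>(3) u1_def split: split_indicator)
    also have "(\<lambda>x. (G x \<bullet> i) * ?\<phi> x) =
        (\<lambda>x. LINT s|lborel. indicator {0..t} s * g1 x * box_bump m a b (x - s *\<^sub>R i))"
    proof
      fix x
      have "(G x \<bullet> i) * ?\<phi> x = g1 x * ?\<phi> x"
        using \<phi>(2)[where x = x] by (cases "x \<in> K") (auto simp: g1_def K_def)
      also have "\<dots> = (LINT s|lborel. g1 x * (indicator {0..t} s * box_bump m a b (x - s *\<^sub>R i)))"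
        by (simp add: set_lebesgue_integral_def)
      finally show "(G x \<bullet> i) * ?\<phi> x = (LINT s|lborel. indicator {0..t} s * g1 x * box_bump m a b (x - s *\<^sub>R i))"
        by (simp add: mult_ac)
    qed
    also have "(LINT x|lborel. LINT s|lborel. indicator {0..t} s * g1 x * box_bump m a b (x - s *\<^sub>R i)) =
        (LINT z|(lborel \<Otimes>\<^sub>M lborel). indicator {0..t} (snd z) * g1 (fst z) * box_bump m a b (fst z - snd z *\<^sub>R i))"
    proof -
      \<comment> \<open>The dominating function is the product of \<open>g1\<close> and the
        indicator of the parameter interval, that is, the shift along the zero vector.\<close>
      have "integrable (lborel \<Otimes>\<^sub>M lborel) (\<lambda>z. indicator {0..t} (snd z) * g1 (fst z) * box_bump m a b (fst z - snd z *\<^sub>R i))"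
        by (rule Bochner_Integration.integrable_bound[OF integrable_shift_along[OF g1, of t 0]])
          (auto simp: case_prod_unfold abs_mult_box_bump_le split: split_indicator)
      from lborel_pair.integral_fst'[OF this] show ?thesis by simp
    qed
    finally show ?thesis .
  qed
  have lim1: "(\<lambda>m. LINT x|lborel. u1 x * (box_bump m a b x - box_bump m a b (x - t *\<^sub>R i))) \<longlonglongrightarrow>
      (LINT x|lborel. u1 x * (indicator (box a b) x - indicator (box a b) (x - t *\<^sub>R i)))"
  proof (rule integral_dominated_convergence[where w = "\<lambda>x. 2 * norm (u1 x)"])
    show "AE x in lborel. norm (u1 x * (box_bump m a b x - box_bump m a b (x - t *\<^sub>R i))) \<le> 2 * norm (u1 x)" for m
    proof (rule AE_I2)
      fix x
      have "\<bar>u1 x * box_bump m a b x - u1 x * box_bump m a b (x - t *\<^sub>R i)\<bar> \<le> \<bar>u1 x\<bar> + \<bar>u1 x\<bar>"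
        by (rule order_trans[OF abs_triangle_ineq4]) (intro add_mono abs_mult_box_bump_le)
      then show "norm (u1 x * (box_bump m a b x - box_bump m a b (x - t *\<^sub>R i))) \<le> 2 * norm (u1 x)"
        by (simp add: right_diff_distrib)
    qed
  qed (use u1 in \<open>auto intro!: tendsto_intros box_bump_tendsto\<close>)
  have lim2: "(\<lambda>m. LINT z|(lborel \<Otimes>\<^sub>M lborel). indicator {0..t} (snd z) * g1 (fst z) * box_bump m a b (fst z - snd z *\<^sub>R i))
     \<longlonglongrightarrow> (LINT z|(lborel \<Otimes>\<^sub>M lborel). indicator {0..t} (snd z) * g1 (fst z) * indicator (box a b) (fst z - snd z *\<^sub>R i))"
  proof (rule integral_dominated_convergence[where w = "\<lambda>z. norm (indicator {0..t} (snd z) * g1 (fst z))"])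
    show "integrable (lborel \<Otimes>\<^sub>M lborel) (\<lambda>z. norm (indicator {0..t} (snd z) * g1 (fst z)))"
      using integrable_norm[OF integrable_shift_along[OF g1, of t 0]] by (simp add: case_prod_unfold)
    show "AE z in lborel \<Otimes>\<^sub>M lborel. (\<lambda>m. indicator {0..t} (snd z) * g1 (fst z) * box_bump m a b (fst z - snd z *\<^sub>R i)) \<longlonglongrightarrow>
        indicator {0..t} (snd z) * g1 (fst z) * indicator (box a b) (fst z - snd z *\<^sub>R i)"
      by (auto intro!: tendsto_mult box_bump_tendsto)
    show "AE z in lborel \<Otimes>\<^sub>M lborel. norm (indicator {0..t} (snd z) * g1 (fst z) * box_bump m a b (fst z - snd z *\<^sub>R i))
        \<le> norm (indicator {0..t} (snd z) * g1 (fst z))" for m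
      unfolding real_norm_def by (intro AE_I2 abs_mult_box_bump_le)
  qed auto
  have "(LINT x|lborel. u1 x * (indicator (box a b) x - indicator (box a b) (x - t *\<^sub>R i))) =
      - (LINT z|(lborel \<Otimes>\<^sub>M lborel). indicator {0..t} (snd z) * g1 (fst z) * indicator (box a b) (fst z - snd z *\<^sub>R i))"
    using LIMSEQ_unique[OF lim1[unfolded weak] tendsto_minus[OF lim2]] .
  also have "(LINT z|(lborel \<Otimes>\<^sub>M lborel). indicator {0..t} (snd z) * g1 (fst z) * indicator (box a b) (fst z - snd z *\<^sub>R i)) =
      (LINT s|lborel. LINT x|lborel. indicator {0..t} s * g1 x * indicator (box a b) (x - s *\<^sub>R i))"
  proof -
    have "integrable (lborel \<Otimes>\<^sub>M lborel) (\<lambda>(x, s). indicator {0..t} s * g1 x * indicator (box a b) (x - s *\<^sub>R i))"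
      by (rule Bochner_Integration.integrable_bound[OF integrable_shift_along[OF g1, of t 0]])
        (auto simp: case_prod_unfold split: split_indicator)
    from lborel_pair.integral_snd[OF this] show ?thesis by (simp add: case_prod_unfold)
  qed
  \<comment> \<open>For each \<open>s\<close> the substitution of \<open>x + s *\<^sub>R i\<close>
    for \<open>x\<close> undoes the shift of the box and shifts \<open>g1\<close> instead.\<close>
  also have "\<dots> = (LINT s|lborel. LINT x|lborel. indicator (box a b) x * (indicator {0..t} s * g1 (x + s *\<^sub>R i)))"
  proof (rule Bochner_Integration.integral_cong[OF refl])
    fix s
    have "(LINT x|lborel. indicator {0..t} s * g1 x * indicator (box a b) (x - s *\<^sub>R i)) =
      (LINT x|lborel. indicator {0..t} s * g1 (x + s *\<^sub>R i) * indicator (box a b) (x + s *\<^sub>R i - s *\<^sub>R i))"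
      by (subst lborel_integral_shift(1)[of _ "s *\<^sub>R i", symmetric]) auto
    then show "(LINT x|lborel. indicator {0..t} s * g1 x * indicator (box a b) (x - s *\<^sub>R i)) =
      (LINT x|lborel. indicator (box a b) x * (indicator {0..t} s * g1 (x + s *\<^sub>R i)))"
      by (simp add: mult_ac)
  qed
  also have "\<dots> = (LINT x|lborel. LINT s|lborel. indicator (box a b) x * (indicator {0..t} s * g1 (x + s *\<^sub>R i)))"
  proof (rule lborel_pair.Fubini_integral)
    show "integrable (lborel \<Otimes>\<^sub>M lborel) (\<lambda>(x, s). indicator (box a b) x * (indicator {0..t} s * g1 (x + s *\<^sub>R i)))"
      by (rule Bochner_Integration.integrable_bound[OF sh])
        (auto simp: case_prod_unfold split: split_indicator)
  qed
  also have "\<dots> = (LINT x|lborel. indicator (box a b) x * I x)"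
    by (simp add: I_def)
  finally have *: "(LINT x|lborel. u1 x * (indicator (box a b) x - indicator (box a b) (x - t *\<^sub>R i))) =
      - (LINT x|lborel. indicator (box a b) x * I x)" .
  have ind: "integrable lborel (\<lambda>x. indicator (box a b) x * f x)" if "integrable lborel f" for f :: "'a \<Rightarrow> real"
    using integrable_mult_indicator[of "box a b" lborel f] that by simp
  have i1: "integrable lborel (\<lambda>x. indicator (box a b) x * u1 (x + t *\<^sub>R i))"
    using ind u1 lborel_integral_shift(2)[of u1] by auto
  have i2: "integrable lborel (\<lambda>x. u1 x * indicator (box a b) (x - t *\<^sub>R i))"
    by (rule Bochner_Integration.integrable_bound[OF u1]) (auto split: split_indicator)
  have "(LINT x|lborel. u1 x * indicator (box a b) (x - t *\<^sub>R i)) =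
      (LINT x|lborel. indicator (box a b) x * u1 (x + t *\<^sub>R i))"
    by (subst lborel_integral_shift(1)[of _ "t *\<^sub>R i", symmetric]) (auto simp: mult_ac)
  moreover have "(LINT x|lborel. u1 x * (indicator (box a b) x - indicator (box a b) (x - t *\<^sub>R i))) =
      (LINT x|lborel. indicator (box a b) x * u1 x) - (LINT x|lborel. u1 x * indicator (box a b) (x - t *\<^sub>R i))"
    using ind[OF u1] i2 by (simp add: right_diff_distrib mult.commute)
  moreover have "(LINT x:box a b|lborel. D x) = (LINT x|lborel. indicator (box a b) x * u1 (x + t *\<^sub>R i) -
      indicator (box a b) x * u1 x - indicator (box a b) x * I x)"
    unfolding set_lebesgue_integral_def
    by (intro Bochner_Integration.integral_cong)
      (auto simp: D_eq subsetD[OF box_subset_cbox] split: split_indicator)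
  ultimately show "(LINT x:box a b|lborel. D x) = 0"
    using * i1 ind[OF u1] ind[OF I] by simp
qed

text \<open>The starting points whose segment of length \<open>t\<close> stays in \<Omega> form an
  open set. A closed box of such points sweeps out a box inside \<Omega>, so the integrated formula
  holds on all of these boxes and localizes to almost every point.\<close>

lemma weak_gradient_increment:
  fixes u :: "'a::euclidean_space \<Rightarrow> real"
  assumes \<Omega>: "open \<Omega>" and w: "has_weak_gradient \<Omega> u G"
    and ms: "u \<in> borel_measurable borel" "G \<in> borel_measurable borel"
    and i: "i \<in> Basis" and t: "t \<ge> 0"
  shows "AE x in lborel. line_inside \<Omega> i x t \<longrightarrow> set_integrable lborel {0..t} (\<lambda>s. G (x + s *\<^sub>R i) \<bullet> i) \<and>
      u (x + t *\<^sub>R i) - u x = (LINT s:{0..t}|lborel. G (x + s *\<^sub>R i) \<bullet> i)"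
proof -
  let ?W = "{x. line_inside \<Omega> i x t}"
  note W = open_line_inside[OF \<Omega>, of i t]
  note cb = weak_gradient_increment_cbox[OF \<Omega> w ms i t cbox_sweep(2)[OF i t]]
  have "AE x in lborel. x \<in> ?W \<longrightarrow> set_integrable lborel {0..t} (\<lambda>s. G (x + s *\<^sub>R i) \<bullet> i)"
  proof (rule AE_on_open_if_cboxes[OF W])
    show "AE x in lborel. x \<in> cbox a b \<longrightarrow> set_integrable lborel {0..t} (\<lambda>s. G (x + s *\<^sub>R i) \<bullet> i)"
      if "cbox a b \<subseteq> ?W" for a b
      \<comment> \<open>An empty box tells nothing about the set it sweeps, so this trivial case is
        separated.\<close>
      using cb(1)[OF _ that] by (cases "cbox a b = {}") auto
  qed
  moreover have "AE x in lborel. x \<in> ?W \<longrightarrow>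
      u (x + t *\<^sub>R i) - u x - (LINT s:{0..t}|lborel. G (x + s *\<^sub>R i) \<bullet> i) = 0" (is "AE x in _. _ \<longrightarrow> ?D x = 0")
  proof (rule AE_zero_if_box_integrals_zero[OF W])
    show "set_integrable lborel (cbox a b) ?D" if "cbox a b \<subseteq> ?W" for a b
      using cb(2)[OF _ that] by (cases "cbox a b = {}") (auto simp: set_integrable_def)
    show "(LINT x:box a b|lborel. ?D x) = 0" if "cbox a b \<subseteq> ?W" for a b
      using cb(3)[OF _ that] box_subset_cbox[of a b]
      by (cases "cbox a b = {}") (auto simp: set_lebesgue_integral_def)
  qed
  ultimately show ?thesis by eventually_elim simp
qed

lemma weak_gradient_imp_abs_cont_on_lines:
  fixes u :: "'a::euclidean_space \<Rightarrow> real"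
  assumes \<Omega>: "open \<Omega>" and w: "has_weak_gradient \<Omega> u G"
    and [measurable]: "u \<in> borel_measurable borel" "G \<in> borel_measurable borel"
    and i: "i \<in> Basis"
  shows "abs_cont_on_lines \<Omega> i u (\<lambda>x. G x \<bullet> i)"
proof -
  have ms: "(\<lambda>x. G x \<bullet> i) \<in> borel_measurable borel" by simp
  show ?thesis
    unfolding abs_cont_on_lines_commute[OF \<Omega> assms(3) ms]
  proof (rule AE_I2)
    fix t :: real
    show "AE x in lborel. 0 \<le> t \<and> line_inside \<Omega> i x t \<longrightarrow>
        set_integrable lborel {0..t} (\<lambda>s. G (x + s *\<^sub>R i) \<bullet> i) \<and>
        u (x + t *\<^sub>R i) - u x = (LINT s:{0..t}|lborel. G (x + s *\<^sub>R i) \<bullet> i)"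
      using weak_gradient_increment[OF assms(1-5), of t] by (cases "t \<ge> 0") simp_all
  qed
qed

section \<open>The chain rule along lines\<close>

lemma set_integral_Icc_combine:
  fixes g :: "real \<Rightarrow> real"
  assumes "set_integrable lborel {a..b} g" "a \<le> c" "c \<le> b"
  shows "(LINT s:{a..b}|lborel. g s) = (LINT s:{a..c}|lborel. g s) + (LINT s:{c..b}|lborel. g s)"
proof -
  have "set_integrable lborel {a..c} g" "set_integrable lborel {c..b} g"
    by (rule set_integrable_subset[OF assms(1)]; use assms in auto)+
  then show ?thesis
    using Henstock_Kurzweil_Integration.integral_combine[OF assms(2,3) set_borel_integral_eq_integral(1)[OF assms(1)]] assms(1)
    by (simp add: set_borel_integral_eq_integral(2))
qed

lemma set_integral_singleton: "(LINT s:{a..a}|lborel. k s) = 0" for k :: "real \<Rightarrow> real"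
proof -
  have "AE s in lborel. indicator {a..a} s *\<^sub>R k s = 0"
    using AE_lborel_singleton[of a] by eventually_elim auto
  then show ?thesis unfolding set_lebesgue_integral_def by (rule integral_eq_zero_AE)
qed

text \<open>No differentiation of \<open>U\<close> is involved. The interval is divided into equal
  pieces so short that \<open>f' (U s)\<close> varies by at most \<epsilon> on each; the increment
  of \<open>f (U s)\<close> over a piece is one value of \<open>f' (U s)\<close> times the integral
  of \<open>g\<close>. The errors add up to at most \<epsilon> times the integral of
  \<open>\<bar>g\<bar>\<close>.\<close>

lemma chain_rule_indefinite_integral:
  fixes f f' g :: "real \<Rightarrow> real" and c :: real
  assumes g: "set_integrable lborel {0..t} g" and t: "t \<ge> 0"
    and f: "\<And>y. (f has_real_derivative f' y) (at y)" and f': "continuous_on UNIV f'"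
  defines "U \<equiv> \<lambda>s. c + (LINT r:{0..s}|lborel. g r)"
  shows "set_integrable lborel {0..t} (\<lambda>s. f' (U s) * g s)"
    and "f (U t) - f c = (LINT s:{0..t}|lborel. f' (U s) * g s)"
proof -
  have sub: "set_integrable lborel {a..b} g" if "0 \<le> a" "b \<le> t" for a b
    by (rule set_integrable_subset[OF g]) (use that in auto)
  have "continuous_on {0..t} (\<lambda>s. c + integral {0..s} g)"
    by (intro continuous_intros indefinite_integral_continuous_1 set_borel_integral_eq_integral(1)[OF g])
  then have U: "continuous_on {0..t} U"
    by (rule continuous_on_eq) (simp add: U_def set_borel_integral_eq_integral(2) sub)
  have f'U: "continuous_on {0..t} (\<lambda>s. f' (U s))"
    by (rule continuous_on_compose2[OF f' U]) auto
  define h where "h s = f' (U s) * g s" for s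
  have "bounded ((\<lambda>s. f' (U s)) ` {0..t})"
    by (intro compact_imp_bounded compact_continuous_image f'U compact_Icc)
  then obtain M where "\<forall>y\<in>(\<lambda>s. f' (U s)) ` {0..t}. norm y \<le> M"
    unfolding bounded_iff by blast
  then have M: "\<bar>f' (U s)\<bar> \<le> M" if "s \<in> {0..t}" for s
    using that by auto
  have h: "set_integrable lborel {0..t} h"
    unfolding set_integrable_def
  proof (rule Bochner_Integration.integrable_bound)
    show "integrable lborel (\<lambda>s. M * (indicator {0..t} s *\<^sub>R g s))"
      using g by (simp add: set_integrable_def)
    have "(\<lambda>s. indicator {0..t} s *\<^sub>R f' (U s)) \<in> borel_measurable borel"
      by (rule borel_measurable_continuous_on_indicator[OF _ f'U]) simp
    moreover have "(\<lambda>s. indicator {0..t} s *\<^sub>R g s) \<in> borel_measurable lborel"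
      using g by (auto simp: set_integrable_def)
    ultimately have "(\<lambda>s. (indicator {0..t} s *\<^sub>R f' (U s)) * (indicator {0..t} s *\<^sub>R g s)) \<in> borel_measurable lborel"
      by simp
    also have "(\<lambda>s. (indicator {0..t} s *\<^sub>R f' (U s)) * (indicator {0..t} s *\<^sub>R g s)) = (\<lambda>s. indicator {0..t} s *\<^sub>R h s)"
      by (auto simp: h_def split: split_indicator)
    finally show "(\<lambda>s. indicator {0..t} s *\<^sub>R h s) \<in> borel_measurable lborel" .
    show "AE s in lborel. norm (indicator {0..t} s *\<^sub>R h s) \<le> norm (M * (indicator {0..t} s *\<^sub>R g s))"
    proof (rule AE_I2)
      fix s
      have "\<bar>h s\<bar> \<le> \<bar>M\<bar> * \<bar>g s\<bar>" if "s \<in> {0..t}"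
        unfolding h_def abs_mult using M[OF that] by (intro mult_right_mono) auto
      then show "norm (indicator {0..t} s *\<^sub>R h s) \<le> norm (M * (indicator {0..t} s *\<^sub>R g s))"
        by (cases "s \<in> {0..t}") (simp_all add: abs_mult)
    qed
  qed
  then show "set_integrable lborel {0..t} (\<lambda>s. f' (U s) * g s)" by (simp add: h_def[abs_def])
  have sub_h: "set_integrable lborel {a..b} h" if "0 \<le> a" "b \<le> t" for a b
    by (rule set_integrable_subset[OF h]) (use that in auto)
  have step: "\<bar>f (U b) - f (U a) - (LINT s:{a..b}|lborel. h s)\<bar> \<le> \<epsilon> * (LINT s:{a..b}|lborel. \<bar>g s\<bar>)"
    if ab: "0 \<le> a" "a \<le> b" "b \<le> t" and close: "\<And>x y. x \<in> {a..b} \<Longrightarrow> y \<in> {a..b} \<Longrightarrow> \<bar>f' (U x) - f' (U y)\<bar> \<le> \<epsilon>"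
    for a b \<epsilon>
  proof -
    have Uab: "continuous_on {a..b} U" by (rule continuous_on_subset[OF U]) (use ab in auto)
    \<comment> \<open>The mean value theorem for \<open>f\<close> yields a point between
      \<open>U a\<close> and \<open>U b\<close>; by continuity \<open>U\<close> attains it inside
      the piece, so the oscillation bound on the piece applies.\<close>
    have "\<exists>\<theta>\<in>{a..b}. f (U b) - f (U a) = (U b - U a) * f' (U \<theta>)"
    proof (cases "U a" "U b" rule: linorder_cases)
      case less
      obtain z where z: "U a < z" "z < U b" "f (U b) - f (U a) = (U b - U a) * f' z"
        using MVT2[OF less, of f f'] f by blast
      then obtain \<theta> where "a \<le> \<theta>" "\<theta> \<le> b" "U \<theta> = z"
        using IVT'[of U a z b] ab(2) Uab by (metis less_imp_le)
      with z show ?thesis by auto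
    next
      case equal
      then show ?thesis using ab by (intro bexI[of _ a]) auto
    next
      case greater
      obtain z where z: "U b < z" "z < U a" "f (U a) - f (U b) = (U a - U b) * f' z"
        using MVT2[OF greater, of f f'] f by blast
      then obtain \<theta> where \<theta>: "a \<le> \<theta>" "\<theta> \<le> b" "U \<theta> = z"
        using IVT2'[of U b z a] ab(2) Uab by (metis less_imp_le)
      then show ?thesis using z by (intro bexI[of _ \<theta>]) (auto simp: algebra_simps)
    qed
    then obtain \<theta> where \<theta>: "\<theta> \<in> {a..b}" "f (U b) - f (U a) = (U b - U a) * f' (U \<theta>)" by blast
    have "U b - U a = (LINT s:{a..b}|lborel. g s)"
      using set_integral_Icc_combine[OF sub[of 0 b], of a] ab by (simp add: U_def)
    then have "f (U b) - f (U a) - (LINT s:{a..b}|lborel. h s) =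
        (LINT s:{a..b}|lborel. f' (U \<theta>) * g s) - (LINT s:{a..b}|lborel. h s)"
      using \<theta>(2) by (simp add: mult.commute)
    also have "\<dots> = (LINT s:{a..b}|lborel. f' (U \<theta>) * g s - h s)"
      using sub ab sub_h by (intro set_integral_diff(2)[symmetric]) auto
    finally have eq: "f (U b) - f (U a) - (LINT s:{a..b}|lborel. h s) = (LINT s:{a..b}|lborel. f' (U \<theta>) * g s - h s)" .
    have int: "set_integrable lborel {a..b} (\<lambda>s. f' (U \<theta>) * g s - h s)"
      using sub ab sub_h by (intro set_integral_diff(1)) auto
    have "\<bar>LINT s:{a..b}|lborel. f' (U \<theta>) * g s - h s\<bar> \<le> (LINT s:{a..b}|lborel. \<bar>f' (U \<theta>) * g s - h s\<bar>)"
      using set_integral_norm_bound[OF int] by simp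
    also have "\<dots> \<le> (LINT s:{a..b}|lborel. \<epsilon> * \<bar>g s\<bar>)"
    proof (rule set_integral_mono)
      show "set_integrable lborel {a..b} (\<lambda>s. \<bar>f' (U \<theta>) * g s - h s\<bar>)"
        using set_integrable_abs[OF int] .
      show "set_integrable lborel {a..b} (\<lambda>s. \<epsilon> * \<bar>g s\<bar>)"
        using set_integrable_abs[OF sub[OF ab(1,3)]] by simp
      show "\<bar>f' (U \<theta>) * g s - h s\<bar> \<le> \<epsilon> * \<bar>g s\<bar>" if "s \<in> {a..b}" for s
      proof -
        have "\<bar>f' (U \<theta>) * g s - h s\<bar> = \<bar>f' (U \<theta>) - f' (U s)\<bar> * \<bar>g s\<bar>"
          by (simp add: h_def abs_mult[symmetric] left_diff_distrib)
        then show ?thesis using close[OF \<theta>(1) that] by (simp add: mult_right_mono)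
      qed
    qed
    finally show ?thesis by (simp add: eq)
  qed
  have small: "\<bar>f (U t) - f (U 0) - (LINT s:{0..t}|lborel. h s)\<bar> \<le> \<epsilon> * (LINT s:{0..t}|lborel. \<bar>g s\<bar>)" if \<epsilon>: "\<epsilon> > 0" for \<epsilon>
  proof -
    have "uniformly_continuous_on {0..t} (\<lambda>s. f' (U s))"
      by (rule compact_uniformly_continuous[OF f'U]) simp
    then obtain \<delta> where \<delta>: "\<delta> > 0" "\<And>x y. x \<in> {0..t} \<Longrightarrow> y \<in> {0..t} \<Longrightarrow> dist y x < \<delta> \<Longrightarrow> dist (f' (U y)) (f' (U x)) < \<epsilon>"
      using \<epsilon> unfolding uniformly_continuous_on_def by metis
    obtain N :: nat where N: "N > 0" "t / real N < \<delta>"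
    proof -
      obtain N :: nat where "real N > t / \<delta>" using reals_Archimedean2 by blast
      with \<delta>(1) t have "real (Suc N) > t / \<delta>" by simp
      with \<delta>(1) have "t / real (Suc N) < \<delta>" by (simp add: field_simps)
      then show ?thesis using that[of "Suc N"] by simp
    qed
    define d where "d = t / real N"
    have d: "0 \<le> d" "d < \<delta>" "real N * d = t" using N t by (auto simp: d_def)
    have "\<bar>f (U (real n * d)) - f (U 0) - (LINT s:{0..real n * d}|lborel. h s)\<bar>
        \<le> \<epsilon> * (LINT s:{0..real n * d}|lborel. \<bar>g s\<bar>)" if "n \<le> N" for n
      using that
    proof (induction n)
      case 0
      show ?case by (simp add: set_integral_singleton[simplified])
    next
      case (Suc n)
      let ?a = "real n * d" and ?b = "real (Suc n) * d"
      have ab: "0 \<le> ?a" "?a \<le> ?b" "?b \<le> t"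
        using d Suc.prems mult_right_mono[of "real (Suc n)" "real N" d] by (auto simp: algebra_simps)
      have "\<bar>f' (U x) - f' (U y)\<bar> \<le> \<epsilon>" if "x \<in> {?a..?b}" "y \<in> {?a..?b}" for x y
      proof -
        have "dist x y < \<delta>" using that d by (auto simp: dist_real_def algebra_simps)
        then show ?thesis using \<delta>(2)[of y x] that ab by (auto simp: dist_real_def)
      qed
      from step[OF ab this] Suc.IH Suc.prems
      show ?case
        using set_integral_Icc_combine[OF sub_h[of 0 ?b], of ?a] ab
          set_integral_Icc_combine[OF set_integrable_abs[OF sub[of 0 ?b]], of ?a]
        by (simp add: distrib_left del: of_nat_Suc)
    qed
    from this[of N] show ?thesis by (simp add: d)
  qed
  have U0: "U 0 = c" unfolding U_def set_integral_singleton by simp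
  have "((\<lambda>\<epsilon>. \<epsilon> * (LINT s:{0..t}|lborel. \<bar>g s\<bar>)) \<longlongrightarrow> 0 * (LINT s:{0..t}|lborel. \<bar>g s\<bar>)) (at_right 0)"
    by (intro tendsto_intros)
  then have "\<bar>f (U t) - f (U 0) - (LINT s:{0..t}|lborel. h s)\<bar> \<le> 0 * (LINT s:{0..t}|lborel. \<bar>g s\<bar>)"
    by (rule tendsto_lowerbound) (use small in \<open>auto simp: eventually_at_filter\<close>)
  then show "f (U t) - f c = (LINT s:{0..t}|lborel. f' (U s) * g s)"
    by (simp add: U0 h_def)
qed

text \<open>A nonempty open set is not a null set. Good base points, parameters and limits of
  constants are selected in this way.\<close>

lemma AE_lborel_ex_in_open:
  fixes S :: "'a::euclidean_space set"
  assumes "AE x in lborel. P x" "open S" "S \<noteq> {}"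
  shows "\<exists>x\<in>S. P x"
proof (rule ccontr)
  assume no: "\<not> (\<exists>x\<in>S. P x)"
  have "AE x in lebesgue. P x" using assms(1) by (simp add: AE_completion_iff)
  then obtain N where "N \<in> null_sets lebesgue" "{x. \<not> P x} \<subseteq> N"
    by (auto simp: eventually_ae_filter)
  then have "negligible S"
    using no by (intro negligible_subset[of N S]) (auto simp: negligible_iff_null_sets)
  with open_not_negligible[OF assms(2,3)] show False by blast
qed

text \<open>On a good line \<open>u\<close> agrees, at almost every parameter, with the continuous
  indefinite integral \<open>U\<close> that starts at \<open>u x\<close>. The chain rule is applied
  to \<open>U\<close>, and \<open>u\<close> is put back afterwards, which only changes the integrand
  on a null set.\<close>

lemma abs_cont_on_lines_compose:
  assumes [measurable]: "u \<in> borel_measurable borel" "g \<in> borel_measurable borel"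
    and ug: "abs_cont_on_lines \<Omega> e u g"
    and f: "\<And>y. (f has_real_derivative f' y) (at y)" and f': "continuous_on UNIV f'"
  shows "abs_cont_on_lines \<Omega> e (\<lambda>x. f (u x)) (\<lambda>x. f' (u x) * g x)"
  unfolding abs_cont_on_lines_def
  using ug[unfolded abs_cont_on_lines_def]
proof eventually_elim
  case (elim x)
  \<comment> \<open>The property for almost all parameters is kept: the end point \<open>t\<close>
    consumes one instance of it, the integrand over the shorter segments another.\<close>
  note line = elim
  have [measurable]: "f' \<in> borel_measurable borel" by (rule borel_measurable_continuous_onI[OF f'])
  show ?case
    using elim
  proof eventually_elim
    case (elim t)
    show ?case
    proof (intro impI)
      assume tl: "0 \<le> t \<and> line_inside \<Omega> e x t"
      define U where "U s = u x + (LINT r:{0..s}|lborel. g (x + r *\<^sub>R e))" for s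
      have int: "set_integrable lborel {0..t} (\<lambda>s. g (x + s *\<^sub>R e))" and Ut: "u (x + t *\<^sub>R e) = U t"
        using elim tl by (auto simp: U_def algebra_simps)
      note cr = chain_rule_indefinite_integral[OF int _ f f', of "u x", folded U_def]
      have eq: "AE s in lborel. indicator {0..t} s *\<^sub>R (f' (U s) * g (x + s *\<^sub>R e)) =
          indicator {0..t} s *\<^sub>R (f' (u (x + s *\<^sub>R e)) * g (x + s *\<^sub>R e))"
        using line
      proof eventually_elim
        case (elim s)
        show ?case
        proof (cases "s \<in> {0..t}")
          case True
          then have "u (x + s *\<^sub>R e) = U s"
            using elim tl line_inside_mono[of \<Omega> e x t s] by (auto simp: U_def algebra_simps)
          then show ?thesis by simp
        qed simp
      qed
      have meas: "(\<lambda>s. indicator {0..t} s *\<^sub>R (f' (u (x + s *\<^sub>R e)) * g (x + s *\<^sub>R e))) \<in> borel_measurable lborel"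
        by measurable
      have "set_integrable lborel {0..t} (\<lambda>s. f' (u (x + s *\<^sub>R e)) * g (x + s *\<^sub>R e))"
        using cr(1) tl eq meas unfolding set_integrable_def by (intro integrable_cong_AE_imp[OF _ meas]) auto
      moreover have "(LINT s:{0..t}|lborel. f' (U s) * g (x + s *\<^sub>R e)) =
          (LINT s:{0..t}|lborel. f' (u (x + s *\<^sub>R e)) * g (x + s *\<^sub>R e))"
        using cr(1) tl eq meas unfolding set_lebesgue_integral_def set_integrable_def
        by (intro integral_cong_AE) auto
      ultimately show "set_integrable lborel {0..t} (\<lambda>s. f' (u (x + s *\<^sub>R e)) * g (x + s *\<^sub>R e)) \<and>
          f (u (x + t *\<^sub>R e)) - f (u x) = (LINT s:{0..t}|lborel. f' (u (x + s *\<^sub>R e)) * g (x + s *\<^sub>R e))"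
        using cr(2) tl by (simp add: Ut)
    qed
  qed
qed

lemma abs_cont_on_lines_linear:
  assumes "abs_cont_on_lines \<Omega> e u g" "abs_cont_on_lines \<Omega> e v h"
  shows "abs_cont_on_lines \<Omega> e (\<lambda>x. a * u x + b * v x) (\<lambda>x. a * g x + b * h x)"
  unfolding abs_cont_on_lines_def
  using assms[unfolded abs_cont_on_lines_def]
proof eventually_elim
  case (elim x)
  then show ?case
  proof eventually_elim
    case (elim t)
    show ?case
    proof (intro impI)
      assume "0 \<le> t \<and> line_inside \<Omega> e x t"
      with elim have *: "set_integrable lborel {0..t} (\<lambda>s. g (x + s *\<^sub>R e))"
          "set_integrable lborel {0..t} (\<lambda>s. h (x + s *\<^sub>R e))"
          "u (x + t *\<^sub>R e) - u x = (LINT s:{0..t}|lborel. g (x + s *\<^sub>R e))"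
          "v (x + t *\<^sub>R e) - v x = (LINT s:{0..t}|lborel. h (x + s *\<^sub>R e))"
        by auto
      have 1: "set_integrable lborel {0..t} (\<lambda>s. a * g (x + s *\<^sub>R e))"
          "set_integrable lborel {0..t} (\<lambda>s. b * h (x + s *\<^sub>R e))"
        using *(1,2) by auto
      have "a * u (x + t *\<^sub>R e) + b * v (x + t *\<^sub>R e) - (a * u x + b * v x) =
          a * (u (x + t *\<^sub>R e) - u x) + b * (v (x + t *\<^sub>R e) - v x)"
        by (simp add: algebra_simps)
      also have "\<dots> = (LINT s:{0..t}|lborel. a * g (x + s *\<^sub>R e) + b * h (x + s *\<^sub>R e))"
        unfolding *(3,4) using set_integral_add(2)[OF 1] by simp
      finally show "set_integrable lborel {0..t} (\<lambda>s. a * g (x + s *\<^sub>R e) + b * h (x + s *\<^sub>R e)) \<and>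
          a * u (x + t *\<^sub>R e) + b * v (x + t *\<^sub>R e) - (a * u x + b * v x) =
          (LINT s:{0..t}|lborel. a * g (x + s *\<^sub>R e) + b * h (x + s *\<^sub>R e))"
        using set_integral_add(1)[OF 1] by blast
    qed
  qed
qed

text \<open>For fixed \<open>t\<close>, a box of admissible starting points sweeps out a compact
  subset of \<Omega>, on which \<open>h\<close> is integrable; Fubini's theorem gives integrability
  along almost every segment. The quantifiers over points and lengths are then exchanged.\<close>

lemma Lebesgue_1_loc_integrable_on_lines:
  fixes h :: "'a::euclidean_space \<Rightarrow> real"
  assumes \<Omega>: "open \<Omega>" and h: "h \<in> Lebesgue_1_loc \<Omega>" and [measurable]: "h \<in> borel_measurable borel"
  shows "AE x in lborel. AE t in lborel. 0 \<le> t \<and> line_inside \<Omega> e x t \<longrightarrow>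
    set_integrable lborel {0..t} (\<lambda>s. h (x + s *\<^sub>R e))"
proof -
  note [measurable] = pred_line_inside[OF \<Omega>]
  have fixed: "AE x in lborel. x \<in> {x. line_inside \<Omega> e x t} \<longrightarrow> set_integrable lborel {0..t} (\<lambda>s. h (x + s *\<^sub>R e))" for t
  proof (rule AE_on_open_if_cboxes[OF open_line_inside[OF \<Omega>]])
    fix a b :: 'a assume ab: "cbox a b \<subseteq> {x. line_inside \<Omega> e x t}"
    define K where "K = (\<lambda>(x, s). x + s *\<^sub>R e) ` (cbox a b \<times> {0..t})"
    have K: "compact K"
      unfolding K_def by (intro compact_continuous_image compact_Times)
        (auto simp: case_prod_unfold intro!: continuous_intros)
    have "K \<subseteq> \<Omega>" using ab by (fastforce simp: K_def line_inside_def)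
    with K h have "integrable lborel (\<lambda>x. indicator K x * h x)"
      by (simp add: Lebesgue_1_loc_borel_iff set_integrable_def)
    from lborel_pair.AE_integrable_fst'[OF integrable_shift_along[OF this, of t e]]
    show "AE x in lborel. x \<in> cbox a b \<longrightarrow> set_integrable lborel {0..t} (\<lambda>s. h (x + s *\<^sub>R e))"
    proof eventually_elim
      case (elim x)
      show ?case
      proof
        assume "x \<in> cbox a b"
        then have "x + s *\<^sub>R e \<in> K" if "s \<in> {0..t}" for s
          unfolding K_def using that by (intro image_eqI[of _ _ "(x, s)"]) auto
        then have "(\<lambda>s. indicator {0..t} s * (indicator K (x + s *\<^sub>R e) * h (x + s *\<^sub>R e))) =
            (\<lambda>s. indicator {0..t} s *\<^sub>R h (x + s *\<^sub>R e))"
          by (auto split: split_indicator)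
        with elim show "set_integrable lborel {0..t} (\<lambda>s. h (x + s *\<^sub>R e))"
          by (simp add: set_integrable_def)
      qed
    qed
  qed
  define P where "P x t \<longleftrightarrow> (0 \<le> t \<and> line_inside \<Omega> e x t \<longrightarrow>
      integrable lborel (\<lambda>s. (if 0 \<le> s \<and> s \<le> t then 1 else 0) *\<^sub>R h (x + s *\<^sub>R e)))" for x t
  have "Measurable.pred (lborel \<Otimes>\<^sub>M lborel) (\<lambda>z. P (fst z) (snd z))"
    unfolding P_def by measurable
  then have "(AE x in lborel. AE t in lborel. P x t) \<longleftrightarrow> (AE t in lborel. AE x in lborel. P x t)"
    unfolding pred_def by (rule lborel_pair.AE_commute)
  moreover have "AE x in lborel. P x t" for t
    using fixed[of t] by eventually_elim (simp add: P_def set_integrable_def indicator_Icc)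
  ultimately have "AE x in lborel. AE t in lborel. P x t" by simp
  then show ?thesis
    unfolding set_integrable_def indicator_Icc P_def .
qed

text \<open>
  The logarithm is approximated by the functions \<open>ln (\<epsilon>\<^sup>2 + y\<^sup>2) / 2\<close>, which are continuously
  differentiable on the whole line, with derivatives below \<open>1 / \<bar>y\<bar>\<close>.
\<close>

lemma abs_cont_on_lines_ln:
  assumes \<Omega>: "open \<Omega>" and [measurable]: "u \<in> borel_measurable borel" "g \<in> borel_measurable borel"
    and ug: "abs_cont_on_lines \<Omega> e u g" and pos: "\<And>x. u x > 0"
    and loc: "(\<lambda>x. g x / u x) \<in> Lebesgue_1_loc \<Omega>"
  shows "abs_cont_on_lines \<Omega> e (\<lambda>x. ln (u x)) (\<lambda>x. g x / u x)"
proof -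
  define \<epsilon> where "\<epsilon> n = inverse (real (Suc n))" for n
  have \<epsilon>: "\<epsilon> n > 0" "\<epsilon> \<longlonglongrightarrow> 0" for n
    unfolding \<epsilon>_def using LIMSEQ_inverse_real_of_nat by auto
  have pos': "(\<epsilon> n)\<^sup>2 + y\<^sup>2 > 0" for n y using \<epsilon>(1)[of n] by (intro add_pos_nonneg) auto
  have lines: "abs_cont_on_lines \<Omega> e (\<lambda>x. ln ((\<epsilon> n)\<^sup>2 + (u x)\<^sup>2) / 2) (\<lambda>x. (u x / ((\<epsilon> n)\<^sup>2 + (u x)\<^sup>2)) * g x)" for n
  proof (rule abs_cont_on_lines_compose[OF _ _ ug, of "\<lambda>y. ln ((\<epsilon> n)\<^sup>2 + y\<^sup>2) / 2" "\<lambda>y. y / ((\<epsilon> n)\<^sup>2 + y\<^sup>2)"])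
    show "((\<lambda>y. ln ((\<epsilon> n)\<^sup>2 + y\<^sup>2) / 2) has_real_derivative y / ((\<epsilon> n)\<^sup>2 + y\<^sup>2)) (at y)" for y
    proof -
      have "((\<lambda>y. (\<epsilon> n)\<^sup>2 + y\<^sup>2) has_real_derivative 2 * y) (at y)"
        by (auto intro!: derivative_eq_intros)
      from DERIV_cdivide[OF DERIV_chain2[OF DERIV_ln[OF pos'[of n y]] this], of 2]
      have "((\<lambda>y. ln ((\<epsilon> n)\<^sup>2 + y\<^sup>2) / 2) has_real_derivative inverse ((\<epsilon> n)\<^sup>2 + y\<^sup>2) * (2 * y) / 2) (at y)" .
      moreover have "inverse a * (2 * y) / 2 = y / a" for a :: real
        by (simp add: field_simps)
      ultimately show ?thesis by (simp only:)
    qed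
    show "continuous_on UNIV (\<lambda>y. y / ((\<epsilon> n)\<^sup>2 + y\<^sup>2))"
      using \<epsilon>(1)[of n] by (intro continuous_on_divide continuous_on_id continuous_on_add continuous_on_const
          continuous_on_power) simp
  qed auto
  \<comment> \<open>Countably many approximations are used, so one null set of lines serves them
    all.\<close>
  have lines': "AE x in lborel. \<forall>n. AE t in lborel. 0 \<le> t \<and> line_inside \<Omega> e x t \<longrightarrow>
      set_integrable lborel {0..t} (\<lambda>s. u (x + s *\<^sub>R e) / ((\<epsilon> n)\<^sup>2 + (u (x + s *\<^sub>R e))\<^sup>2) * g (x + s *\<^sub>R e)) \<and>
      ln ((\<epsilon> n)\<^sup>2 + (u (x + t *\<^sub>R e))\<^sup>2) / 2 - ln ((\<epsilon> n)\<^sup>2 + (u x)\<^sup>2) / 2 =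
      (LINT s:{0..t}|lborel. u (x + s *\<^sub>R e) / ((\<epsilon> n)\<^sup>2 + (u (x + s *\<^sub>R e))\<^sup>2) * g (x + s *\<^sub>R e))"
    unfolding AE_all_countable using lines unfolding abs_cont_on_lines_def by blast
  have "(\<lambda>x. g x / u x) \<in> borel_measurable borel" by measurable
  from Lebesgue_1_loc_integrable_on_lines[OF \<Omega> loc this, where e = e] lines' show ?thesis
    unfolding abs_cont_on_lines_def
  proof eventually_elim
    case (elim x)
    have "AE t in lborel. \<forall>n. 0 \<le> t \<and> line_inside \<Omega> e x t \<longrightarrow>
      ln ((\<epsilon> n)\<^sup>2 + (u (x + t *\<^sub>R e))\<^sup>2) / 2 - ln ((\<epsilon> n)\<^sup>2 + (u x)\<^sup>2) / 2 =
      (LINT s:{0..t}|lborel. u (x + s *\<^sub>R e) / ((\<epsilon> n)\<^sup>2 + (u (x + s *\<^sub>R e))\<^sup>2) * g (x + s *\<^sub>R e))"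
      unfolding AE_all_countable
    proof
      fix n
      from spec[OF elim(2), of n] show "AE t in lborel. 0 \<le> t \<and> line_inside \<Omega> e x t \<longrightarrow>
          ln ((\<epsilon> n)\<^sup>2 + (u (x + t *\<^sub>R e))\<^sup>2) / 2 - ln ((\<epsilon> n)\<^sup>2 + (u x)\<^sup>2) / 2 =
          (LINT s:{0..t}|lborel. u (x + s *\<^sub>R e) / ((\<epsilon> n)\<^sup>2 + (u (x + s *\<^sub>R e))\<^sup>2) * g (x + s *\<^sub>R e))"
        by eventually_elim blast
    qed
    with elim(1) show ?case
    proof eventually_elim
      case (elim t)
      show ?case
      proof (intro impI)
        assume tl: "0 \<le> t \<and> line_inside \<Omega> e x t"
        with elim have int: "set_integrable lborel {0..t} (\<lambda>s. g (x + s *\<^sub>R e) / u (x + s *\<^sub>R e))"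
          and eq: "\<And>n. ln ((\<epsilon> n)\<^sup>2 + (u (x + t *\<^sub>R e))\<^sup>2) / 2 - ln ((\<epsilon> n)\<^sup>2 + (u x)\<^sup>2) / 2 =
            (LINT s:{0..t}|lborel. u (x + s *\<^sub>R e) / ((\<epsilon> n)\<^sup>2 + (u (x + s *\<^sub>R e))\<^sup>2) * g (x + s *\<^sub>R e))"
          by auto
        have lim: "(\<lambda>n. ln ((\<epsilon> n)\<^sup>2 + y\<^sup>2) / 2) \<longlonglongrightarrow> ln y" if "y > 0" for y :: real
        proof -
          have "(\<lambda>n. ln ((\<epsilon> n)\<^sup>2 + y\<^sup>2) / 2) \<longlonglongrightarrow> ln (0\<^sup>2 + y\<^sup>2) / 2"
            using that by (intro tendsto_intros \<epsilon>) auto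
          then show ?thesis using that by (simp add: ln_realpow)
        qed
        have "(\<lambda>n. LINT s:{0..t}|lborel. u (x + s *\<^sub>R e) / ((\<epsilon> n)\<^sup>2 + (u (x + s *\<^sub>R e))\<^sup>2) * g (x + s *\<^sub>R e))
            \<longlonglongrightarrow> (LINT s:{0..t}|lborel. g (x + s *\<^sub>R e) / u (x + s *\<^sub>R e))"
          unfolding set_lebesgue_integral_def
        proof (rule integral_dominated_convergence)
          show "integrable lborel (\<lambda>s. norm (indicator {0..t} s *\<^sub>R (g (x + s *\<^sub>R e) / u (x + s *\<^sub>R e))))"
            using int unfolding set_integrable_def by (rule integrable_norm)
          show "AE s in lborel. (\<lambda>n. indicator {0..t} s *\<^sub>R (u (x + s *\<^sub>R e) / ((\<epsilon> n)\<^sup>2 + (u (x + s *\<^sub>R e))\<^sup>2) * g (x + s *\<^sub>R e)))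
              \<longlonglongrightarrow> indicator {0..t} s *\<^sub>R (g (x + s *\<^sub>R e) / u (x + s *\<^sub>R e))"
          proof (rule AE_I2)
            fix s
            let ?y = "u (x + s *\<^sub>R e)" and ?g = "g (x + s *\<^sub>R e)"
            have "(\<lambda>n. indicator {0..t} s *\<^sub>R (?y / ((\<epsilon> n)\<^sup>2 + ?y\<^sup>2) * ?g)) \<longlonglongrightarrow>
                indicator {0..t} s *\<^sub>R (?y / (0\<^sup>2 + ?y\<^sup>2) * ?g)"
              using pos[of "x + s *\<^sub>R e"] by (intro tendsto_intros \<epsilon>) auto
            then show "(\<lambda>n. indicator {0..t} s *\<^sub>R (?y / ((\<epsilon> n)\<^sup>2 + ?y\<^sup>2) * ?g)) \<longlonglongrightarrow>
                indicator {0..t} s *\<^sub>R (?g / ?y)"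
              using pos[of "x + s *\<^sub>R e"] by (simp add: power2_eq_square)
          qed
          show "AE s in lborel. norm (indicator {0..t} s *\<^sub>R (u (x + s *\<^sub>R e) / ((\<epsilon> n)\<^sup>2 + (u (x + s *\<^sub>R e))\<^sup>2) * g (x + s *\<^sub>R e)))
              \<le> norm (indicator {0..t} s *\<^sub>R (g (x + s *\<^sub>R e) / u (x + s *\<^sub>R e)))" for n
          proof (rule AE_I2)
            fix s
            let ?y = "u (x + s *\<^sub>R e)" and ?g = "g (x + s *\<^sub>R e)"
            have "?y / ((\<epsilon> n)\<^sup>2 + ?y\<^sup>2) \<le> ?y / ?y\<^sup>2"
              using pos[of "x + s *\<^sub>R e"] pos'[of n ?y] by (intro divide_left_mono) auto
            also have "\<dots> = 1 / ?y" using pos[of "x + s *\<^sub>R e"] by (simp add: power2_eq_square)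
            finally have "\<bar>?y / ((\<epsilon> n)\<^sup>2 + ?y\<^sup>2)\<bar> \<le> 1 / ?y"
              using pos[of "x + s *\<^sub>R e"] pos'[of n ?y] by simp
            from mult_right_mono[OF this, of "\<bar>?g\<bar>"]
            have "\<bar>?y / ((\<epsilon> n)\<^sup>2 + ?y\<^sup>2) * ?g\<bar> \<le> \<bar>?g / ?y\<bar>"
              using pos[of "x + s *\<^sub>R e"] by (simp add: abs_mult)
            then show "norm (indicator {0..t} s *\<^sub>R (?y / ((\<epsilon> n)\<^sup>2 + ?y\<^sup>2) * ?g)) \<le>
                norm (indicator {0..t} s *\<^sub>R (?g / ?y))"
              by (cases "s \<in> {0..t}") simp_all
          qed
        qed measurable
        moreover have "(\<lambda>n. ln ((\<epsilon> n)\<^sup>2 + (u (x + t *\<^sub>R e))\<^sup>2) / 2 - ln ((\<epsilon> n)\<^sup>2 + (u x)\<^sup>2) / 2)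
            \<longlonglongrightarrow> ln (u (x + t *\<^sub>R e)) - ln (u x)"
          by (intro tendsto_diff lim pos)
        ultimately have "ln (u (x + t *\<^sub>R e)) - ln (u x) = (LINT s:{0..t}|lborel. g (x + s *\<^sub>R e) / u (x + s *\<^sub>R e))"
          unfolding eq by (rule LIMSEQ_unique[rotated])
        with int show "set_integrable lborel {0..t} (\<lambda>s. g (x + s *\<^sub>R e) / u (x + s *\<^sub>R e)) \<and>
            ln (u (x + t *\<^sub>R e)) - ln (u x) = (LINT s:{0..t}|lborel. g (x + s *\<^sub>R e) / u (x + s *\<^sub>R e))"
          by blast
      qed
    qed
  qed
qed

section \<open>From absolute continuity on lines back to the weak formulation\<close>

lemma test_function_continuous_on:
  assumes "test_function \<Omega> \<phi>"
  shows "continuous_on S \<phi>"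
    and "i \<in> Basis \<Longrightarrow> continuous_on S (\<lambda>x. frechet_derivative \<phi> (at x) i)"
proof -
  have C: "C_k (Suc 0) \<phi>" using assms unfolding test_function_def by blast
  show "continuous_on S \<phi>"
    by (rule continuous_on_subset[OF C_k_imp_continuous_on[OF C]]) simp
  show "continuous_on S (\<lambda>x. frechet_derivative \<phi> (at x) i)" if "i \<in> Basis"
    by (rule continuous_on_subset[of UNIV]) (use C that in simp_all)
qed

lemma test_function_line_derivative:
  assumes \<phi>: "test_function \<Omega> \<phi>"
  shows "((\<lambda>s. \<phi> (x + s *\<^sub>R e)) has_real_derivative frechet_derivative \<phi> (at (x + s *\<^sub>R e)) e) (at s within S)"
proof -
  have "C_k (Suc 0) \<phi>" using \<phi> by (auto simp: test_function_def)
  note d = C_k_has_derivative[OF this, of "x + s *\<^sub>R e"]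
  have "((\<lambda>s. \<phi> (x + s *\<^sub>R e)) has_derivative (\<lambda>h. frechet_derivative \<phi> (at (x + s *\<^sub>R e)) (h *\<^sub>R e))) (at s within S)"
  proof (rule has_derivative_compose[of "\<lambda>s. x + s *\<^sub>R e" "\<lambda>h. h *\<^sub>R e", OF _ d])
    show "((\<lambda>s. x + s *\<^sub>R e) has_derivative (\<lambda>h. h *\<^sub>R e)) (at s within S)"
      by (auto intro!: derivative_eq_intros)
  qed
  also have "(\<lambda>h. frechet_derivative \<phi> (at (x + s *\<^sub>R e)) (h *\<^sub>R e)) = (*) (frechet_derivative \<phi> (at (x + s *\<^sub>R e)) e)"
    using linear_cmul[OF has_derivative_linear[OF d]] by (auto simp: mult.commute)
  finally show ?thesis by (simp add: has_field_derivative_def)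
qed

text \<open>The partial derivative is bounded on the compact support and vanishes elsewhere. Taking
  the maximum with 0 covers an empty support, where the bound \<open>L0\<close> is
  unconstrained.\<close>

lemma test_function_lipschitz:
  assumes \<phi>: "test_function \<Omega> \<phi>" and i: "i \<in> Basis"
  obtains L where "L \<ge> 0" "\<And>x. \<bar>frechet_derivative \<phi> (at x) i\<bar> \<le> L"
    "\<And>x s. \<bar>\<phi> (x + s *\<^sub>R i) - \<phi> x\<bar> \<le> L * \<bar>s\<bar>"
proof -
  let ?K = "closure {x. \<phi> x \<noteq> 0}"
  have K: "compact ?K" using \<phi> by (auto simp: test_function_def)
  have "bounded ((\<lambda>x. frechet_derivative \<phi> (at x) i) ` ?K)"
    by (intro compact_imp_bounded compact_continuous_image K test_function_continuous_on(2)[OF \<phi> i])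
  then obtain L0 where L0: "\<forall>y\<in>(\<lambda>x. frechet_derivative \<phi> (at x) i) ` ?K. norm y \<le> L0"
    unfolding bounded_iff by blast
  have L: "\<bar>frechet_derivative \<phi> (at x) i\<bar> \<le> max 0 L0" for x
  proof (cases "x \<in> ?K")
    case True
    then show ?thesis using L0 by (auto simp: le_max_iff_disj)
  next
    case False
    then show ?thesis using test_function_eq_0(2)[OF \<phi> False] by simp
  qed
  have "\<bar>\<phi> (x + s *\<^sub>R i) - \<phi> x\<bar> \<le> max 0 L0 * \<bar>s\<bar>" for x s
    using field_differentiable_bound[of UNIV "\<lambda>s. \<phi> (x + s *\<^sub>R i)" _ "max 0 L0" s 0,
        OF _ test_function_line_derivative[OF \<phi>]] L by simp
  with L show ?thesis by (intro that[of "max 0 L0"]) auto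
qed

text \<open>This is discrete integration by parts. A translation turns a difference quotient of
  \<phi> integrated against \<open>f\<close> into an increment of \<open>f\<close> integrated
  against \<phi>, which is an average of \<open>h\<close> along short segments. As the length tends
  to zero, one side becomes the partial derivative of \<phi>, the other the integral of
  \<open>h * \<phi>\<close>.\<close>

lemma abs_cont_on_lines_imp_weak_form:
  fixes f h :: "'a::euclidean_space \<Rightarrow> real"
  assumes \<Omega>: "open \<Omega>" and i: "i \<in> Basis" and \<phi>: "test_function \<Omega> \<phi>"
    and [measurable]: "f \<in> borel_measurable borel" "h \<in> borel_measurable borel"
    and f: "f \<in> Lebesgue_1_loc \<Omega>" and h: "h \<in> Lebesgue_1_loc \<Omega>"
    and ac: "abs_cont_on_lines \<Omega> i f h"
  shows "(LINT x|lborel. f x * frechet_derivative \<phi> (at x) i) = - (LINT x|lborel. h x * \<phi> x)"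
proof -
  define K where "K = closure {x. \<phi> x \<noteq> 0}"
  have K: "compact K" "K \<subseteq> \<Omega>" using \<phi> by (auto simp: test_function_def K_def)
  note [measurable] = test_function_measurable(1)[OF \<phi>] test_function_measurable(2)[OF \<phi> i]
  obtain \<delta> where \<delta>: "\<delta> > 0" "(\<Union>x\<in>K. cball x \<delta>) \<subseteq> \<Omega>"
    by (rule compact_subset_open_imp_cball_epsilon_subset[OF K(1) \<Omega> K(2)]) (rule that)
  \<comment> \<open>The support is thickened by \<delta>, so that segments of length at most
    \<delta> starting in the support stay in a compact subset of \<Omega>.\<close>
  define K' where "K' = {x + y |x y. x \<in> K \<and> y \<in> cball 0 \<delta>}"
  have K': "compact K'" unfolding K'_def by (rule compact_sums[OF K(1) compact_cball])
  have "K' \<subseteq> \<Omega>"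
  proof
    fix z assume "z \<in> K'"
    then obtain x y where "z = x + y" "x \<in> K" "norm y \<le> \<delta>" by (auto simp: K'_def)
    then have "z \<in> (\<Union>x\<in>K. cball x \<delta>)" by (auto simp: dist_norm intro!: bexI[of _ x])
    with \<delta>(2) show "z \<in> \<Omega>" by blast
  qed
  have K'_line: "x + s *\<^sub>R i \<in> K'" if "x \<in> K" "\<bar>s\<bar> \<le> \<delta>" for x s
    using that i unfolding K'_def by (intro CollectI exI[of _ x] exI[of _ "s *\<^sub>R i"]) auto
  have K'0: "x \<in> K'" if "x \<in> K" for x using K'_line[OF that, of 0] \<delta>(1) by simp
  have [measurable]: "K' \<in> sets borel" using K' by (auto dest: compact_imp_closed)
  define f1 where "f1 x = indicator K' x * f x" for x
  define h1 where "h1 x = indicator K' x * h x" for x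
  have [measurable]: "f1 \<in> borel_measurable borel" "h1 \<in> borel_measurable borel"
    unfolding f1_def h1_def by measurable
  have f1: "integrable lborel f1" and h1: "integrable lborel h1"
    using f h K' \<open>K' \<subseteq> \<Omega>\<close>
    by (simp_all add: Lebesgue_1_loc_borel_iff set_integrable_def f1_def[abs_def] h1_def[abs_def])
  have \<phi>0: "\<phi> x = 0" "frechet_derivative \<phi> (at x) i = 0" if "x \<notin> K" for x
    using test_function_eq_0[OF \<phi>, of x] that by (auto simp: K_def)
  obtain L where L: "L \<ge> 0" "\<And>x. \<bar>frechet_derivative \<phi> (at x) i\<bar> \<le> L"
    "\<And>x s. \<bar>\<phi> (x + s *\<^sub>R i) - \<phi> x\<bar> \<le> L * \<bar>s\<bar>"
    by (rule test_function_lipschitz[OF \<phi> i]) (rule that)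
  obtain M where M: "M \<ge> 0" "\<And>x. \<bar>\<phi> x\<bar> \<le> M"
  proof -
    have "bounded (\<phi> ` K)"
      by (intro compact_imp_bounded compact_continuous_image K test_function_continuous_on(1)[OF \<phi>])
    then obtain M0 where M0: "\<forall>y\<in>\<phi> ` K. norm y \<le> M0" unfolding bounded_iff by blast
    have "\<bar>\<phi> x\<bar> \<le> max 0 M0" for x
      using M0 \<phi>0(1)[of x] by (cases "x \<in> K") (auto simp: le_max_iff_disj)
    then show ?thesis by (intro that[of "max 0 M0"]) auto
  qed
  have int_mult: "integrable lborel (\<lambda>x. g x * \<psi> x)"
    if "integrable lborel g" "\<psi> \<in> borel_measurable borel" "\<And>x. \<bar>\<psi> x\<bar> \<le> c" "c \<ge> 0" for g \<psi> :: "'a \<Rightarrow> real" and c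
  proof (rule Bochner_Integration.integrable_bound)
    show "integrable lborel (\<lambda>x. c * g x)" using that(1) by simp
    show "(\<lambda>x. g x * \<psi> x) \<in> borel_measurable lborel" using that(1,2) by (auto intro!: borel_measurable_times)
    show "AE x in lborel. norm (g x * \<psi> x) \<le> norm (c * g x)"
      using that(3,4) by (intro AE_I2) (auto simp: abs_mult mult.commute[of c] intro!: mult_left_mono)
  qed
  \<comment> \<open>The shift of \<phi> is backwards, so this quotient tends to minus the partial
    derivative; this is the sign in the weak formulation.\<close>
  define a where "a t = (LINT x|lborel. f1 x * ((\<phi> (x - t *\<^sub>R i) - \<phi> x) / t))" for t
  have est: "AE t in lborel. 0 < t \<and> t < \<delta> \<longrightarrow> \<bar>a t - (LINT x|lborel. h1 x * \<phi> x)\<bar> \<le> L * t * (LINT x|lborel. \<bar>h1 x\<bar>)"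
    using ac[unfolded abs_cont_on_lines_commute[OF \<Omega> assms(4,5)]]
  proof eventually_elim
    case (elim t)
    show ?case
    proof
      assume t: "0 < t \<and> t < \<delta>"
      note sh = integrable_shift_along[OF h1, of t i]
      have eq: "AE x in lborel. (f1 (x + t *\<^sub>R i) - f1 x) * \<phi> x =
          (LINT s|lborel. indicator {0..t} s * h1 (x + s *\<^sub>R i)) * \<phi> x"
        using elim
      proof eventually_elim
        case (elim x)
        show ?case
        proof (cases "x \<in> K")
          case True
          have K't: "x + s *\<^sub>R i \<in> K'" if "s \<in> {0..t}" for s
            using K'_line[OF True, of s] that t by auto
          then have "line_inside \<Omega> i x t" using \<open>K' \<subseteq> \<Omega>\<close> by (auto simp: line_inside_def)
          with elim t have "f (x + t *\<^sub>R i) - f x = (LINT s:{0..t}|lborel. h (x + s *\<^sub>R i))" by simp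
          also have "\<dots> = (LINT s|lborel. indicator {0..t} s * h1 (x + s *\<^sub>R i))"
            unfolding set_lebesgue_integral_def
            by (intro Bochner_Integration.integral_cong) (use K't in \<open>auto simp: h1_def split: split_indicator\<close>)
          finally show ?thesis using K't[of t] K'0[OF True] t by (simp add: f1_def)
        next
          case False
          then show ?thesis by (simp add: \<phi>0)
        qed
      qed
      have J: "integrable lborel (\<lambda>x. LINT s|lborel. indicator {0..t} s * h1 (x + s *\<^sub>R i))"
        using lborel_pair.integrable_fst'[OF sh] by simp
      then have [measurable]: "(\<lambda>x. LINT s|lborel. indicator {0..t} s * h1 (x + s *\<^sub>R i)) \<in> borel_measurable borel"
        by auto
      have "(LINT x|lborel. (f1 (x + t *\<^sub>R i) - f1 x) * \<phi> x) =
          (LINT x|lborel. (LINT s|lborel. indicator {0..t} s * h1 (x + s *\<^sub>R i)) * \<phi> x)"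
        using eq by (intro integral_cong_AE) auto
      also have "\<dots> = (LINT x|lborel. LINT s|lborel. indicator {0..t} s * h1 (x + s *\<^sub>R i) * \<phi> x)"
        by simp
      also have "\<dots> = (LINT s|lborel. LINT x|lborel. indicator {0..t} s * h1 (x + s *\<^sub>R i) * \<phi> x)"
      proof (rule lborel_pair.Fubini_integral[symmetric])
        show "integrable (lborel \<Otimes>\<^sub>M lborel) (\<lambda>(x, s). indicator {0..t} s * h1 (x + s *\<^sub>R i) * \<phi> x)"
        proof (rule Bochner_Integration.integrable_bound)
          show "integrable (lborel \<Otimes>\<^sub>M lborel) (\<lambda>z. M * (case z of (x, s) \<Rightarrow> indicator {0..t} s * h1 (x + s *\<^sub>R i)))"
            using sh by simp
          show "AE z in lborel \<Otimes>\<^sub>M lborel. norm (case z of (x, s) \<Rightarrow> indicator {0..t} s * h1 (x + s *\<^sub>R i) * \<phi> x)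
              \<le> norm (M * (case z of (x, s) \<Rightarrow> indicator {0..t} s * h1 (x + s *\<^sub>R i)))"
          proof (rule AE_I2)
            fix z :: "'a \<times> real"
            obtain x s where z: "z = (x, s)" by (cases z)
            have "\<bar>indicator {0..t} s * h1 (x + s *\<^sub>R i)\<bar> * \<bar>\<phi> x\<bar> \<le> \<bar>indicator {0..t} s * h1 (x + s *\<^sub>R i)\<bar> * M"
              by (intro mult_left_mono M) auto
            then show "norm (case z of (x, s) \<Rightarrow> indicator {0..t} s * h1 (x + s *\<^sub>R i) * \<phi> x)
              \<le> norm (M * (case z of (x, s) \<Rightarrow> indicator {0..t} s * h1 (x + s *\<^sub>R i)))"
              using M(1) by (simp add: z abs_mult mult_ac)
          qed
        qed measurable
      qed
      also have "\<dots> = (LINT s|lborel. indicator {0..t} s * (LINT x|lborel. h1 x * \<phi> (x - s *\<^sub>R i)))"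
      proof (rule Bochner_Integration.integral_cong[OF refl])
        fix s
        have "(LINT x|lborel. h1 x * \<phi> (x - s *\<^sub>R i)) = (LINT x|lborel. h1 (x + s *\<^sub>R i) * \<phi> (x + s *\<^sub>R i - s *\<^sub>R i))"
          by (subst lborel_integral_shift(1)[of _ "s *\<^sub>R i", symmetric]) auto
        then show "(LINT x|lborel. indicator {0..t} s * h1 (x + s *\<^sub>R i) * \<phi> x) =
            indicator {0..t} s * (LINT x|lborel. h1 x * \<phi> (x - s *\<^sub>R i))"
          by (simp add: mult.assoc)
      qed
      finally have rhs: "(LINT x|lborel. (f1 (x + t *\<^sub>R i) - f1 x) * \<phi> x) =
          (LINT s:{0..t}|lborel. (LINT x|lborel. h1 x * \<phi> (x - s *\<^sub>R i)))"
        by (simp add: set_lebesgue_integral_def)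
      have i1: "integrable lborel (\<lambda>x. f1 x * \<phi> (x - t *\<^sub>R i))" "integrable lborel (\<lambda>x. f1 x * \<phi> x)"
        using M by (auto intro!: int_mult f1)
      have i2: "integrable lborel (\<lambda>x. h1 x * \<phi> (x - s *\<^sub>R i))" "integrable lborel (\<lambda>x. h1 x * \<phi> x)" for s
        using M by (auto intro!: int_mult h1)
      have i3: "integrable lborel (\<lambda>x. f1 (x + t *\<^sub>R i) * \<phi> x)"
        using M f1 lborel_integral_shift(2)[of f1] by (auto intro!: int_mult)
      have "(LINT x|lborel. f1 x * \<phi> (x - t *\<^sub>R i)) = (LINT x|lborel. f1 (x + t *\<^sub>R i) * \<phi> x)"
        by (subst lborel_integral_shift(1)[of _ "t *\<^sub>R i", symmetric]) auto
      then have "(LINT x|lborel. (f1 (x + t *\<^sub>R i) - f1 x) * \<phi> x) = (LINT x|lborel. f1 x * (\<phi> (x - t *\<^sub>R i) - \<phi> x))"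
        using i1 i3 by (simp add: left_diff_distrib right_diff_distrib)
      also have "\<dots> = (LINT x|lborel. t * (f1 x * ((\<phi> (x - t *\<^sub>R i) - \<phi> x) / t)))"
        using t by (intro Bochner_Integration.integral_cong) auto
      also have "\<dots> = t * a t" by (simp add: a_def)
      finally have ta: "t * a t = (LINT s:{0..t}|lborel. (LINT x|lborel. h1 x * \<phi> (x - s *\<^sub>R i)))"
        using rhs by simp
      let ?c = "LINT x|lborel. h1 x * \<phi> x" and ?H = "LINT x|lborel. \<bar>h1 x\<bar>"
      \<comment> \<open>Within the range of the average \<phi> has moved by at most
        \<open>t\<close>, so the Lipschitz constant controls the distance to the integral against
        \<phi> itself.\<close>
      have bound: "\<bar>(LINT x|lborel. h1 x * \<phi> (x - s *\<^sub>R i)) - ?c\<bar> \<le> L * t * ?H" if s: "s \<in> {0..t}" for s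
      proof -
        have "\<bar>(LINT x|lborel. h1 x * \<phi> (x - s *\<^sub>R i)) - ?c\<bar> = \<bar>LINT x|lborel. h1 x * \<phi> (x - s *\<^sub>R i) - h1 x * \<phi> x\<bar>"
          using i2 by simp
        also have "\<dots> \<le> (LINT x|lborel. \<bar>h1 x * \<phi> (x - s *\<^sub>R i) - h1 x * \<phi> x\<bar>)"
          by (rule integral_abs_bound)
        also have "\<dots> \<le> (LINT x|lborel. L * t * \<bar>h1 x\<bar>)"
        proof (rule integral_mono)
          show "\<bar>h1 x * \<phi> (x - s *\<^sub>R i) - h1 x * \<phi> x\<bar> \<le> L * t * \<bar>h1 x\<bar>" for x
          proof -
            have "\<bar>\<phi> (x - s *\<^sub>R i) - \<phi> x\<bar> \<le> L * \<bar>s\<bar>" using L(3)[of x "- s"] by simp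
            also have "\<dots> \<le> L * t" using s L(1) by (intro mult_left_mono) auto
            finally have "\<bar>h1 x\<bar> * \<bar>\<phi> (x - s *\<^sub>R i) - \<phi> x\<bar> \<le> \<bar>h1 x\<bar> * (L * t)" by (intro mult_left_mono) auto
            then show ?thesis by (simp add: abs_mult[symmetric] right_diff_distrib mult_ac)
          qed
          show "integrable lborel (\<lambda>x. \<bar>h1 x * \<phi> (x - s *\<^sub>R i) - h1 x * \<phi> x\<bar>)"
            by (intro integrable_abs Bochner_Integration.integrable_diff i2)
          show "integrable lborel (\<lambda>x. L * t * \<bar>h1 x\<bar>)"
            by (intro integrable_mult_right integrable_abs h1)
        qed
        also have "\<dots> = L * t * ?H" by simp
        finally show ?thesis .
      qed
      have int_s: "set_integrable lborel {0..t} (\<lambda>s. LINT x|lborel. h1 x * \<phi> (x - s *\<^sub>R i))"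
        unfolding set_integrable_def
      proof (rule Bochner_Integration.integrable_bound)
        show "integrable lborel (\<lambda>s. indicator {0..t} s * (\<bar>?c\<bar> + L * t * ?H))"
          by (auto intro!: integrable_mult_left integrable_real_indicator simp: emeasure_lborel_Icc_eq)
        show "(\<lambda>s. indicator {0..t} s *\<^sub>R (LINT x|lborel. h1 x * \<phi> (x - s *\<^sub>R i))) \<in> borel_measurable lborel"
          by measurable
        show "AE s in lborel. norm (indicator {0..t} s *\<^sub>R (LINT x|lborel. h1 x * \<phi> (x - s *\<^sub>R i)))
            \<le> norm (indicator {0..t} s * (\<bar>?c\<bar> + L * t * ?H))"
        proof (rule AE_I2)
          show "norm (indicator {0..t} s *\<^sub>R (LINT x|lborel. h1 x * \<phi> (x - s *\<^sub>R i)))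
            \<le> norm (indicator {0..t} s * (\<bar>?c\<bar> + L * t * ?H))" for s
            using bound[of s] by (cases "s \<in> {0..t}") auto
        qed
      qed
      have int_c: "set_integrable lborel {0..t} (\<lambda>s. k)" "(LINT s:{0..t}|lborel. k) = t * k" for k :: real
        using t by (auto simp: set_integrable_def set_lebesgue_integral_def
            intro!: integrable_mult_left integrable_real_indicator)
      have "\<bar>t * a t - t * ?c\<bar> = \<bar>LINT s:{0..t}|lborel. (LINT x|lborel. h1 x * \<phi> (x - s *\<^sub>R i)) - ?c\<bar>"
        unfolding ta using set_integral_diff(2)[OF int_s int_c(1)] int_c(2) by simp
      also have "\<dots> \<le> (LINT s:{0..t}|lborel. \<bar>(LINT x|lborel. h1 x * \<phi> (x - s *\<^sub>R i)) - ?c\<bar>)"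
        using set_integral_norm_bound[OF set_integral_diff(1)[OF int_s int_c(1)]] by simp
      also have "\<dots> \<le> (LINT s:{0..t}|lborel. L * t * ?H)"
        by (rule set_integral_mono[OF set_integrable_abs[OF set_integral_diff(1)[OF int_s int_c(1)]] int_c(1) bound])
      also have "\<dots> = t * (L * t * ?H)" by (rule int_c)
      finally have "t * \<bar>a t - ?c\<bar> \<le> t * (L * t * ?H)"
        using t by (simp add: right_diff_distrib[symmetric] abs_mult)
      then show "\<bar>a t - ?c\<bar> \<le> L * t * ?H"
        using t by (simp only: mult_le_cancel_left_pos)
    qed
  qed
  \<comment> \<open>The estimate is only known for almost all \<open>t\<close>; such lengths still
    exist below every positive bound and form a sequence tending to zero.\<close>
  have "\<exists>t. 0 < t \<and> t < \<delta> \<and> t < inverse (real (Suc n)) \<and>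
      \<bar>a t - (LINT x|lborel. h1 x * \<phi> x)\<bar> \<le> L * t * (LINT x|lborel. \<bar>h1 x\<bar>)" for n
  proof -
    have "0 < min \<delta> (inverse (real (Suc n)))" using \<delta>(1) by (simp only: min_less_iff_conj) simp
    then have "open {0<..<min \<delta> (inverse (real (Suc n)))}" "{0<..<min \<delta> (inverse (real (Suc n)))} \<noteq> {}"
      using greaterThanLessThan_empty_iff by (simp, blast dest: leD)
    from AE_lborel_ex_in_open[OF est this] obtain t where
      "t \<in> {0<..<min \<delta> (inverse (real (Suc n)))}"
      "0 < t \<and> t < \<delta> \<longrightarrow> \<bar>a t - (LINT x|lborel. h1 x * \<phi> x)\<bar> \<le> L * t * (LINT x|lborel. \<bar>h1 x\<bar>)"
      by blast
    then show ?thesis by (intro exI[of _ t]) simp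
  qed
  then obtain t where t: "\<And>n. 0 < t n" "\<And>n. t n < inverse (real (Suc n))"
      "\<And>n. \<bar>a (t n) - (LINT x|lborel. h1 x * \<phi> x)\<bar> \<le> L * t n * (LINT x|lborel. \<bar>h1 x\<bar>)"
    using choice[of "\<lambda>n t. 0 < t \<and> t < \<delta> \<and> t < inverse (real (Suc n)) \<and>
      \<bar>a t - (LINT x|lborel. h1 x * \<phi> x)\<bar> \<le> L * t * (LINT x|lborel. \<bar>h1 x\<bar>)"] by blast
  have t0: "t \<longlonglongrightarrow> 0"
    by (rule tendsto_sandwich[OF _ _ tendsto_const LIMSEQ_inverse_real_of_nat])
      (use t(1,2) in \<open>auto intro!: always_eventually less_imp_le\<close>)
  have "(\<lambda>n. a (t n) - (LINT x|lborel. h1 x * \<phi> x)) \<longlonglongrightarrow> 0"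
  proof (rule Lim_null_comparison)
    show "\<forall>\<^sub>F n in sequentially. norm (a (t n) - (LINT x|lborel. h1 x * \<phi> x)) \<le> L * t n * (LINT x|lborel. \<bar>h1 x\<bar>)"
      using t(3) by simp
    have "(\<lambda>n. L * t n * (LINT x|lborel. \<bar>h1 x\<bar>)) \<longlonglongrightarrow> L * 0 * (LINT x|lborel. \<bar>h1 x\<bar>)"
      by (intro tendsto_intros t0)
    then show "(\<lambda>n. L * t n * (LINT x|lborel. \<bar>h1 x\<bar>)) \<longlonglongrightarrow> 0" by simp
  qed
  then have lim1: "(\<lambda>n. a (t n)) \<longlonglongrightarrow> (LINT x|lborel. h1 x * \<phi> x)"
    by (rule LIM_zero_cancel)
  have lim2: "(\<lambda>n. a (t n)) \<longlonglongrightarrow> (LINT x|lborel. f1 x * - frechet_derivative \<phi> (at x) i)"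
    unfolding a_def
  proof (rule integral_dominated_convergence)
    show "integrable lborel (\<lambda>x. L * \<bar>f1 x\<bar>)" using f1 by auto
    show "AE x in lborel. (\<lambda>n. f1 x * ((\<phi> (x - t n *\<^sub>R i) - \<phi> x) / t n)) \<longlonglongrightarrow> f1 x * - frechet_derivative \<phi> (at x) i"
    proof (rule AE_I2)
      fix x
      have "((\<lambda>s. \<phi> (x + s *\<^sub>R i)) has_real_derivative frechet_derivative \<phi> (at x) i) (at 0)"
        using test_function_line_derivative[OF \<phi>, of x i 0 UNIV] by simp
      then have "((\<lambda>s. (\<phi> (x + s *\<^sub>R i) - \<phi> x) / s) \<longlongrightarrow> frechet_derivative \<phi> (at x) i) (at 0)"
        by (simp add: DERIV_def)
      moreover have "filterlim (\<lambda>n. - t n) (at 0) sequentially"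
        unfolding filterlim_at using tendsto_minus[OF t0] t(1) by (auto simp: less_imp_neq[symmetric])
      ultimately have "(\<lambda>n. (\<phi> (x + (- t n) *\<^sub>R i) - \<phi> x) / (- t n)) \<longlonglongrightarrow> frechet_derivative \<phi> (at x) i"
        by (rule filterlim_compose)
      from tendsto_mult[OF tendsto_const[of "f1 x"] tendsto_minus[OF this]]
      show "(\<lambda>n. f1 x * ((\<phi> (x - t n *\<^sub>R i) - \<phi> x) / t n)) \<longlonglongrightarrow> f1 x * - frechet_derivative \<phi> (at x) i"
        by simp
    qed
    show "AE x in lborel. norm (f1 x * ((\<phi> (x - t n *\<^sub>R i) - \<phi> x) / t n)) \<le> L * \<bar>f1 x\<bar>" for n
    proof (rule AE_I2)
      fix x
      have "\<bar>\<phi> (x - t n *\<^sub>R i) - \<phi> x\<bar> \<le> L * t n" using L(3)[of x "- t n"] t(1)[of n] by simp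
      then have "\<bar>(\<phi> (x - t n *\<^sub>R i) - \<phi> x) / t n\<bar> \<le> L" using t(1)[of n] by (simp add: divide_le_eq)
      then have "\<bar>f1 x\<bar> * \<bar>(\<phi> (x - t n *\<^sub>R i) - \<phi> x) / t n\<bar> \<le> \<bar>f1 x\<bar> * L" by (intro mult_left_mono) auto
      then show "norm (f1 x * ((\<phi> (x - t n *\<^sub>R i) - \<phi> x) / t n)) \<le> L * \<bar>f1 x\<bar>" by (simp add: abs_mult mult.commute)
    qed
  qed measurable
  have "(\<lambda>x. f1 x * - frechet_derivative \<phi> (at x) i) = (\<lambda>x. - (f x * frechet_derivative \<phi> (at x) i))"
  proof
    show "f1 x * - frechet_derivative \<phi> (at x) i = - (f x * frechet_derivative \<phi> (at x) i)" for x
      using K'0[of x] \<phi>0(2)[of x] by (cases "x \<in> K") (simp_all add: f1_def)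
  qed
  moreover have "(\<lambda>x. h1 x * \<phi> x) = (\<lambda>x. h x * \<phi> x)"
  proof
    show "h1 x * \<phi> x = h x * \<phi> x" for x
      using K'0[of x] \<phi>0(1)[of x] by (cases "x \<in> K") (simp_all add: h1_def)
  qed
  ultimately show ?thesis using LIMSEQ_unique[OF lim1 lim2] by simp
qed

lemma abs_cont_on_lines_imp_weak_gradient:
  fixes f :: "'a::euclidean_space \<Rightarrow> real"
  assumes \<Omega>: "open \<Omega>" and [measurable]: "f \<in> borel_measurable borel" "G \<in> borel_measurable borel"
    and f: "f \<in> Lebesgue_1_loc \<Omega>" and G: "G \<in> Lebesgue_1_loc \<Omega>"
    and ac: "\<And>i. i \<in> Basis \<Longrightarrow> abs_cont_on_lines \<Omega> i f (\<lambda>x. G x \<bullet> i)"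
  shows "has_weak_gradient \<Omega> f G"
  unfolding has_weak_gradient_def
proof (intro conjI allI impI f G)
  fix \<phi> and i :: 'a assume *: "test_function \<Omega> \<phi> \<and> i \<in> Basis"
  then have \<phi>: "test_function \<Omega> \<phi>" and i: "i \<in> Basis" by auto
  note [measurable] = test_function_measurable(1)[OF \<phi>] test_function_measurable(2)[OF \<phi> i]
  have Gi: "(\<lambda>x. G x \<bullet> i) \<in> borel_measurable borel" by measurable
  have "(\<lambda>x. G x \<bullet> i) \<in> Lebesgue_1_loc \<Omega>"
    using G[unfolded Lebesgue_1_loc_borel_iff[OF assms(3)]]
    by (simp add: Lebesgue_1_loc_borel_iff[OF Gi] set_integrable_inner)
  from abs_cont_on_lines_imp_weak_form[OF \<Omega> i \<phi> assms(2) Gi f this ac[OF i]]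
  have "(LINT x|lborel. f x * frechet_derivative \<phi> (at x) i) = - (LINT x|lborel. (G x \<bullet> i) * \<phi> x)" .
  moreover have out: "x \<notin> closure {x. \<phi> x \<noteq> 0}" if "x \<notin> \<Omega>" for x
    using that \<phi> by (auto simp: test_function_def)
  have "(LINT x|lebesgue_on \<Omega>. f x * frechet_derivative \<phi> (at x) i) =
      (LINT x|lborel. f x * frechet_derivative \<phi> (at x) i)"
    by (rule LINT_lebesgue_on_eq_lborel[OF \<Omega>]) (measurable, simp add: test_function_eq_0[OF \<phi> out])
  moreover have "(LINT x|lebesgue_on \<Omega>. (G x \<bullet> i) * \<phi> x) = (LINT x|lborel. (G x \<bullet> i) * \<phi> x)"
    by (rule LINT_lebesgue_on_eq_lborel[OF \<Omega>]) (measurable, simp add: test_function_eq_0[OF \<phi> out])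
  ultimately show "(LINT x|lebesgue_on \<Omega>. f x * frechet_derivative \<phi> (at x) i) =
      - (LINT x|lebesgue_on \<Omega>. (G x \<bullet> i) * \<phi> x)" by simp
qed

section \<open>Functions with vanishing gradient\<close>

lemma weak_gradient_borelE:
  assumes \<Omega>: "open \<Omega>" and w: "has_weak_gradient \<Omega> u G"
  obtains u' G' where "u' \<in> borel_measurable borel" "G' \<in> borel_measurable borel"
    "AE x in lborel. x \<in> \<Omega> \<longrightarrow> u x = u' x" "AE x in lborel. x \<in> \<Omega> \<longrightarrow> G x = G' x"
    "has_weak_gradient \<Omega> u' G'"
proof -
  have l1: "u \<in> Lebesgue_1_loc \<Omega>" "G \<in> Lebesgue_1_loc \<Omega>"
    using w by (auto simp: has_weak_gradient_def)
  obtain u' where u: "u' \<in> borel_measurable borel" "AE x in lborel. x \<in> \<Omega> \<longrightarrow> u x = u' x"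
    by (rule Lebesgue_1_loc_ex_borel[OF \<Omega> l1(1)]) (rule that)
  obtain G' where G: "G' \<in> borel_measurable borel" "AE x in lborel. x \<in> \<Omega> \<longrightarrow> G x = G' x"
    by (rule Lebesgue_1_loc_ex_borel[OF \<Omega> l1(2)]) (rule that)
  show ?thesis
    by (rule that[OF u(1) G(1) u(2) G(2) has_weak_gradient_cong_AE[OF \<Omega> u(2) G(2) w]])
qed

text \<open>The point \<open>x + v\<close> is reached by moving along one coordinate after the
  other. Since the coordinates of \<open>v\<close> are nonnegative, the whole path stays in
  \<open>cbox x (x + v)\<close>; the induction is over the set of directions already used.\<close>

lemma increment_zero_cbox:
  fixes u :: "'a::euclidean_space \<Rightarrow> real" and v :: 'a
  assumes inc: "\<And>i t. i \<in> Basis \<Longrightarrow> t \<ge> 0 \<Longrightarrow>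
      AE x in lborel. line_inside \<Omega> i x t \<longrightarrow> u (x + t *\<^sub>R i) = u x"
    and v: "\<And>j. j \<in> Basis \<Longrightarrow> v \<bullet> j \<ge> 0"
  shows "AE x in lborel. cbox x (x + v) \<subseteq> \<Omega> \<longrightarrow> u (x + v) = u x"
proof -
  have "AE x in lborel. cbox x (x + (\<Sum>j\<in>S. (v \<bullet> j) *\<^sub>R j)) \<subseteq> \<Omega> \<longrightarrow> u (x + (\<Sum>j\<in>S. (v \<bullet> j) *\<^sub>R j)) = u x"
    if "S \<subseteq> Basis" for S
    using finite_subset[OF that finite_Basis] that
  proof (induction S rule: finite_induct)
    case empty
    then show ?case by simp
  next
    case (insert i S)
    let ?v = "\<Sum>j\<in>S. (v \<bullet> j) *\<^sub>R j"
    have i: "i \<in> Basis" using insert.prems by simp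
    have v_inner: "?v \<bullet> k = (if k \<in> S then v \<bullet> k else 0)" if "k \<in> Basis" for k
    proof -
      have "?v \<bullet> k = (\<Sum>j\<in>S. (v \<bullet> j) * (j \<bullet> k))" by (simp add: inner_sum_left)
      also have "\<dots> = (\<Sum>j\<in>S. if j = k then v \<bullet> k else 0)"
        using insert.prems that by (intro sum.cong) (auto simp: inner_Basis subset_iff)
      also have "\<dots> = (if k \<in> S then v \<bullet> k else 0)" using insert.hyps(1) by simp
      finally show ?thesis .
    qed
    \<comment> \<open>This segment starts at the point reached so far; translating the exceptional
      null set by the partial sum keeps it a null set.\<close>
    have "AE x in lborel. line_inside \<Omega> i (x + ?v) (v \<bullet> i) \<longrightarrow> u (x + ?v + (v \<bullet> i) *\<^sub>R i) = u (x + ?v)"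
      using AE_lborel_shift[OF inc[OF i v[OF i]]] by simp
    moreover have "AE x in lborel. cbox x (x + ?v) \<subseteq> \<Omega> \<longrightarrow> u (x + ?v) = u x"
      using insert by simp
    ultimately show ?case
    proof eventually_elim
      case (elim x)
      have sum: "(\<Sum>j\<in>insert i S. (v \<bullet> j) *\<^sub>R j) = ?v + (v \<bullet> i) *\<^sub>R i"
        using insert.hyps by (simp add: add.commute)
      show ?case
      proof
        assume sub: "cbox x (x + (\<Sum>j\<in>insert i S. (v \<bullet> j) *\<^sub>R j)) \<subseteq> \<Omega>"
        have "cbox x (x + ?v) \<subseteq> cbox x (x + ?v + (v \<bullet> i) *\<^sub>R i)"
          using v[OF i] i by (intro subset_box_imp) (auto simp: inner_add_left inner_Basis)
        with sub have 1: "cbox x (x + ?v) \<subseteq> \<Omega>" by (simp add: sum add.assoc)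
        have "x + ?v + s *\<^sub>R i \<in> cbox x (x + ?v + (v \<bullet> i) *\<^sub>R i)" if "s \<in> {0..v \<bullet> i}" for s
          using that i v insert.prems
          by (auto simp: mem_box inner_add_left v_inner inner_Basis subset_iff)
        with sub have "line_inside \<Omega> i (x + ?v) (v \<bullet> i)"
          by (auto simp: line_inside_def sum add.assoc)
        with elim 1 show "u (x + (\<Sum>j\<in>insert i S. (v \<bullet> j) *\<^sub>R j)) = u x"
          by (simp add: sum add.assoc)
      qed
    qed
  qed
  from this[of Basis] show ?thesis by (simp add: euclidean_representation)
qed

text \<open>In a cube around \<open>z\<close>, for almost every base point \<open>x\<close> the
  values \<open>u (x + v)\<close> and \<open>u x\<close> agree for almost every \<open>v\<close>
  with nonnegative coordinates. A good base point strictly below \<open>z\<close> in every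
  coordinate thus makes \<open>u\<close> constant almost everywhere on a box that contains
  \<open>z\<close>.\<close>

lemma weak_gradient_zero_locally_constant:
  fixes u :: "'a::euclidean_space \<Rightarrow> real"
  assumes \<Omega>: "open \<Omega>" and w: "has_weak_gradient \<Omega> u (\<lambda>x. 0)" and [measurable]: "u \<in> borel_measurable borel"
    and z: "z \<in> \<Omega>"
  obtains N c where "open N" "z \<in> N" "AE y in lborel. y \<in> N \<longrightarrow> u y = c"
proof -
  have inc: "AE x in lborel. line_inside \<Omega> i x t \<longrightarrow> u (x + t *\<^sub>R i) = u x" if i: "i \<in> Basis" and t: "t \<ge> 0" for i t
    using weak_gradient_increment[OF \<Omega> w _ _ i t]
    by (simp add: set_lebesgue_integral_def set_integrable_def)
  obtain d where d: "d > 0" "cbox (z - d *\<^sub>R One) (z + d *\<^sub>R One) \<subseteq> \<Omega>"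
  proof -
    obtain \<epsilon> where \<epsilon>: "\<epsilon> > 0" "cball z \<epsilon> \<subseteq> \<Omega>" using \<Omega> z open_contains_cball by blast
    \<comment> \<open>The Euclidean norm is at most the sum of the absolute coordinates, so a cube
      with this half side fits into the ball.\<close>
    define d where "d = \<epsilon> / real DIM('a)"
    have "cbox (z - d *\<^sub>R One) (z + d *\<^sub>R One) \<subseteq> cball z \<epsilon>"
    proof
      fix y assume y: "y \<in> cbox (z - d *\<^sub>R One) (z + d *\<^sub>R One)"
      have "norm (y - z) \<le> (\<Sum>j\<in>Basis. \<bar>(y - z) \<bullet> j\<bar>)" by (rule norm_le_l1)
      also have "\<dots> \<le> (\<Sum>j\<in>(Basis::'a set). d)"
      proof (rule sum_mono)
        fix j :: 'a assume j: "j \<in> Basis"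
        have "z \<bullet> j - d \<le> y \<bullet> j" "y \<bullet> j \<le> z \<bullet> j + d"
          using y j by (auto simp: mem_box inner_diff_left inner_add_left)
        then show "\<bar>(y - z) \<bullet> j\<bar> \<le> d" by (simp add: inner_diff_left abs_le_iff)
      qed
      also have "\<dots> = \<epsilon>" by (simp add: d_def)
      finally show "y \<in> cball z \<epsilon>" by (simp add: dist_norm norm_minus_commute)
    qed
    moreover have "d > 0" using \<epsilon>(1) by (simp add: d_def)
    ultimately show ?thesis using \<epsilon>(2) that[of d] by blast
  qed
  define C where "C = cbox (z - d *\<^sub>R One) (z + d *\<^sub>R One)"
  define P where "P = {v::'a. \<forall>j\<in>Basis. 0 \<le> v \<bullet> j}"
  have [measurable]: "C \<in> sets borel" by (simp add: C_def)
  have [measurable]: "P \<in> sets borel"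
  proof -
    have "closed (\<Inter>j\<in>(Basis::'a set). {v. 0 \<le> v \<bullet> j})"
      by (intro closed_INT ballI closed_Collect_le continuous_intros)
    also have "(\<Inter>j\<in>(Basis::'a set). {v. 0 \<le> v \<bullet> j}) = P" by (auto simp: P_def)
    finally show ?thesis by simp
  qed
  define Q where "Q x v \<longleftrightarrow> (x \<in> C \<and> x + v \<in> C \<and> v \<in> P \<longrightarrow> u (x + v) = u x)" for x v
  have "AE x in lborel. Q x v" for v
  proof (cases "v \<in> P")
    case True
    then have "AE x in lborel. cbox x (x + v) \<subseteq> \<Omega> \<longrightarrow> u (x + v) = u x"
      by (intro increment_zero_cbox[OF inc]) (auto simp: P_def)
    then show ?thesis
    proof eventually_elim
      case (elim x)
      have "cbox x (x + v) \<subseteq> C" if "x \<in> C" "x + v \<in> C"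
        using that unfolding C_def by (intro subset_box_imp) (auto simp: mem_box)
      then show ?case using elim d(2) by (auto simp: Q_def C_def)
    qed
  qed (simp add: Q_def)
  moreover have "Measurable.pred (lborel \<Otimes>\<^sub>M lborel) (\<lambda>z. Q (fst z) (snd z))"
    unfolding Q_def by measurable
  then have "(AE x in lborel. AE v in lborel. Q x v) \<longleftrightarrow> (AE v in lborel. AE x in lborel. Q x v)"
    unfolding pred_def by (rule lborel_pair.AE_commute)
  ultimately have ae: "AE x in lborel. AE v in lborel. Q x v" by simp
  \<comment> \<open>The base point is taken from this corner of the cube because displacements are
    known only in the positive orthant and \<open>z\<close> must be interior to the region
    reached.\<close>
  have "box (z - d *\<^sub>R One) z \<noteq> {}"
    using d(1) by (simp add: box_ne_empty inner_diff_left)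
  from AE_lborel_ex_in_open[OF ae open_box this]
  obtain x where x: "x \<in> box (z - d *\<^sub>R One) z" "AE v in lborel. Q x v"
    by blast
  have xC: "x \<in> C" and xz: "\<And>j. j \<in> Basis \<Longrightarrow> x \<bullet> j < z \<bullet> j"
    using x(1) d(1) by (fastforce simp: C_def mem_box inner_diff_left inner_add_left)+
  \<comment> \<open>Translation by the fixed base point turns almost all displacements into almost
    all end points.\<close>
  have "AE y in lborel. Q x (y + (- x))" by (rule AE_lborel_shift[OF x(2)])
  then have "AE y in lborel. y \<in> box x (z + d *\<^sub>R One) \<longrightarrow> u y = u x"
  proof eventually_elim
    case (elim y)
    show ?case
    proof
      assume y: "y \<in> box x (z + d *\<^sub>R One)"
      have "y \<in> C" unfolding C_def mem_box
      proof (intro ballI conjI)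
        fix j :: 'a assume j: "j \<in> Basis"
        show "(z - d *\<^sub>R One) \<bullet> j \<le> y \<bullet> j" "y \<bullet> j \<le> (z + d *\<^sub>R One) \<bullet> j"
          using bspec[OF x(1)[unfolded mem_box] j] bspec[OF y[unfolded mem_box] j] by auto
      qed
      moreover have "y + - x \<in> P" using y by (auto simp: P_def mem_box inner_diff_left less_imp_le)
      ultimately show "u y = u x" using elim xC by (simp add: Q_def)
    qed
  qed
  moreover have "z \<in> box x (z + d *\<^sub>R One)"
    using xz d(1) by (simp add: mem_box inner_add_left)
  ultimately show ?thesis by (intro that[OF open_box])
qed

text \<open>The constant value near a point is unique, because two neighbourhoods meet in a nonempty
  open set. The points with value \<open>c0\<close> and those with another value form two disjoint
  open sets covering \<Omega>, so connectedness leaves only one of them.\<close>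

lemma weak_gradient_zero_imp_constant:
  fixes u :: "'a::euclidean_space \<Rightarrow> real"
  assumes \<Omega>: "open \<Omega>" "connected \<Omega>" and w: "has_weak_gradient \<Omega> u (\<lambda>x. 0)"
  obtains c where "AE x in lborel. x \<in> \<Omega> \<longrightarrow> u x = c"
proof (cases "\<Omega> = {}")
  case True
  then show ?thesis by (intro that[of 0]) simp
next
  case False
  then obtain z0 where z0: "z0 \<in> \<Omega>" by blast
  obtain u' G' where u': "u' \<in> borel_measurable borel" "G' \<in> borel_measurable borel"
    "AE x in lborel. x \<in> \<Omega> \<longrightarrow> u x = u' x" "AE x in lborel. x \<in> \<Omega> \<longrightarrow> 0 = G' x" "has_weak_gradient \<Omega> u' G'"
    by (rule weak_gradient_borelE[OF \<Omega>(1) w]) (rule that)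
  have w': "has_weak_gradient \<Omega> u' (\<lambda>x. 0)"
    by (rule has_weak_gradient_cong_AE[OF \<Omega>(1) u'(3) _ w]) simp
  define near where "near z c \<longleftrightarrow> (\<exists>N. open N \<and> z \<in> N \<and> (AE y in lborel. y \<in> N \<longrightarrow> u' y = c))" for z c
  have ex: "\<exists>c. near z c" if z: "z \<in> \<Omega>" for z
  proof -
    obtain N c where "open N" "z \<in> N" "AE y in lborel. y \<in> N \<longrightarrow> u' y = c"
      by (rule weak_gradient_zero_locally_constant[OF \<Omega>(1) w' u'(1) z]) (rule that)
    then show ?thesis unfolding near_def by blast
  qed
  have uniq: "c = c'" if "near z c" "near z c'" for z c c'
  proof -
    obtain N where N: "open N" "z \<in> N" "AE y in lborel. y \<in> N \<longrightarrow> u' y = c"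
      using \<open>near z c\<close> unfolding near_def by blast
    obtain N' where N': "open N'" "z \<in> N'" "AE y in lborel. y \<in> N' \<longrightarrow> u' y = c'"
      using \<open>near z c'\<close> unfolding near_def by blast
    from N(3) N'(3) have "AE y in lborel. y \<in> N \<inter> N' \<longrightarrow> c = c'" by eventually_elim auto
    note ae = this
    have "open (N \<inter> N')" "N \<inter> N' \<noteq> {}" using N N' by auto
    from AE_lborel_ex_in_open[OF ae this] obtain y where "y \<in> N \<inter> N'" "y \<in> N \<inter> N' \<longrightarrow> c = c'"
      by blast
    then show ?thesis by blast
  qed
  have op: "open {z. near z c}" for c
  proof -
    have "{z. near z c} = \<Union>{N. open N \<and> (AE y in lborel. y \<in> N \<longrightarrow> u' y = c)}"
      by (auto simp: near_def)
    also have "open \<dots>" by (rule open_Union) simp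
    finally show ?thesis .
  qed
  obtain c0 where c0: "near z0 c0" using ex[OF z0] by blast
  define A where "A = {z. near z c0}"
  define B where "B = (\<Union>c\<in>-{c0}. {z. near z c})"
  have AB: "\<Omega> \<subseteq> A \<union> B"
  proof
    fix z assume "z \<in> \<Omega>"
    then obtain c where "near z c" using ex by blast
    then show "z \<in> A \<union> B" by (cases "c = c0") (auto simp: A_def B_def)
  qed
  have "open A" "open B" unfolding A_def B_def using op by auto
  then have "A \<inter> \<Omega> = {} \<or> B \<inter> \<Omega> = {}"
  proof (rule connectedD[OF \<Omega>(2)])
    show "A \<inter> B \<inter> \<Omega> = {}" using uniq by (auto simp: A_def B_def)
    show "\<Omega> \<subseteq> A \<union> B" by (rule AB)
  qed
  moreover have "A \<inter> \<Omega> \<noteq> {}" using c0 z0 by (auto simp: A_def)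
  ultimately have "B \<inter> \<Omega> = {}" by blast
  then have A: "\<Omega> \<subseteq> A" using AB by blast
  define S where "S = {y \<in> \<Omega>. u' y \<noteq> c0}"
  have "negligible S"
  \<comment> \<open>The neighbourhoods are uncountably many, so their null sets cannot simply be
    united; a locally negligible set is nevertheless negligible.\<close>
  proof (rule iffD2[OF locally_negligible_alt], rule ballI)
    fix z assume z: "z \<in> S"
    then have "near z c0" using A by (auto simp: S_def A_def)
    then obtain N where N: "open N" "z \<in> N" "AE y in lborel. y \<in> N \<longrightarrow> u' y = c0"
      unfolding near_def by blast
    from N(3) have "AE y in lebesgue. y \<in> N \<longrightarrow> u' y = c0" by (simp add: AE_completion_iff)
    then obtain M where M: "M \<in> null_sets lebesgue" "{y. \<not> (y \<in> N \<longrightarrow> u' y = c0)} \<subseteq> M"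
      by (auto simp: eventually_ae_filter)
    have "negligible (S \<inter> N)"
      by (rule negligible_subset[of M]) (use M in \<open>auto simp: negligible_iff_null_sets S_def\<close>)
    then show "\<exists>U. openin (top_of_set S) U \<and> z \<in> U \<and> negligible U"
      using N z by (intro exI[of _ "S \<inter> N"]) (auto simp: openin_open_Int)
  qed
  then have "S \<in> null_sets lebesgue" by (simp add: negligible_iff_null_sets)
  from AE_not_in[OF this] have "AE x in lborel. x \<notin> S" by (simp add: AE_completion_iff)
  with u'(3) have "AE x in lborel. x \<in> \<Omega> \<longrightarrow> u x = c0"
    by eventually_elim (auto simp: S_def)
  then show ?thesis by (rule that)
qed

section \<open>Calculus of weak gradients\<close>

lemma weak_grad_eq:
  assumes "open \<Omega>" "has_weak_gradient \<Omega> u G"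
  shows "AE x in lborel. x \<in> \<Omega> \<longrightarrow> weak_grad \<Omega> u x = G x"
  unfolding weak_grad_def
  by (rule weak_gradient_unique[OF assms(1) someI[of "has_weak_gradient \<Omega> u", OF assms(2)] assms(2)])

lemma has_weak_gradient_weak_grad:
  "has_weak_gradient \<Omega> u G \<Longrightarrow> has_weak_gradient \<Omega> u (weak_grad \<Omega> u)"
  unfolding weak_grad_def by (rule someI[of "has_weak_gradient \<Omega> u"])

lemma Lebesgue_1_loc_linear:
  assumes "f \<in> Lebesgue_1_loc \<Omega>" "g \<in> Lebesgue_1_loc \<Omega>"
  shows "(\<lambda>x. a *\<^sub>R f x + b *\<^sub>R g x) \<in> Lebesgue_1_loc \<Omega>"
proof -
  have "(\<lambda>x. a *\<^sub>R f x + b *\<^sub>R g x) absolutely_integrable_on K" if "compact K \<and> K \<subseteq> \<Omega>" for K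
    using assms that unfolding Lebesgue_1_loc_def
    by (intro set_integral_add(1) absolutely_integrable_scaleR_left) auto
  then show ?thesis by (auto simp: Lebesgue_1_loc_def)
qed

lemma Lebesgue_1_loc_norm:
  "f \<in> Lebesgue_1_loc \<Omega> \<Longrightarrow> (\<lambda>x. norm (f x)) \<in> Lebesgue_1_loc \<Omega>"
  by (auto simp: Lebesgue_1_loc_def intro: absolutely_integrable_norm[unfolded o_def])

lemma Lebesgue_1_loc_bound:
  fixes f :: "'a::euclidean_space \<Rightarrow> real" and g :: "'a \<Rightarrow> 'b::euclidean_space"
  assumes \<Omega>: "open \<Omega>" and f: "f \<in> Lebesgue_1_loc \<Omega>" and g: "g \<in> borel_measurable (lebesgue_on \<Omega>)"
    and le: "AE x in lborel. x \<in> \<Omega> \<longrightarrow> norm (g x) \<le> f x"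
  shows "g \<in> Lebesgue_1_loc \<Omega>"
proof -
  have "g absolutely_integrable_on K" if K: "compact K \<and> K \<subseteq> \<Omega>" for K
  proof -
    have [measurable]: "K \<in> sets lebesgue" using K by (auto dest: compact_imp_closed)
    have "integrable lebesgue (\<lambda>x. indicator K x *\<^sub>R f x)"
      using f K by (auto simp: Lebesgue_1_loc_def set_integrable_def)
    moreover have "g \<in> borel_measurable (lebesgue_on K)"
      by (rule measurable_restrict_mono[OF g]) (use K in auto)
    then have "(\<lambda>x. indicator K x *\<^sub>R g x) \<in> borel_measurable lebesgue"
      by (subst (asm) borel_measurable_restrict_space_iff) auto
    moreover have "AE x in lebesgue. norm (indicator K x *\<^sub>R g x) \<le> norm (indicator K x *\<^sub>R f x)"
    proof -
      have "AE x in lebesgue. x \<in> \<Omega> \<longrightarrow> norm (g x) \<le> f x" using le by (simp add: AE_completion_iff)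
      then show ?thesis by eventually_elim (use K in \<open>auto split: split_indicator\<close>)
    qed
    ultimately show ?thesis unfolding set_integrable_def by (rule Bochner_Integration.integrable_bound)
  qed
  then show ?thesis by (auto simp: Lebesgue_1_loc_def)
qed

text \<open>Additivity is taken over from the lines, so that the integrals against test functions
  need not be split.\<close>

lemma weak_gradient_linear:
  fixes u v :: "'a::euclidean_space \<Rightarrow> real"
  assumes \<Omega>: "open \<Omega>" and u: "has_weak_gradient \<Omega> u G" and v: "has_weak_gradient \<Omega> v H"
  shows "has_weak_gradient \<Omega> (\<lambda>x. a * u x + b * v x) (\<lambda>x. a *\<^sub>R G x + b *\<^sub>R H x)"
proof -
  obtain u' G' where u': "u' \<in> borel_measurable borel" "G' \<in> borel_measurable borel"
    "AE x in lborel. x \<in> \<Omega> \<longrightarrow> u x = u' x" "AE x in lborel. x \<in> \<Omega> \<longrightarrow> G x = G' x" "has_weak_gradient \<Omega> u' G'"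
    by (rule weak_gradient_borelE[OF \<Omega>(1) u]) (rule that)
  obtain v' H' where v': "v' \<in> borel_measurable borel" "H' \<in> borel_measurable borel"
    "AE x in lborel. x \<in> \<Omega> \<longrightarrow> v x = v' x" "AE x in lborel. x \<in> \<Omega> \<longrightarrow> H x = H' x" "has_weak_gradient \<Omega> v' H'"
    by (rule weak_gradient_borelE[OF \<Omega>(1) v]) (rule that)
  have l1: "u' \<in> Lebesgue_1_loc \<Omega>" "G' \<in> Lebesgue_1_loc \<Omega>" "v' \<in> Lebesgue_1_loc \<Omega>" "H' \<in> Lebesgue_1_loc \<Omega>"
    using u'(5) v'(5) by (auto simp: has_weak_gradient_def)
  have "has_weak_gradient \<Omega> (\<lambda>x. a * u' x + b * v' x) (\<lambda>x. a *\<^sub>R G' x + b *\<^sub>R H' x)"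
  proof (rule abs_cont_on_lines_imp_weak_gradient[OF \<Omega>])
    show "(\<lambda>x. a * u' x + b * v' x) \<in> borel_measurable borel" "(\<lambda>x. a *\<^sub>R G' x + b *\<^sub>R H' x) \<in> borel_measurable borel"
      using u'(1,2) v'(1,2) by auto
    show "(\<lambda>x. a * u' x + b * v' x) \<in> Lebesgue_1_loc \<Omega>" using Lebesgue_1_loc_linear[OF l1(1,3)] by simp
    show "(\<lambda>x. a *\<^sub>R G' x + b *\<^sub>R H' x) \<in> Lebesgue_1_loc \<Omega>" by (rule Lebesgue_1_loc_linear[OF l1(2,4)])
    show "abs_cont_on_lines \<Omega> i (\<lambda>x. a * u' x + b * v' x) (\<lambda>x. (a *\<^sub>R G' x + b *\<^sub>R H' x) \<bullet> i)" if "i \<in> Basis" for i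
      using abs_cont_on_lines_linear[OF weak_gradient_imp_abs_cont_on_lines[OF \<Omega> u'(5,1,2) that]
          weak_gradient_imp_abs_cont_on_lines[OF \<Omega> v'(5,1,2) that], of a b]
      by (simp add: inner_add_left)
  qed
  moreover have "AE x in lborel. x \<in> \<Omega> \<longrightarrow> a * u' x + b * v' x = a * u x + b * v x"
    using u'(3) v'(3) by eventually_elim simp
  moreover have "AE x in lborel. x \<in> \<Omega> \<longrightarrow> a *\<^sub>R G' x + b *\<^sub>R H' x = a *\<^sub>R G x + b *\<^sub>R H x"
    using u'(4) v'(4) by eventually_elim simp
  ultimately show ?thesis by (rule has_weak_gradient_cong_AE[OF \<Omega>, rotated 2])
qed

lemma weak_gradient_const:
  assumes "open \<Omega>"
  shows "has_weak_gradient \<Omega> (\<lambda>x. c) (\<lambda>x. 0)"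
proof (rule abs_cont_on_lines_imp_weak_gradient[OF assms])
  show "(\<lambda>x. c) \<in> Lebesgue_1_loc \<Omega>"
    by (subst Lebesgue_1_loc_borel_iff) (auto simp: set_integrable_def 
      intro!: integrable_mult_left integrable_real_indicator emeasure_bounded_finite dest: compact_imp_closed compact_imp_bounded)
  show "(\<lambda>x. 0) \<in> Lebesgue_1_loc \<Omega>"
    by (subst Lebesgue_1_loc_borel_iff) (auto simp: set_integrable_def)
  show "abs_cont_on_lines \<Omega> i (\<lambda>x. c) (\<lambda>x. 0 \<bullet> i)" for i
    by (simp add: abs_cont_on_lines_def set_integrable_def set_lebesgue_integral_def)
qed simp_all

lemma abs_cont_on_lines_ln_representative:
  fixes w :: "'a::euclidean_space \<Rightarrow> real"
  assumes \<Omega>: "open \<Omega>" and wG: "has_weak_gradient \<Omega> w G" and p: "AE x in lborel. x \<in> \<Omega> \<longrightarrow> w x > 0"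
    and l: "(\<lambda>x. G x /\<^sub>R w x) \<in> Lebesgue_1_loc \<Omega>"
  obtains u V where "u \<in> borel_measurable borel" "V \<in> borel_measurable borel" "\<And>x. u x > 0"
    "AE x in lborel. x \<in> \<Omega> \<longrightarrow> w x = u x" "AE x in lborel. x \<in> \<Omega> \<longrightarrow> G x = V x"
    "\<And>i. i \<in> Basis \<Longrightarrow> abs_cont_on_lines \<Omega> i (\<lambda>x. ln (u x)) (\<lambda>x. (V x \<bullet> i) / u x)"
proof -
  obtain u0 V where u0: "u0 \<in> borel_measurable borel" "V \<in> borel_measurable borel"
    "AE x in lborel. x \<in> \<Omega> \<longrightarrow> w x = u0 x" "AE x in lborel. x \<in> \<Omega> \<longrightarrow> G x = V x" "has_weak_gradient \<Omega> u0 V"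
    by (rule weak_gradient_borelE[OF \<Omega> wG]) (rule that)
  note [measurable] = u0(1,2)
  \<comment> \<open>The logarithm along lines needs a representative that is positive everywhere,
    not only almost everywhere on \<Omega>; the value 1 is put where the given one fails to be
    positive.\<close>
  define u where "u x = (if u0 x > 0 then u0 x else 1)" for x
  have u: "u x > 0" for x by (simp add: u_def)
  have [measurable]: "u \<in> borel_measurable borel" unfolding u_def by measurable
  have wu: "AE x in lborel. x \<in> \<Omega> \<longrightarrow> w x = u x"
    using p u0(3) by eventually_elim (auto simp: u_def)
  have wgu: "has_weak_gradient \<Omega> u V" by (rule has_weak_gradient_cong_AE[OF \<Omega> wu u0(4) wG])
  have ac: "abs_cont_on_lines \<Omega> i (\<lambda>x. ln (u x)) (\<lambda>x. (V x \<bullet> i) / u x)" if i: "i \<in> Basis" for i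
  proof (rule abs_cont_on_lines_ln[OF \<Omega> _ _ weak_gradient_imp_abs_cont_on_lines[OF \<Omega> wgu _ _ i] u])
    have "AE x in lborel. x \<in> \<Omega> \<longrightarrow> G x /\<^sub>R w x = V x /\<^sub>R u x"
      using wu u0(4) by eventually_elim auto
    from Lebesgue_1_loc_cong_AE[OF this l] have "(\<lambda>x. V x /\<^sub>R u x) \<in> Lebesgue_1_loc \<Omega>" .
    moreover have "(\<lambda>x. V x /\<^sub>R u x) \<in> borel_measurable borel" by measurable
    ultimately have "set_integrable lborel K (\<lambda>x. V x /\<^sub>R u x)" if "compact K \<and> K \<subseteq> \<Omega>" for K
      using that Lebesgue_1_loc_borel_iff[of "\<lambda>x. V x /\<^sub>R u x" \<Omega>] by blast
    note int = set_integrable_inner[OF this, of _ i]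
    have eq: "(\<lambda>x. (V x /\<^sub>R u x) \<bullet> i) = (\<lambda>x. (V x \<bullet> i) / u x)"
      by (simp add: divide_inverse_commute)
    have "(\<lambda>x. (V x \<bullet> i) / u x) \<in> borel_measurable borel" by measurable
    from Lebesgue_1_loc_borel_iff[OF this, of \<Omega>] int[unfolded eq]
    show "(\<lambda>x. (V x \<bullet> i) / u x) \<in> Lebesgue_1_loc \<Omega>"
      by blast
  qed auto
  have "u \<in> borel_measurable borel" by measurable
  then show ?thesis by (rule that[OF _ u0(2) u wu u0(4) ac])
qed

text \<open>The product is \<open>exp (\<alpha> * ln w\<^sub>1 + \<beta> * ln w\<^sub>2)\<close>:
  the logarithms are absolutely continuous on lines, linear combinations stay so, and the
  exponential is a smooth function of one variable. Local integrability of the product and of its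
  gradient is left to each application.\<close>

lemma weak_gradient_powr_mult:
  fixes w\<^sub>1 w\<^sub>2 :: "'a::euclidean_space \<Rightarrow> real"
  assumes \<Omega>: "open \<Omega>" and w: "has_weak_gradient \<Omega> w\<^sub>1 G\<^sub>1" "has_weak_gradient \<Omega> w\<^sub>2 G\<^sub>2"
    and pos: "AE x in lborel. x \<in> \<Omega> \<longrightarrow> w\<^sub>1 x > 0" "AE x in lborel. x \<in> \<Omega> \<longrightarrow> w\<^sub>2 x > 0"
    and log: "(\<lambda>x. G\<^sub>1 x /\<^sub>R w\<^sub>1 x) \<in> Lebesgue_1_loc \<Omega>" "(\<lambda>x. G\<^sub>2 x /\<^sub>R w\<^sub>2 x) \<in> Lebesgue_1_loc \<Omega>"
    and f: "AE x in lborel. x \<in> \<Omega> \<longrightarrow> f x = w\<^sub>1 x powr \<alpha> * w\<^sub>2 x powr \<beta>" "f \<in> Lebesgue_1_loc \<Omega>"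
    and H: "AE x in lborel. x \<in> \<Omega> \<longrightarrow> H x = f x *\<^sub>R (\<alpha> *\<^sub>R (G\<^sub>1 x /\<^sub>R w\<^sub>1 x) + \<beta> *\<^sub>R (G\<^sub>2 x /\<^sub>R w\<^sub>2 x))" "H \<in> Lebesgue_1_loc \<Omega>"
  shows "has_weak_gradient \<Omega> f H"
proof -
  obtain u V where u: "u \<in> borel_measurable borel" "V \<in> borel_measurable borel" "\<And>x. u x > 0"
      "AE x in lborel. x \<in> \<Omega> \<longrightarrow> w\<^sub>1 x = u x" "AE x in lborel. x \<in> \<Omega> \<longrightarrow> G\<^sub>1 x = V x"
      "\<And>i. i \<in> Basis \<Longrightarrow> abs_cont_on_lines \<Omega> i (\<lambda>x. ln (u x)) (\<lambda>x. (V x \<bullet> i) / u x)"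
    by (rule abs_cont_on_lines_ln_representative[OF \<Omega> w(1) pos(1) log(1)]) (rule that)
  obtain u' V' where u': "u' \<in> borel_measurable borel" "V' \<in> borel_measurable borel" "\<And>x. u' x > 0"
      "AE x in lborel. x \<in> \<Omega> \<longrightarrow> w\<^sub>2 x = u' x" "AE x in lborel. x \<in> \<Omega> \<longrightarrow> G\<^sub>2 x = V' x"
      "\<And>i. i \<in> Basis \<Longrightarrow> abs_cont_on_lines \<Omega> i (\<lambda>x. ln (u' x)) (\<lambda>x. (V' x \<bullet> i) / u' x)"
    by (rule abs_cont_on_lines_ln_representative[OF \<Omega> w(2) pos(2) log(2)]) (rule that)
  note [measurable] = u(1,2) u'(1,2)
  define f' where "f' x = exp (\<alpha> * ln (u x) + \<beta> * ln (u' x))" for x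
  define H' where "H' x = f' x *\<^sub>R (\<alpha> *\<^sub>R (V x /\<^sub>R u x) + \<beta> *\<^sub>R (V' x /\<^sub>R u' x))" for x
  have ff': "AE x in lborel. x \<in> \<Omega> \<longrightarrow> f x = f' x"
    using f(1) u(4) u'(4)
  proof eventually_elim
    case (elim x)
    then show ?case using u(3)[of x] u'(3)[of x] by (auto simp: f'_def powr_def exp_add)
  qed
  have HH': "AE x in lborel. x \<in> \<Omega> \<longrightarrow> H x = H' x"
    using H(1) ff' u(4,5) u'(4,5) by eventually_elim (auto simp: H'_def)
  have "has_weak_gradient \<Omega> f' H'"
  proof (rule abs_cont_on_lines_imp_weak_gradient[OF \<Omega>])
    show "f' \<in> borel_measurable borel" unfolding f'_def by measurable
    then show "H' \<in> borel_measurable borel" unfolding H'_def by measurable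
    show "f' \<in> Lebesgue_1_loc \<Omega>" "H' \<in> Lebesgue_1_loc \<Omega>"
      using Lebesgue_1_loc_cong_AE[OF ff' f(2)] Lebesgue_1_loc_cong_AE[OF HH' H(2)] by auto
    fix i :: 'a assume i: "i \<in> Basis"
    have "abs_cont_on_lines \<Omega> i (\<lambda>x. exp (\<alpha> * ln (u x) + \<beta> * ln (u' x)))
        (\<lambda>x. exp (\<alpha> * ln (u x) + \<beta> * ln (u' x)) * (\<alpha> * ((V x \<bullet> i) / u x) + \<beta> * ((V' x \<bullet> i) / u' x)))"
      by (rule abs_cont_on_lines_compose[OF _ _ abs_cont_on_lines_linear[OF u(6)[OF i] u'(6)[OF i]] DERIV_exp])
        (auto intro: continuous_intros)
    then show "abs_cont_on_lines \<Omega> i f' (\<lambda>x. H' x \<bullet> i)"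
      by (simp add: f'_def[abs_def] H'_def inner_add_left divide_inverse mult_ac)
  qed
  moreover have "AE x in lborel. x \<in> \<Omega> \<longrightarrow> f' x = f x" "AE x in lborel. x \<in> \<Omega> \<longrightarrow> H' x = H x"
    using ff' HH' by (eventually_elim, simp)+
  ultimately show ?thesis by (rule has_weak_gradient_cong_AE[OF \<Omega>, rotated 2])
qed

section \<open>The pointwise Picone inequality\<close>

text \<open>Write \<open>z powr r\<close> as \<open>z * exp ((r - 1) * ln z)\<close>. Then
  \<open>exp y \<ge> 1 + y\<close> gives the lower bound \<open>z + (r - 1) * (z * ln z)\<close>,
  and \<open>z * ln z \<ge> z - 1\<close> finishes. Equality makes the last inequality sharp, which
  happens only at \<open>z = 1\<close>.\<close>

lemma bernoulli_powr:
  fixes z r :: real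
  assumes "z > 0" "r > 1"
  shows "z powr r \<ge> r * z - (r - 1)" and "z powr r = r * z - (r - 1) \<Longrightarrow> z = 1"
proof -
  have eq: "z powr r = z * exp ((r - 1) * ln z)"
    using assms powr_add[of z 1 "r - 1"] by (simp add: powr_def)
  have ln: "z * ln z \<ge> z - 1"
  proof -
    have "ln (1 / z) \<le> 1 / z - 1" using assms by (intro ln_le_minus_one) simp
    then have "1 - 1 / z \<le> ln z" using assms by (simp add: ln_div)
    from mult_left_mono[OF this, of z] show ?thesis using assms by (simp add: right_diff_distrib)
  qed
  have le1: "z * exp ((r - 1) * ln z) \<ge> z * (1 + (r - 1) * ln z)"
    using assms by (intro mult_left_mono exp_ge_add_one_self) auto
  have le2: "(r - 1) * (z * ln z) \<ge> (r - 1) * (z - 1)"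
    using assms ln by (intro mult_left_mono) auto
  have expand: "z * (1 + (r - 1) * ln z) = z + (r - 1) * (z * ln z)" "r * z - (r - 1) = z + (r - 1) * (z - 1)"
    by (simp_all add: algebra_simps)
  show "z powr r \<ge> r * z - (r - 1)" using le1 le2 expand unfolding eq by linarith
  assume "z powr r = r * z - (r - 1)"
  then have "(r - 1) * (z * ln z) = (r - 1) * (z - 1)" using le1 le2 expand unfolding eq by linarith
  then have "z * ln z = z - 1" using assms by simp
  then have "ln z = 1 - 1 / z" using assms by (simp add: field_simps)
  then have "ln (1 / z) = 1 / z - 1" using assms by (simp add: ln_div)
  then have "1 / z = 1" using assms by (intro ln_eq_minus_one) auto
  then show "z = 1" by simp
qed

text \<open>All terms are homogeneous of degree \<open>r\<close>, so this is the previous inequality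
  at \<open>z = a / c\<close>, multiplied by \<open>c powr r\<close>.\<close>

lemma young_powr:
  fixes a c r :: real
  assumes "a > 0" "c > 0" "r > 1"
  shows "a powr r + (r - 1) * c powr r - r * a * c powr (r - 1) \<ge> 0"
    and "a powr r + (r - 1) * c powr r - r * a * c powr (r - 1) = 0 \<Longrightarrow> a = c"
proof -
  have z: "a / c > 0" using assms by simp
  have ar: "a powr r = (a / c) powr r * c powr r"
    using assms by (simp add: powr_divide)
  have cr: "c powr r = c * c powr (r - 1)"
    using assms powr_add[of c 1 "r - 1"] by simp
  have eq: "a powr r + (r - 1) * c powr r - r * a * c powr (r - 1) =
      ((a / c) powr r - (r * (a / c) - (r - 1))) * c powr r"
  proof -
    have "r * a * c powr (r - 1) = r * (a / c) * c powr r" unfolding cr using assms by simp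
    then show ?thesis unfolding ar by (simp add: algebra_simps)
  qed
  show "a powr r + (r - 1) * c powr r - r * a * c powr (r - 1) \<ge> 0"
    unfolding eq using bernoulli_powr(1)[OF z assms(3)] by (intro mult_nonneg_nonneg) auto
  assume "a powr r + (r - 1) * c powr r - r * a * c powr (r - 1) = 0"
  then have "(a / c) powr r = r * (a / c) - (r - 1)" unfolding eq using assms by simp
  from bernoulli_powr(2)[OF z assms(3) this] show "a = c" using assms by simp
qed

text \<open>
  \<open>L\<close> is the sum of a monotonicity term and of two remainders of Young's inequality, for the pairs
  \<open>(a, c / t)\<close> and \<open>(c / t, a)\<close>.
\<close>

lemma picone_scalar:
  fixes a c t r k l :: real
  assumes pos: "a > 0" "c > 0" "t > 0" "k > 0" "l > 0" and r: "r > 1"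
    and mono: "a \<le> c \<longrightarrow> k \<le> l" "c \<le> a \<longrightarrow> l \<le> k"
  defines "L \<equiv> (k * a powr (r - 1)) * (a + (r - 1) * t powr r * a - r * t powr (r - 1) * c) +
    (l * c powr (r - 1)) * (c + (r - 1) * t powr (- r) * c - r * t powr (1 - r) * a)"
  shows "L \<ge> 0" and "L = 0 \<Longrightarrow> c = t * a"
proof -
  \<comment> \<open>With \<open>c = t * g\<close> the powers of \<open>t\<close> separate from those
    of \<open>g\<close>, and proportionality of the lengths reads \<open>a = g\<close>.\<close>
  define g where "g = c / t"
  have g: "g > 0" "c = t * g" using pos by (auto simp: g_def)
  define T T' A' B' where "T = t powr r" and "T' = t powr (r - 1)" and "A' = a powr (r - 1)" and "B' = g powr (r - 1)"
  have T: "T = t * T'" "T > 0" "T' > 0" using pos powr_add[of t 1 "r - 1"] by (auto simp: T_def T'_def)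
  have A: "a powr r = a * A'" using pos powr_add[of a 1 "r - 1"] by (simp add: A'_def)
  have B: "g powr r = g * B'" using g powr_add[of g 1 "r - 1"] by (simp add: B'_def)
  have Tm: "t powr (- r) = 1 / T" "t powr (1 - r) = 1 / T'"
    using powr_minus_divide[of t r] powr_minus_divide[of t "r - 1"] by (simp_all add: T_def T'_def)
  have c': "c powr (r - 1) = T' * B'" using g pos by (simp add: powr_mult T'_def B'_def)
  have cr: "c powr r = T * (g * B')" using g pos by (simp add: powr_mult T_def B)
  define Y1 where "Y1 = a powr r + (r - 1) * g powr r - r * a * g powr (r - 1)"
  define Y2 where "Y2 = g powr r + (r - 1) * a powr r - r * g * a powr (r - 1)"
  have Y: "Y1 \<ge> 0" "Y2 \<ge> 0"
    unfolding Y1_def Y2_def by (rule young_powr(1)[OF pos(1) g(1) r], rule young_powr(1)[OF g(1) pos(1) r])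
  have first: "(k * a powr (r - 1)) * (a + (r - 1) * t powr r * a - r * t powr (r - 1) * c) =
      k * (a * A') + k * T * (Y2 - g * B')"
    unfolding Y2_def A B A'_def[symmetric] T_def[symmetric] T'_def[symmetric] g(2)
    by (simp add: T(1) algebra_simps)
  have second: "(l * c powr (r - 1)) * (c + (r - 1) * t powr (- r) * c - r * t powr (1 - r) * a) =
      l * (T * (g * B')) + l * (Y1 - a * A')"
  proof -
    define i j where "i = 1 / T" and "j = 1 / T'"
    have ij: "i * T = 1" "j * T' = 1" using T(2,3) by (simp_all add: i_def j_def)
    have "l * (T' * B') * (t * g + (r - 1) * i * (t * g) - r * j * a) =
        l * (t * T' * (g * B')) + l * ((r - 1) * (i * (t * T')) * (g * B') - r * (j * T') * a * B')"
      by (simp add: algebra_simps)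
    also have "\<dots> = l * (T * (g * B')) + l * ((r - 1) * (g * B') - r * a * B')"
      by (simp only: ij T(1)[symmetric] mult_1_right)
    also have "\<dots> = l * (T * (g * B')) + l * (Y1 - a * A')"
      by (simp add: Y1_def A B B'_def[symmetric])
    finally show ?thesis
      unfolding Tm c'[unfolded g(2)] i_def[symmetric] j_def[symmetric] g(2) .
  qed
  have L: "L = (k - l) * (a powr r - c powr r) + k * T * Y2 + l * Y1"
    unfolding L_def first second cr A by (simp add: algebra_simps)
  \<comment> \<open>Here \<open>k\<close> and \<open>l\<close> stand for the values of the quotient
    \<Phi>(x, s) / \<open>s powr (r - 1)\<close> at \<open>a\<close> and \<open>c\<close>, so both
    factors have the same sign.\<close>
  have h: "(k - l) * (a powr r - c powr r) \<ge> 0"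
  proof (cases "a \<le> c")
    case True
    then have "a powr r \<le> c powr r" using pos r by (intro powr_mono2) auto
    with mono(1) True show ?thesis by (intro mult_nonpos_nonpos) auto
  next
    case False
    then have "c powr r \<le> a powr r" using pos r by (intro powr_mono2) auto
    with mono(2) False show ?thesis by (intro mult_nonneg_nonneg) auto
  qed
  have n: "k * T * Y2 \<ge> 0" "l * Y1 \<ge> 0" using pos T Y by auto
  show "L \<ge> 0" unfolding L using h n by linarith
  assume "L = 0"
  then have "l * Y1 = 0" unfolding L using h n by linarith
  then have "Y1 = 0" using pos by simp
  then have "a = g" unfolding Y1_def by (rule young_powr(2)[OF pos(1) g(1) r])
  then show "c = t * a" using g by simp
qed

text \<open>The vectors \<xi> and \<eta> stand for the gradients of the two functions and
  \<open>t\<close> for \<open>w\<^sub>2 / w\<^sub>1\<close>. The inner bracket of the first line is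
  the gradient of \<open>w\<^sub>2 powr r / w\<^sub>1 powr (r - 1)\<close> in these terms; the
  second line exchanges the two functions, which replaces \<open>t\<close> by its
  reciprocal.\<close>

definition picone_integrand ::
    "('a::euclidean_space \<Rightarrow> real \<Rightarrow> real) \<Rightarrow> real \<Rightarrow> 'a \<Rightarrow> 'a \<Rightarrow> 'a \<Rightarrow> real \<Rightarrow> real" where
  "picone_integrand \<Psi> r x \<xi> \<eta> t =
     flux \<Psi> x \<xi> \<bullet> (\<xi> - ((r * t powr (r - 1)) *\<^sub>R \<eta> - ((r - 1) * t powr r) *\<^sub>R \<xi>)) -
     flux \<Psi> x \<eta> \<bullet> (((r * t powr (1 - r)) *\<^sub>R \<xi> - ((r - 1) * t powr (- r)) *\<^sub>R \<eta>) - \<eta>)"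

lemma picone_integrand_expand:
  "picone_integrand \<Psi> r x \<xi> \<eta> t =
     (flux \<Psi> x \<xi> \<bullet> \<xi>) * (1 + (r - 1) * t powr r) - r * t powr (r - 1) * (flux \<Psi> x \<xi> \<bullet> \<eta>) +
     ((flux \<Psi> x \<eta> \<bullet> \<eta>) * (1 + (r - 1) * t powr (- r)) - r * t powr (1 - r) * (flux \<Psi> x \<eta> \<bullet> \<xi>))"
  unfolding picone_integrand_def inner_diff_right inner_scaleR_right by (simp add: algebra_simps)

lemma flux_inner_self: "flux \<Psi> x \<xi> \<bullet> \<xi> = flux_mod \<Psi> x (norm \<xi>) * norm \<xi>"
  by (simp add: flux_def flux_mod_def norm_eq_sqrt_inner)

context
  fixes \<Psi> :: "'a::euclidean_space \<Rightarrow> real \<Rightarrow> real" and x :: 'a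
  assumes pos: "\<And>s. s > 0 \<Longrightarrow> \<Psi> x s > 0"
begin

lemma flux_mod_pos: "s > 0 \<Longrightarrow> flux_mod \<Psi> x s > 0"
  using pos by (simp add: flux_mod_def)

lemma norm_flux: "norm (flux \<Psi> x \<xi>) = flux_mod \<Psi> x (norm \<xi>)"
  using pos[of "norm \<xi>"] by (cases "\<xi> = 0") (simp_all add: flux_def flux_mod_def abs_of_pos)

lemma flux_inner_le: "flux \<Psi> x \<xi> \<bullet> \<eta> \<le> flux_mod \<Psi> x (norm \<xi>) * norm \<eta>"
  using norm_cauchy_schwarz[of "flux \<Psi> x \<xi>" \<eta>] by (simp add: norm_flux)

text \<open>Replacing the mixed inner products by products of norms lowers the integrand to the
  scalar expression already treated. At zero the scalar part fixes the ratio of the norms, and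
  equality in the Cauchy-Schwarz inequality fixes the direction.\<close>

lemma picone_integrand_nonneg:
  assumes r: "r > 1" and t: "t > 0"
    and mono: "mono_on {0<..} (\<lambda>s. flux_mod \<Psi> x s / s powr (r - 1))"
  shows "picone_integrand \<Psi> r x \<xi> \<eta> t \<ge> 0"
    and "picone_integrand \<Psi> r x \<xi> \<eta> t = 0 \<Longrightarrow> \<eta> = t *\<^sub>R \<xi>"
proof -
  have "picone_integrand \<Psi> r x \<xi> \<eta> t \<ge> 0 \<and> (picone_integrand \<Psi> r x \<xi> \<eta> t = 0 \<longrightarrow> \<eta> = t *\<^sub>R \<xi>)"
  proof (cases "\<xi> = 0 \<or> \<eta> = 0")
    case True
    \<comment> \<open>If one vector vanishes, the mixed terms disappear and a single diagonal term
      with positive coefficient remains. Here the quotient with \<open>s powr (r - 1)\<close> would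
      be evaluated at zero, hence the separate case.\<close>
    have p: "1 + (r - 1) * t powr s > 0" for s using r by (intro add_pos_nonneg) auto
    have q: "flux_mod \<Psi> x (norm \<zeta>) * norm \<zeta> > 0" if "\<zeta> \<noteq> 0" for \<zeta> :: 'a
      using flux_mod_pos[of "norm \<zeta>"] that by simp
    from True show ?thesis
    proof
      assume "\<xi> = 0"
      then have e: "picone_integrand \<Psi> r x \<xi> \<eta> t = (flux_mod \<Psi> x (norm \<eta>) * norm \<eta>) * (1 + (r - 1) * t powr (- r))"
        by (simp add: picone_integrand_expand flux_inner_self) (simp add: flux_def)
      show ?thesis
        using mult_pos_pos[OF q p, of \<eta> "- r"] \<open>\<xi> = 0\<close> unfolding e by (cases "\<eta> = 0") auto
    next
      assume "\<eta> = 0"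
      then have e: "picone_integrand \<Psi> r x \<xi> \<eta> t = (flux_mod \<Psi> x (norm \<xi>) * norm \<xi>) * (1 + (r - 1) * t powr r)"
        by (simp add: picone_integrand_expand flux_inner_self) (simp add: flux_def)
      show ?thesis
        using mult_pos_pos[OF q p, of \<xi> r] \<open>\<eta> = 0\<close> unfolding e by (cases "\<xi> = 0") auto
    qed
  next
    case False
    define a c where "a = norm \<xi>" and "c = norm \<eta>"
    have ac: "a > 0" "c > 0" using False by (auto simp: a_def c_def)
    define h where "h s = flux_mod \<Psi> x s / s powr (r - 1)" for s
    have hpos: "h s > 0" if "s > 0" for s using flux_mod_pos[OF that] that by (simp add: h_def)
    have hmono: "h s \<le> h s'" if "0 < s" "s \<le> s'" for s s'
      using mono_onD[OF mono, of s s'] that by (simp add: h_def)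
    have \<phi>: "flux_mod \<Psi> x s = h s * s powr (r - 1)" if "s > 0" for s using that by (simp add: h_def)
    define L where "L = (h a * a powr (r - 1)) * (a + (r - 1) * t powr r * a - r * t powr (r - 1) * c) +
      (h c * c powr (r - 1)) * (c + (r - 1) * t powr (- r) * c - r * t powr (1 - r) * a)"
    have "a \<le> c \<longrightarrow> h a \<le> h c" "c \<le> a \<longrightarrow> h c \<le> h a" using hmono ac by auto
    note L = picone_scalar[OF ac t hpos[OF ac(1)] hpos[OF ac(2)] r this, folded L_def]
    \<comment> \<open>\<open>R1\<close> and \<open>R2\<close> are the weighted losses in the two
      Cauchy-Schwarz estimates.\<close>
    define R1 where "R1 = r * t powr (r - 1) * (flux_mod \<Psi> x a * c - flux \<Psi> x \<xi> \<bullet> \<eta>)"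
    define R2 where "R2 = r * t powr (1 - r) * (flux_mod \<Psi> x c * a - flux \<Psi> x \<eta> \<bullet> \<xi>)"
    have R: "R1 \<ge> 0" "R2 \<ge> 0"
      using r flux_inner_le[of \<xi> \<eta>] flux_inner_le[of \<eta> \<xi>] by (auto simp: R1_def R2_def a_def c_def)
    have eq: "picone_integrand \<Psi> r x \<xi> \<eta> t = L + R1 + R2"
      unfolding picone_integrand_expand flux_inner_self a_def[symmetric] c_def[symmetric] L_def R1_def R2_def
        \<phi>[OF ac(1)] \<phi>[OF ac(2)]
      by (simp add: algebra_simps)
    have "\<eta> = t *\<^sub>R \<xi>" if "picone_integrand \<Psi> r x \<xi> \<eta> t = 0"
    proof -
      have "L = 0" "R1 = 0" using that R L(1) unfolding eq by auto
      have c: "c = t * a" by (rule L(2)[OF \<open>L = 0\<close>])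
      have "flux \<Psi> x \<xi> \<bullet> \<eta> = flux_mod \<Psi> x a * c" using \<open>R1 = 0\<close> r t by (auto simp: R1_def)
      then have "\<Psi> x a * (\<xi> \<bullet> \<eta>) = \<Psi> x a * (a * c)"
        using False ac by (simp add: flux_def flux_mod_def a_def)
      then have "\<xi> \<bullet> \<eta> = norm \<xi> * norm \<eta>" using pos[OF ac(1)] by (simp add: a_def c_def)
      then have "a *\<^sub>R \<eta> = c *\<^sub>R \<xi>" unfolding norm_cauchy_schwarz_eq a_def c_def .
      then have "a *\<^sub>R \<eta> = a *\<^sub>R (t *\<^sub>R \<xi>)" by (simp add: c mult.commute)
      then show ?thesis using ac(1) unfolding scaleR_cancel_left by simp
    qed
    then show ?thesis using R L(1) unfolding eq by auto
  qed
  then show "picone_integrand \<Psi> r x \<xi> \<eta> t \<ge> 0" "picone_integrand \<Psi> r x \<xi> \<eta> t = 0 \<Longrightarrow> \<eta> = t *\<^sub>R \<xi>" by auto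
qed

text \<open>For \<open>r = 1\<close> the integrand is the product of the difference of the fluxes
  with \<xi> - \<eta>. It is at least the product of the differences of \<Phi> and of the norms,
  positive for different norms; for equal nonzero norms it is a positive multiple of
  \<open>(\<xi> - \<eta>) \<bullet> (\<xi> - \<eta>)\<close>.\<close>

lemma picone_integrand_1:
  assumes t: "t > 0" and mono: "strict_mono_on {0<..} (\<lambda>s. \<Psi> x s * s)"
  shows "picone_integrand \<Psi> 1 x \<xi> \<eta> t \<ge> 0" and "picone_integrand \<Psi> 1 x \<xi> \<eta> t = 0 \<longleftrightarrow> \<xi> = \<eta>"
proof -
  let ?\<phi> = "flux_mod \<Psi> x"
  have smono: "?\<phi> s < ?\<phi> s'" if "0 \<le> s" "s < s'" for s s'
  proof (cases "s = 0")
    case True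
    then show ?thesis using flux_mod_pos[of s'] that by (simp add: flux_mod_def)
  next
    case False
    then show ?thesis
      using strict_mono_onD[OF mono, of s s'] that by (simp add: flux_mod_def)
  qed
  have eq: "picone_integrand \<Psi> 1 x \<xi> \<eta> t = flux \<Psi> x \<xi> \<bullet> \<xi> - flux \<Psi> x \<xi> \<bullet> \<eta> + (flux \<Psi> x \<eta> \<bullet> \<eta> - flux \<Psi> x \<eta> \<bullet> \<xi>)"
    using t by (simp add: picone_integrand_expand)
  have ge: "picone_integrand \<Psi> 1 x \<xi> \<eta> t \<ge> (?\<phi> (norm \<xi>) - ?\<phi> (norm \<eta>)) * (norm \<xi> - norm \<eta>)"
    unfolding eq flux_inner_self using flux_inner_le[of \<xi> \<eta>] flux_inner_le[of \<eta> \<xi>]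
    by (simp add: algebra_simps)
  have pos': "(?\<phi> (norm \<xi>) - ?\<phi> (norm \<eta>)) * (norm \<xi> - norm \<eta>) > 0" if "norm \<xi> \<noteq> norm \<eta>"
  proof (cases "norm \<xi> < norm \<eta>")
    case True
    then show ?thesis using smono[of "norm \<xi>" "norm \<eta>"] by (intro mult_neg_neg) auto
  next
    case False
    then show ?thesis using that smono[of "norm \<eta>" "norm \<xi>"] by (intro mult_pos_pos) auto
  qed
  have "picone_integrand \<Psi> 1 x \<xi> \<eta> t \<ge> 0 \<and> (picone_integrand \<Psi> 1 x \<xi> \<eta> t = 0 \<longrightarrow> \<xi> = \<eta>)"
  proof (cases "norm \<xi> = norm \<eta>")
    case True
    show ?thesis
    proof (cases "\<xi> = 0")
      case True
      then show ?thesis using \<open>norm \<xi> = norm \<eta>\<close> ge by simp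
    next
      case False
      have f: "flux \<Psi> x \<xi> = \<Psi> x (norm \<xi>) *\<^sub>R \<xi>" "flux \<Psi> x \<eta> = \<Psi> x (norm \<xi>) *\<^sub>R \<eta>"
        using True by (simp_all add: flux_def)
      have "(\<xi> - \<eta>) \<bullet> (\<xi> - \<eta>) = \<xi> \<bullet> \<xi> - \<xi> \<bullet> \<eta> + (\<eta> \<bullet> \<eta> - \<eta> \<bullet> \<xi>)"
        by (simp add: inner_diff_left inner_diff_right)
      then have "picone_integrand \<Psi> 1 x \<xi> \<eta> t = \<Psi> x (norm \<xi>) * ((\<xi> - \<eta>) \<bullet> (\<xi> - \<eta>))"
        unfolding eq f by (simp only: inner_scaleR_left distrib_left right_diff_distrib)
      moreover have "\<Psi> x (norm \<xi>) > 0" using False by (intro pos) simp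
      ultimately show ?thesis by (simp add: zero_le_mult_iff)
    qed
  next
    case False
    then show ?thesis using pos' ge by auto
  qed
  moreover have "picone_integrand \<Psi> 1 x \<xi> \<xi> t = 0" using t by (simp add: picone_integrand_expand)
  ultimately show "picone_integrand \<Psi> 1 x \<xi> \<eta> t \<ge> 0" "picone_integrand \<Psi> 1 x \<xi> \<eta> t = 0 \<longleftrightarrow> \<xi> = \<eta>" by auto
qed

text \<open>For parallel vectors the integrand factors as \<open>1 - t powr r\<close> times the norm
  of \<xi> times the difference of \<Phi> at \<open>norm \<xi>\<close> and \<Phi> at
  \<open>t * norm \<xi>\<close> divided by \<open>t powr (r - 1)\<close>. The first factor vanishes
  only at \<open>t = 1\<close>.\<close>

lemma picone_integrand_parallel:
  assumes r: "r > 1" and t: "t > 0"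
  shows "picone_integrand \<Psi> r x \<xi> (t *\<^sub>R \<xi>) t = 0 \<longleftrightarrow>
    t = 1 \<or> flux_mod \<Psi> x (t * norm \<xi>) = t powr (r - 1) * flux_mod \<Psi> x (norm \<xi>)"
proof (cases "\<xi> = 0")
  case True
  then show ?thesis by (simp add: picone_integrand_def flux_def flux_mod_def)
next
  case False
  define a where "a = norm \<xi>"
  have a: "a > 0" using False by (simp add: a_def)
  define S where "S = t powr (r - 1)"
  have S: "S > 0" "t powr r = t * S" "t powr (1 - r) = 1 / S" "t powr (- r) = 1 / (t * S)"
    using t powr_add[of t 1 "r - 1"] powr_minus_divide[of t "r - 1"] powr_minus_divide[of t r] by (auto simp: S_def)
  have f1: "flux \<Psi> x \<xi> \<bullet> \<xi> = flux_mod \<Psi> x a * a" by (simp add: flux_inner_self a_def)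
  have f2: "flux \<Psi> x (t *\<^sub>R \<xi>) \<bullet> \<xi> = flux_mod \<Psi> x (t * a) * a"
  proof -
    have "t * (flux \<Psi> x (t *\<^sub>R \<xi>) \<bullet> \<xi>) = flux \<Psi> x (t *\<^sub>R \<xi>) \<bullet> (t *\<^sub>R \<xi>)" by simp
    also have "\<dots> = flux_mod \<Psi> x (t * a) * (t * a)" using t by (subst flux_inner_self) (simp add: a_def)
    finally show ?thesis using t by simp
  qed
  have "picone_integrand \<Psi> r x \<xi> (t *\<^sub>R \<xi>) t =
      (flux_mod \<Psi> x a * a) * (1 - t * S) + (flux_mod \<Psi> x (t * a) * a) * (t - 1 / S)"
    unfolding picone_integrand_expand inner_scaleR_right f1 f2 S S_def[symmetric]
    using t S(1) by (simp add: field_simps)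
  also have "\<dots> = (1 - t * S) * a * (flux_mod \<Psi> x a - flux_mod \<Psi> x (t * a) / S)"
    using S(1) by (simp add: field_simps)
  finally have "picone_integrand \<Psi> r x \<xi> (t *\<^sub>R \<xi>) t = 0 \<longleftrightarrow>
      t * S = 1 \<or> flux_mod \<Psi> x a = flux_mod \<Psi> x (t * a) / S"
    using a by auto
  moreover have "t * S = 1 \<longleftrightarrow> t = 1"
    using t r unfolding S(2)[symmetric] by (simp add: powr_def)
  moreover have "flux_mod \<Psi> x a = flux_mod \<Psi> x (t * a) / S \<longleftrightarrow> flux_mod \<Psi> x (t * a) = S * flux_mod \<Psi> x a"
    using S(1) by (auto simp: field_simps)
  ultimately show ?thesis unfolding S_def a_def by simp
qed

end

section \<open>Integrability of the Picone integrand\<close>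

text \<open>Lebesgue measure is complete, so the second function inherits measurability. This
  matters for the flux, which is known to be measurable only through a representative.\<close>

lemma integrable_lebesgue_on_cong_AE:
  fixes f g :: "'a::euclidean_space \<Rightarrow> real"
  assumes \<Omega>: "open \<Omega>" and f: "integrable (lebesgue_on \<Omega>) f" and eq: "AE x in lborel. x \<in> \<Omega> \<longrightarrow> f x = g x"
  shows "integrable (lebesgue_on \<Omega>) g"
proof -
  have fa: "f absolutely_integrable_on \<Omega>"
    using f \<Omega> by (simp add: set_integrable_def integrable_restrict_space)
  have "AE x in lebesgue. x \<in> \<Omega> \<longrightarrow> f x = g x" using eq by (simp add: AE_completion_iff)
  then obtain N where N: "N \<in> null_sets lebesgue" "{x. \<not> (x \<in> \<Omega> \<longrightarrow> f x = g x)} \<subseteq> N"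
    by (auto simp: eventually_ae_filter)
  have "g absolutely_integrable_on \<Omega>"
    by (rule absolutely_integrable_spike[OF fa, of N]) (use N in \<open>auto simp: negligible_iff_null_sets\<close>)
  then show ?thesis
    using \<Omega> by (simp add: set_integrable_def integrable_restrict_space)
qed

text \<open>The definition is used for the single interval between \<open>s\<close> and a nearby
  point, within \<open>s / 2\<close> and \<open>2 * s\<close>, which keeps it away from
  zero.\<close>

lemma absolutely_continuous_imp_isCont:
  assumes "locally_absolutely_continuous_pos f" "s > 0"
  shows "isCont f s"
  unfolding continuous_at_eps_delta
proof (intro allI impI)
  fix \<epsilon> :: real assume \<epsilon>: "\<epsilon> > 0"
  have "absolutely_continuous_on_interval (s / 2) (2 * s) f"
    using assms unfolding locally_absolutely_continuous_pos_def by simp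
  then obtain \<delta> where \<delta>: "\<delta> > 0" "\<And>D. finite D \<and> (\<forall>(u, v)\<in>D. s / 2 \<le> u \<and> u \<le> v \<and> v \<le> 2 * s) \<and>
        disjoint_family_on (\<lambda>(u, v). {u<..<v}) D \<and> (\<Sum>(u, v)\<in>D. v - u) < \<delta> \<Longrightarrow>
        (\<Sum>(u, v)\<in>D. \<bar>f v - f u\<bar>) < \<epsilon>"
    using \<epsilon> unfolding absolutely_continuous_on_interval_def by blast
  have "\<bar>f y - f s\<bar> < \<epsilon>" if y: "\<bar>y - s\<bar> < min \<delta> (s / 2)" for y
  proof -
    have "\<bar>f (max y s) - f (min y s)\<bar> < \<epsilon>"
      using \<delta>(2)[of "{(min y s, max y s)}"] y assms(2)
      by (auto simp: disjoint_family_on_def max_def min_def abs_if field_simps split: if_splits)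
    then show ?thesis by (cases "y \<le> s") (auto simp: abs_minus_commute max_def min_def)
  qed
  then show "\<exists>d>0. \<forall>x'. dist x' s < d \<longrightarrow> dist (f x') (f s) < \<epsilon>"
    using \<delta>(1) assms(2) by (intro exI[of _ "min \<delta> (s / 2)"]) (auto simp: dist_real_def)
qed

text \<open>
  \<open>\<Psi>\<close> is a Caratheodory function; the argument \<open>norm (\<xi> x)\<close> is approximated by functions with
  countably many values.
\<close>

lemma flux_ex_measurable:
  fixes \<Psi> :: "'a::euclidean_space \<Rightarrow> real \<Rightarrow> real"
  assumes meas: "\<And>s. s > 0 \<Longrightarrow> (\<lambda>x. \<Psi> x s) \<in> borel_measurable M"
    and cont: "AE x in M. \<forall>s>0. isCont (\<Psi> x) s"
    and \<xi>[measurable]: "\<xi> \<in> borel_measurable M"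
  obtains F where "F \<in> borel_measurable M" "AE x in M. flux \<Psi> x (\<xi> x) = F x"
proof -
  obtain N where N: "{x\<in>space M. \<not> (\<forall>s>0. isCont (\<Psi> x) s)} \<subseteq> N" "emeasure M N = 0" "N \<in> sets M"
    using cont by (rule AE_E)
  have [measurable]: "N \<in> sets M" by (rule N(3))
  define \<Psi>' where "\<Psi>' x s = (if x \<in> N then 1 else \<Psi> x s)" for x s
  \<comment> \<open>\<Psi> is controlled at positive arguments only; where \<xi> vanishes the
    argument is set to 1, which is harmless because the value is multiplied by \<xi> at the
    end.\<close>
  define \<sigma> where "\<sigma> x = (if \<xi> x = 0 then 1 else norm (\<xi> x))" for x
  have \<sigma>: "\<sigma> x > 0" for x by (simp add: \<sigma>_def)
  have [measurable]: "\<sigma> \<in> borel_measurable M" unfolding \<sigma>_def by measurable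
  \<comment> \<open>The grid point used is \<open>k + 1\<close> divided by \<open>Suc n\<close>: it
    lies above \<sigma>, so it is positive even when \<open>k\<close> is zero, and it exceeds
    \<sigma> by at most one mesh width.\<close>
  define k where "k n x = nat \<lfloor>\<sigma> x * real (Suc n)\<rfloor>" for n x
  define \<tau> where "\<tau> n x = (real (k n x) + 1) / real (Suc n)" for n x
  have \<tau>_bounds: "\<sigma> x \<le> \<tau> n x" "\<tau> n x \<le> \<sigma> x + inverse (real (Suc n))" for n x
  proof -
    have "\<sigma> x * real (Suc n) \<ge> 0" using \<sigma>[of x] by simp
    then have k: "real (k n x) \<le> \<sigma> x * real (Suc n)" "\<sigma> x * real (Suc n) \<le> real (k n x) + 1"
      unfolding k_def by linarith+
    show "\<sigma> x \<le> \<tau> n x"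
      unfolding \<tau>_def using k(2) by (subst pos_le_divide_eq) (simp_all del: of_nat_Suc)
    have "(\<sigma> x + inverse (real (Suc n))) * real (Suc n) = \<sigma> x * real (Suc n) + 1"
      by (simp add: distrib_right del: of_nat_Suc)
    with k(1) show "\<tau> n x \<le> \<sigma> x + inverse (real (Suc n))"
      unfolding \<tau>_def by (subst pos_divide_le_eq) (simp_all del: of_nat_Suc)
  qed
  have \<tau>: "(\<lambda>n. \<tau> n x) \<longlonglongrightarrow> \<sigma> x" for x
  proof (rule tendsto_sandwich)
    show "\<forall>\<^sub>F n in sequentially. \<sigma> x \<le> \<tau> n x" using \<tau>_bounds(1) by simp
    show "\<forall>\<^sub>F n in sequentially. \<tau> n x \<le> \<sigma> x + inverse (real (Suc n))" using \<tau>_bounds(2) by simp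
    show "(\<lambda>n. \<sigma> x + inverse (real (Suc n))) \<longlonglongrightarrow> \<sigma> x"
      using tendsto_add[OF tendsto_const LIMSEQ_inverse_real_of_nat, of "\<sigma> x"] by simp
  qed simp
  have "(\<lambda>x. \<Psi>' x (\<tau> n x)) \<in> borel_measurable M" for n
  proof -
    have "(\<lambda>x. (\<lambda>j x. \<Psi>' x ((real j + 1) / real (Suc n))) (k n x) x) \<in> borel_measurable M"
    proof (rule measurable_compose_countable[where f = "\<lambda>j x. \<Psi>' x ((real j + 1) / real (Suc n))" and g = "k n"])
      fix j :: nat
      have [measurable]: "(\<lambda>x. \<Psi> x ((real j + 1) / real (Suc n))) \<in> borel_measurable M"
        by (rule meas) simp
      show "(\<lambda>x. \<Psi>' x ((real j + 1) / real (Suc n))) \<in> borel_measurable M"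
        unfolding \<Psi>'_def by measurable
      show "k n \<in> measurable M (count_space UNIV)" unfolding k_def by measurable
    qed
    then show ?thesis by (simp add: \<tau>_def)
  qed
  moreover have "(\<lambda>n. \<Psi>' x (\<tau> n x)) \<longlonglongrightarrow> \<Psi>' x (\<sigma> x)" if "x \<in> space M" for x
  proof (cases "x \<in> N")
    case True
    then show ?thesis by (simp add: \<Psi>'_def)
  next
    case False
    then have "isCont (\<Psi> x) (\<sigma> x)" using N(1) that \<sigma>[of x] by blast
    then have "(\<lambda>n. \<Psi> x (\<tau> n x)) \<longlonglongrightarrow> \<Psi> x (\<sigma> x)" by (rule isCont_tendsto_compose[OF _ \<tau>])
    then show ?thesis using False by (simp add: \<Psi>'_def)
  qed
  ultimately have [measurable]: "(\<lambda>x. \<Psi>' x (\<sigma> x)) \<in> borel_measurable M"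
    by (rule borel_measurable_LIMSEQ_real[rotated])
  have "(\<lambda>x. \<Psi>' x (\<sigma> x) *\<^sub>R \<xi> x) \<in> borel_measurable M" by measurable
  moreover have "AE x in M. x \<notin> N" by (rule AE_not_in) (use N in \<open>simp add: null_sets_def\<close>)
  then have "AE x in M. flux \<Psi> x (\<xi> x) = \<Psi>' x (\<sigma> x) *\<^sub>R \<xi> x"
    by eventually_elim (simp add: flux_def \<Psi>'_def \<sigma>_def)
  ultimately show ?thesis by (rule that)
qed

text \<open>Young's inequality with constants 1 comes from comparing \<open>z\<close> with the point
  \<open>y powr (1 / (p - 1))\<close>; on either side one summand alone dominates the product. The
  constants are uniform in \<open>p\<close>, as a variable exponent requires.\<close>

lemma young_powr_conj:
  fixes y z p :: real
  assumes "y \<ge> 0" "z \<ge> 0" "p > 1"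
  shows "y * z \<le> y powr (p / (p - 1)) + z powr p"
proof (cases "y = 0")
  case False
  then have y: "y > 0" using assms by simp
  define c where "c = y powr (1 / (p - 1))"
  have c: "c > 0" "c powr (p - 1) = y" using y assms by (auto simp: c_def powr_powr)
  show ?thesis
  proof (cases "c \<le> z")
    case True
    then have z: "z > 0" using c by simp
    have "y \<le> z powr (p - 1)" unfolding c(2)[symmetric] using True c assms by (intro powr_mono2) auto
    then have "y * z \<le> z powr (p - 1) * z" using z by (intro mult_right_mono) auto
    also have "\<dots> = z powr p" using z powr_add[of z "p - 1" 1] by simp
    finally show ?thesis by (simp add: add_increasing)
  next
    case False
    then have "y * z \<le> y * c" using y by (intro mult_left_mono) auto
    also have "\<dots> = y powr (1 + 1 / (p - 1))" using y by (simp add: c_def powr_add)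
    also have "1 + 1 / (p - 1) = p / (p - 1)" using assms by (simp add: field_simps)
    finally show ?thesis by (simp add: add_increasing2)
  qed
qed simp

lemma powr_minus_one_mult_le:
  fixes y z p :: real
  assumes "y \<ge> 0" "z \<ge> 0" "p > 1"
  shows "y powr (p - 1) * z \<le> y powr p + z powr p"
proof (cases "y \<le> z")
  case True
  have "y powr (p - 1) * z \<le> z powr (p - 1) * z"
    using True assms by (intro mult_right_mono powr_mono2) auto
  also have "\<dots> = z powr p" using assms powr_add[of z "p - 1" 1] by (cases "z = 0") auto
  finally show ?thesis by (simp add: add_increasing)
next
  case False
  then have "y powr (p - 1) * z \<le> y powr (p - 1) * y" by (intro mult_left_mono) auto
  also have "\<dots> = y powr p" using assms powr_add[of y "p - 1" 1] by (cases "y = 0") auto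
  finally show ?thesis by (simp add: add_increasing2)
qed

text \<open>The Cauchy-Schwarz inequality and the growth bound reduce the integrand to four
  products, one for each pairing of \<open>a\<^sub>0\<close> or
  \<open>norm \<xi> powr (p - 1)\<close> with the norms of \<xi> and \<eta>. Each is bounded by the
  three integrable powers.\<close>

lemma integrable_flux_inner:
  fixes \<Psi> :: "'a::euclidean_space \<Rightarrow> real \<Rightarrow> real" and \<xi> \<eta> \<zeta> :: "'a \<Rightarrow> 'a"
  assumes \<Omega>: "open \<Omega>"
    and pos: "\<And>x s. x \<in> \<Omega> \<Longrightarrow> s > 0 \<Longrightarrow> \<Psi> x s > 0"
    and meas: "\<And>s. s > 0 \<Longrightarrow> (\<lambda>x. \<Psi> x s) \<in> borel_measurable (lebesgue_on \<Omega>)"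
    and cont: "AE x in lebesgue_on \<Omega>. \<forall>s>0. isCont (\<Psi> x) s"
    and p: "\<And>x. x \<in> \<Omega> \<Longrightarrow> p x > 1"
    and a\<^sub>0: "integrable (lebesgue_on \<Omega>) (\<lambda>x. \<bar>a\<^sub>0 x\<bar> powr (p x / (p x - 1)))"
    and b: "b \<ge> 0"
    and growth: "AE x in lebesgue_on \<Omega>. \<forall>s\<ge>0. flux_mod \<Psi> x s \<le> a\<^sub>0 x + b * \<bar>s\<bar> powr (p x - 1)"
    and [measurable]: "\<xi> \<in> borel_measurable (lebesgue_on \<Omega>)" "\<zeta> \<in> borel_measurable (lebesgue_on \<Omega>)"
    and int: "integrable (lebesgue_on \<Omega>) (\<lambda>x. norm (\<xi> x) powr p x)"
      "integrable (lebesgue_on \<Omega>) (\<lambda>x. norm (\<eta> x) powr p x)"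
    and bound: "AE x in lebesgue_on \<Omega>. norm (\<zeta> x) \<le> c * (norm (\<xi> x) + norm (\<eta> x))" and c: "c \<ge> 0"
  shows "integrable (lebesgue_on \<Omega>) (\<lambda>x. flux \<Psi> x (\<xi> x) \<bullet> \<zeta> x)"
proof -
  obtain F where F: "F \<in> borel_measurable (lebesgue_on \<Omega>)" "AE x in lebesgue_on \<Omega>. flux \<Psi> x (\<xi> x) = F x"
    by (rule flux_ex_measurable[OF meas cont assms(9)]) (assumption, rule that)
  note [measurable] = F(1)
  have "integrable (lebesgue_on \<Omega>) (\<lambda>x. F x \<bullet> \<zeta> x)"
  proof (rule Bochner_Integration.integrable_bound)
    show "integrable (lebesgue_on \<Omega>) (\<lambda>x. c * (2 * \<bar>a\<^sub>0 x\<bar> powr (p x / (p x - 1)) +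
        (1 + 2 * b) * norm (\<xi> x) powr p x + (1 + b) * norm (\<eta> x) powr p x))"
      using a\<^sub>0 int by auto
    show "(\<lambda>x. F x \<bullet> \<zeta> x) \<in> borel_measurable (lebesgue_on \<Omega>)" by measurable
    show "AE x in lebesgue_on \<Omega>. norm (F x \<bullet> \<zeta> x) \<le> norm (c * (2 * \<bar>a\<^sub>0 x\<bar> powr (p x / (p x - 1)) +
        (1 + 2 * b) * norm (\<xi> x) powr p x + (1 + b) * norm (\<eta> x) powr p x))"
      using F(2) growth bound AE_space
    proof eventually_elim
      case (elim x)
      have x: "x \<in> \<Omega>" using elim(4) by simp
      let ?a = "norm (\<xi> x)" and ?c = "norm (\<eta> x)" and ?q = "\<bar>a\<^sub>0 x\<bar> powr (p x / (p x - 1))"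
      note px = p[OF x]
      have "\<bar>F x \<bullet> \<zeta> x\<bar> \<le> norm (F x) * norm (\<zeta> x)" by (rule Cauchy_Schwarz_ineq2)
      also have "norm (F x) = flux_mod \<Psi> x ?a"
        using elim(1) norm_flux[of \<Psi> x "\<xi> x"] pos[OF x] by simp
      also have "flux_mod \<Psi> x ?a * norm (\<zeta> x) \<le> (\<bar>a\<^sub>0 x\<bar> + b * ?a powr (p x - 1)) * (c * (?a + ?c))"
      proof (rule mult_mono)
        show "flux_mod \<Psi> x ?a \<le> \<bar>a\<^sub>0 x\<bar> + b * ?a powr (p x - 1)"
          using elim(2) by (auto dest!: spec[of _ ?a])
      qed (use elim(3) b in auto)
      also have "\<dots> = c * (\<bar>a\<^sub>0 x\<bar> * ?a + \<bar>a\<^sub>0 x\<bar> * ?c + b * (?a powr (p x - 1) * ?a) + b * (?a powr (p x - 1) * ?c))"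
        by (simp add: algebra_simps)
      also have "\<dots> \<le> c * ((?q + ?a powr p x) + (?q + ?c powr p x) + b * (?a powr p x) + b * (?a powr p x + ?c powr p x))"
      proof (intro mult_left_mono add_mono c b)
        show "\<bar>a\<^sub>0 x\<bar> * ?a \<le> ?q + ?a powr p x" "\<bar>a\<^sub>0 x\<bar> * ?c \<le> ?q + ?c powr p x"
          by (intro young_powr_conj px; simp)+
        show "?a powr (p x - 1) * ?a \<le> ?a powr p x"
          using powr_add[of ?a "p x - 1" 1] by (cases "?a = 0") auto
        show "?a powr (p x - 1) * ?c \<le> ?a powr p x + ?c powr p x"
          by (intro powr_minus_one_mult_le px) auto
      qed
      also have "\<dots> = c * (2 * ?q + (1 + 2 * b) * ?a powr p x + (1 + b) * ?c powr p x)"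
        by (simp add: algebra_simps)
      finally show ?case by simp
    qed
  qed
  moreover have "AE x in lborel. x \<in> \<Omega> \<longrightarrow> F x \<bullet> \<zeta> x = flux \<Psi> x (\<xi> x) \<bullet> \<zeta> x"
    using F(2) unfolding AE_lebesgue_on_iff[OF \<Omega>] by eventually_elim simp
  ultimately show ?thesis by (rule integrable_lebesgue_on_cong_AE[OF \<Omega>])
qed

text \<open>This is the product rule with exponents \<open>1 - r\<close> and \<open>r\<close>. The
  bound \<open>C\<close> on the ratio supplies the missing integrability: the quotient is at most
  \<open>C powr (r - 1) * w\<^sub>2\<close>, and its gradient is dominated by a combination of the
  norms of the two gradients.\<close>

lemma weak_gradient_picone_quotient:
  fixes w\<^sub>1 w\<^sub>2 :: "'a::euclidean_space \<Rightarrow> real"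
  assumes \<Omega>: "open \<Omega>" and w: "has_weak_gradient \<Omega> w\<^sub>1 G\<^sub>1" "has_weak_gradient \<Omega> w\<^sub>2 G\<^sub>2"
    and pos: "AE x in lborel. x \<in> \<Omega> \<longrightarrow> w\<^sub>1 x > 0" "AE x in lborel. x \<in> \<Omega> \<longrightarrow> w\<^sub>2 x > 0"
    and log: "(\<lambda>x. G\<^sub>1 x /\<^sub>R w\<^sub>1 x) \<in> Lebesgue_1_loc \<Omega>" "(\<lambda>x. G\<^sub>2 x /\<^sub>R w\<^sub>2 x) \<in> Lebesgue_1_loc \<Omega>"
    and C: "AE x in lborel. x \<in> \<Omega> \<longrightarrow> w\<^sub>2 x / w\<^sub>1 x \<le> C" and r: "r \<ge> 1"
  defines "H \<equiv> \<lambda>x. (r * (w\<^sub>2 x / w\<^sub>1 x) powr (r - 1)) *\<^sub>R G\<^sub>2 x - ((r - 1) * (w\<^sub>2 x / w\<^sub>1 x) powr r) *\<^sub>R G\<^sub>1 x"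
  shows "has_weak_gradient \<Omega> (\<lambda>x. w\<^sub>2 x powr r / w\<^sub>1 x powr (r - 1)) H"
    and "H \<in> borel_measurable (lebesgue_on \<Omega>)"
    and "AE x in lborel. x \<in> \<Omega> \<longrightarrow> norm (H x) \<le> r * C powr (r - 1) * norm (G\<^sub>2 x) + (r - 1) * C powr r * norm (G\<^sub>1 x)"
proof -
  have l1: "w\<^sub>1 \<in> Lebesgue_1_loc \<Omega>" "w\<^sub>2 \<in> Lebesgue_1_loc \<Omega>" "G\<^sub>1 \<in> Lebesgue_1_loc \<Omega>" "G\<^sub>2 \<in> Lebesgue_1_loc \<Omega>"
    using w by (auto simp: has_weak_gradient_def)
  note [measurable] = l1[THEN Lebesgue_1_loc_measurable[OF \<Omega>]]
  let ?f = "\<lambda>x. w\<^sub>2 x powr r / w\<^sub>1 x powr (r - 1)"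
  show Hm: "H \<in> borel_measurable (lebesgue_on \<Omega>)" unfolding H_def by measurable
  have fm: "?f \<in> borel_measurable (lebesgue_on \<Omega>)" by measurable
  show HC: "AE x in lborel. x \<in> \<Omega> \<longrightarrow> norm (H x) \<le> r * C powr (r - 1) * norm (G\<^sub>2 x) + (r - 1) * C powr r * norm (G\<^sub>1 x)"
    using pos C
  proof eventually_elim
    case (elim x)
    show ?case
    proof
      assume x: "x \<in> \<Omega>"
      have "(w\<^sub>2 x / w\<^sub>1 x) powr s \<le> C powr s" if "s \<ge> 0" for s
        using elim x that by (intro powr_mono2) auto
      then have "norm ((r * (w\<^sub>2 x / w\<^sub>1 x) powr (r - 1)) *\<^sub>R G\<^sub>2 x) \<le> r * C powr (r - 1) * norm (G\<^sub>2 x)"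
          "norm (((r - 1) * (w\<^sub>2 x / w\<^sub>1 x) powr r) *\<^sub>R G\<^sub>1 x) \<le> (r - 1) * C powr r * norm (G\<^sub>1 x)"
        using r by (auto simp: abs_mult intro!: mult_right_mono mult_left_mono)
      then show "norm (H x) \<le> r * C powr (r - 1) * norm (G\<^sub>2 x) + (r - 1) * C powr r * norm (G\<^sub>1 x)"
        unfolding H_def using norm_triangle_ineq4[of "(r * (w\<^sub>2 x / w\<^sub>1 x) powr (r - 1)) *\<^sub>R G\<^sub>2 x"
          "((r - 1) * (w\<^sub>2 x / w\<^sub>1 x) powr r) *\<^sub>R G\<^sub>1 x"] by linarith
    qed
  qed
  have Hl: "H \<in> Lebesgue_1_loc \<Omega>"
    using Lebesgue_1_loc_linear[OF Lebesgue_1_loc_norm[OF l1(4)] Lebesgue_1_loc_norm[OF l1(3)],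
        of "r * C powr (r - 1)" "(r - 1) * C powr r"]
    by (intro Lebesgue_1_loc_bound[OF \<Omega> _ Hm HC]) simp
  have quot: "AE x in lborel. x \<in> \<Omega> \<longrightarrow> ?f x = w\<^sub>2 x * (w\<^sub>2 x / w\<^sub>1 x) powr (r - 1) \<and>
      ?f x / w\<^sub>1 x = (w\<^sub>2 x / w\<^sub>1 x) powr r \<and> ?f x / w\<^sub>2 x = (w\<^sub>2 x / w\<^sub>1 x) powr (r - 1)"
    using pos
  proof eventually_elim
    case (elim x)
    have "w powr r = w * w powr (r - 1)" if "w > 0" for w :: real
      using that powr_add[of w 1 "r - 1"] by simp
    then show ?case using elim by (auto simp: powr_divide)
  qed
  have fl: "?f \<in> Lebesgue_1_loc \<Omega>"
  proof (rule Lebesgue_1_loc_bound[OF \<Omega> _ fm])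
    show "(\<lambda>x. C powr (r - 1) * w\<^sub>2 x) \<in> Lebesgue_1_loc \<Omega>"
      using Lebesgue_1_loc_linear[OF l1(2,2), of "C powr (r - 1)" 0] by simp
    show "AE x in lborel. x \<in> \<Omega> \<longrightarrow> norm (?f x) \<le> C powr (r - 1) * w\<^sub>2 x"
      using pos C quot
    proof eventually_elim
      case (elim x)
      show ?case
      proof
        assume x: "x \<in> \<Omega>"
        have "(w\<^sub>2 x / w\<^sub>1 x) powr (r - 1) \<le> C powr (r - 1)"
          using elim x r by (intro powr_mono2) auto
        from mult_left_mono[OF this, of "w\<^sub>2 x"] show "norm (?f x) \<le> C powr (r - 1) * w\<^sub>2 x"
          using elim x by (simp add: mult.commute)
      qed
    qed
  qed
  show "has_weak_gradient \<Omega> ?f H"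
  proof (rule weak_gradient_powr_mult[OF \<Omega> w pos log _ fl _ Hl, of "1 - r" r])
    show "AE x in lborel. x \<in> \<Omega> \<longrightarrow> ?f x = w\<^sub>1 x powr (1 - r) * w\<^sub>2 x powr r"
      using pos(1)
    proof eventually_elim
      case (elim x)
      show ?case using powr_minus_divide[of "w\<^sub>1 x" "r - 1"] by simp
    qed
    show "AE x in lborel. x \<in> \<Omega> \<longrightarrow> H x = ?f x *\<^sub>R ((1 - r) *\<^sub>R (G\<^sub>1 x /\<^sub>R w\<^sub>1 x) + r *\<^sub>R (G\<^sub>2 x /\<^sub>R w\<^sub>2 x))"
      using quot
    proof eventually_elim
      case (elim x)
      show ?case
      proof
        assume "x \<in> \<Omega>"
        with elim have q: "?f x / w\<^sub>1 x = (w\<^sub>2 x / w\<^sub>1 x) powr r" "?f x / w\<^sub>2 x = (w\<^sub>2 x / w\<^sub>1 x) powr (r - 1)"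
          by blast+
        have "H x = (r * (?f x / w\<^sub>2 x)) *\<^sub>R G\<^sub>2 x - ((r - 1) * (?f x / w\<^sub>1 x)) *\<^sub>R G\<^sub>1 x"
          by (simp only: H_def q)
        also have "\<dots> = ?f x *\<^sub>R ((1 - r) *\<^sub>R (G\<^sub>1 x /\<^sub>R w\<^sub>1 x) + r *\<^sub>R (G\<^sub>2 x /\<^sub>R w\<^sub>2 x))"
        proof -
          have "F * ((1 - r) * inverse a) = - ((r - 1) * (F / a))" "F * (r * inverse b) = r * (F / b)" for F a b
            by (simp_all add: divide_inverse algebra_simps)
          then show ?thesis by (simp only: scaleR_add_right scaleR_scaleR scaleR_minus_left) simp
        qed
        finally show "H x = ?f x *\<^sub>R ((1 - r) *\<^sub>R (G\<^sub>1 x /\<^sub>R w\<^sub>1 x) + r *\<^sub>R (G\<^sub>2 x /\<^sub>R w\<^sub>2 x))" .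
      qed
    qed
  qed
qed

text \<open>Both integrals converge, so their equality says that the nonnegative difference of the
  integrands has integral zero. Nonnegativity is a hypothesis because it has different origins for
  \<open>r = 1\<close> and \<open>r > 1\<close>.\<close>

lemma picone_equality_iff:
  fixes \<Omega> :: "'a::euclidean_space set" and w\<^sub>1 w\<^sub>2 a\<^sub>0 p :: "'a \<Rightarrow> real" and \<Psi> :: "'a \<Rightarrow> real \<Rightarrow> real"
  assumes \<Omega>: "open \<Omega>"
    and pos: "\<And>x s. x \<in> \<Omega> \<Longrightarrow> s > 0 \<Longrightarrow> \<Psi> x s > 0"
    and meas: "\<And>s. s > 0 \<Longrightarrow> (\<lambda>x. \<Psi> x s) \<in> borel_measurable (lebesgue_on \<Omega>)"
    and cont: "AE x in lebesgue_on \<Omega>. \<forall>s>0. isCont (\<Psi> x) s"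
    and p: "\<And>x. x \<in> \<Omega> \<Longrightarrow> p x > 1"
    and a\<^sub>0: "a\<^sub>0 \<in> Lebesgue_var \<Omega> (conj_exponent p)" and b: "b \<ge> 0"
    and growth: "AE x in lebesgue_on \<Omega>. \<forall>s\<ge>0. flux_mod \<Psi> x s \<le> a\<^sub>0 x + b * \<bar>s\<bar> powr (p x - 1)"
    and r: "r \<ge> 1"
    and nonneg: "AE x in lebesgue_on \<Omega>. \<forall>\<xi> \<eta> t. t > 0 \<longrightarrow> picone_integrand \<Psi> r x \<xi> \<eta> t \<ge> 0"
    and w\<^sub>1: "w\<^sub>1 \<in> Sobolev_var \<Omega> p" "AE x in lebesgue_on \<Omega>. w\<^sub>1 x > 0"
    and w\<^sub>2: "w\<^sub>2 \<in> Sobolev_var \<Omega> p" "AE x in lebesgue_on \<Omega>. w\<^sub>2 x > 0"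
    and ratios: "(\<lambda>x. w\<^sub>2 x / w\<^sub>1 x) \<in> Lebesgue_infty \<Omega>" "(\<lambda>x. w\<^sub>1 x / w\<^sub>2 x) \<in> Lebesgue_infty \<Omega>"
    and log_gradients:
      "(\<lambda>x. weak_grad \<Omega> w\<^sub>1 x /\<^sub>R w\<^sub>1 x) \<in> Lebesgue_1_loc \<Omega>"
      "(\<lambda>x. weak_grad \<Omega> w\<^sub>2 x /\<^sub>R w\<^sub>2 x) \<in> Lebesgue_1_loc \<Omega>"
  shows "picone_equality \<Omega> \<Psi> r w\<^sub>1 w\<^sub>2 \<longleftrightarrow>
    (AE x in lebesgue_on \<Omega>. picone_integrand \<Psi> r x (weak_grad \<Omega> w\<^sub>1 x) (weak_grad \<Omega> w\<^sub>2 x) (w\<^sub>2 x / w\<^sub>1 x) = 0)"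
proof -
  define G\<^sub>1 G\<^sub>2 where "G\<^sub>1 = weak_grad \<Omega> w\<^sub>1" and "G\<^sub>2 = weak_grad \<Omega> w\<^sub>2"
  have G: "has_weak_gradient \<Omega> w (weak_grad \<Omega> w)"
      "integrable (lebesgue_on \<Omega>) (\<lambda>x. norm (weak_grad \<Omega> w x) powr p x)"
    if S: "w \<in> Sobolev_var \<Omega> p" for w
  proof -
    obtain G where G: "has_weak_gradient \<Omega> w G" "G \<in> Lebesgue_var \<Omega> p"
      using S unfolding Sobolev_var_def by blast
    show "has_weak_gradient \<Omega> w (weak_grad \<Omega> w)" by (rule has_weak_gradient_weak_grad[OF G(1)])
    have "integrable (lebesgue_on \<Omega>) (\<lambda>x. norm (G x) powr p x)" using G(2) by (simp add: Lebesgue_var_def)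
    moreover have "AE x in lborel. x \<in> \<Omega> \<longrightarrow> norm (G x) powr p x = norm (weak_grad \<Omega> w x) powr p x"
      using weak_grad_eq[OF \<Omega> G(1)] by eventually_elim simp
    ultimately show "integrable (lebesgue_on \<Omega>) (\<lambda>x. norm (weak_grad \<Omega> w x) powr p x)"
      by (rule integrable_lebesgue_on_cong_AE[OF \<Omega>])
  qed
  note wg = G(1)[OF w\<^sub>1(1), folded G\<^sub>1_def] G(1)[OF w\<^sub>2(1), folded G\<^sub>2_def]
  note modular = G(2)[OF w\<^sub>1(1), folded G\<^sub>1_def] G(2)[OF w\<^sub>2(1), folded G\<^sub>2_def]
  have "G\<^sub>1 \<in> Lebesgue_1_loc \<Omega>" "G\<^sub>2 \<in> Lebesgue_1_loc \<Omega>" using wg by (auto simp: has_weak_gradient_def)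
  note Gm = this[THEN Lebesgue_1_loc_measurable[OF \<Omega>]]
  note pos1 = w\<^sub>1(2)[unfolded AE_lebesgue_on_iff[OF \<Omega>]] and pos2 = w\<^sub>2(2)[unfolded AE_lebesgue_on_iff[OF \<Omega>]]
  obtain C where C: "AE x in lborel. x \<in> \<Omega> \<longrightarrow> \<bar>w\<^sub>2 x / w\<^sub>1 x\<bar> \<le> C"
    using ratios(1) unfolding Lebesgue_infty_def AE_lebesgue_on_iff[OF \<Omega>] by blast
  obtain C' where C': "AE x in lborel. x \<in> \<Omega> \<longrightarrow> \<bar>w\<^sub>1 x / w\<^sub>2 x\<bar> \<le> C'"
    using ratios(2) unfolding Lebesgue_infty_def AE_lebesgue_on_iff[OF \<Omega>] by blast
  have C1: "AE x in lborel. x \<in> \<Omega> \<longrightarrow> w\<^sub>2 x / w\<^sub>1 x \<le> C" using C by eventually_elim (blast intro: order_trans[OF abs_ge_self])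
  have C2: "AE x in lborel. x \<in> \<Omega> \<longrightarrow> w\<^sub>1 x / w\<^sub>2 x \<le> C'" using C' by eventually_elim (blast intro: order_trans[OF abs_ge_self])
  define H\<^sub>1 where "H\<^sub>1 x = (r * (w\<^sub>2 x / w\<^sub>1 x) powr (r - 1)) *\<^sub>R G\<^sub>2 x - ((r - 1) * (w\<^sub>2 x / w\<^sub>1 x) powr r) *\<^sub>R G\<^sub>1 x" for x
  define H\<^sub>2 where "H\<^sub>2 x = (r * (w\<^sub>1 x / w\<^sub>2 x) powr (r - 1)) *\<^sub>R G\<^sub>1 x - ((r - 1) * (w\<^sub>1 x / w\<^sub>2 x) powr r) *\<^sub>R G\<^sub>2 x" for x
  note H1 = weak_gradient_picone_quotient[OF \<Omega> wg pos1 pos2 log_gradients[folded G\<^sub>1_def G\<^sub>2_def] C1 r,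
      folded H\<^sub>1_def]
  note H2 = weak_gradient_picone_quotient[OF \<Omega> wg(2,1) pos2 pos1 log_gradients(2,1)[folded G\<^sub>1_def G\<^sub>2_def] C2 r,
      folded H\<^sub>2_def]
  note diff_measurable = borel_measurable_diff[OF Gm(1) H1(2)] borel_measurable_diff[OF H2(2) Gm(2)]
  let ?v\<^sub>1 = "\<lambda>y. w\<^sub>1 y - w\<^sub>2 y powr r / w\<^sub>1 y powr (r - 1)"
  let ?v\<^sub>2 = "\<lambda>y. w\<^sub>1 y powr r / w\<^sub>2 y powr (r - 1) - w\<^sub>2 y"
  have g1: "AE x in lborel. x \<in> \<Omega> \<longrightarrow> weak_grad \<Omega> ?v\<^sub>1 x = G\<^sub>1 x - H\<^sub>1 x"
    using weak_grad_eq[OF \<Omega> weak_gradient_linear[OF \<Omega> wg(1) H1(1), of 1 "- 1"]] by simp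
  have g2: "AE x in lborel. x \<in> \<Omega> \<longrightarrow> weak_grad \<Omega> ?v\<^sub>2 x = H\<^sub>2 x - G\<^sub>2 x"
    using weak_grad_eq[OF \<Omega> weak_gradient_linear[OF \<Omega> H2(1) wg(2), of 1 "- 1"]] by simp
  define E\<^sub>1 E\<^sub>2 where "E\<^sub>1 x = flux \<Psi> x (G\<^sub>1 x) \<bullet> (G\<^sub>1 x - H\<^sub>1 x)" and "E\<^sub>2 x = flux \<Psi> x (G\<^sub>2 x) \<bullet> (H\<^sub>2 x - G\<^sub>2 x)" for x
  have a\<^sub>0': "integrable (lebesgue_on \<Omega>) (\<lambda>x. \<bar>a\<^sub>0 x\<bar> powr (p x / (p x - 1)))"
    using a\<^sub>0 by (simp add: Lebesgue_var_def conj_exponent_def)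
  \<comment> \<open>The sum of the constants for both quotients, so that one number dominates both
    gradients of differences.\<close>
  define M where "M = 1 + r * C powr (r - 1) + (r - 1) * C powr r + r * C' powr (r - 1) + (r - 1) * C' powr r"
  have M: "M \<ge> 0" using r by (simp add: M_def)
  have le: "norm g + (x1 * norm g' + x2 * norm g) \<le> (1 + x1 + x2 + x3 + x4) * (norm g + norm g')"
    if "x1 \<ge> 0" "x2 \<ge> 0" "x3 \<ge> 0" "x4 \<ge> 0" for g g' :: 'a and x1 x2 x3 x4 :: real
  proof -
    have "0 \<le> norm g' + x1 * norm g + x2 * norm g' + x3 * (norm g + norm g') + x4 * (norm g + norm g')"
      using that by (intro add_nonneg_nonneg mult_nonneg_nonneg) auto
    then show ?thesis by (simp add: algebra_simps)
  qed
  have bound1: "AE x in lebesgue_on \<Omega>. norm (G\<^sub>1 x - H\<^sub>1 x) \<le> M * (norm (G\<^sub>1 x) + norm (G\<^sub>2 x))"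
    using H1(3) unfolding AE_lebesgue_on_iff[OF \<Omega>]
  proof eventually_elim
    case (elim x)
    show ?case
    proof
      assume "x \<in> \<Omega>"
      with elim have "norm (G\<^sub>1 x - H\<^sub>1 x) \<le> norm (G\<^sub>1 x) + (r * C powr (r - 1) * norm (G\<^sub>2 x) + (r - 1) * C powr r * norm (G\<^sub>1 x))"
        using norm_triangle_ineq4[of "G\<^sub>1 x" "H\<^sub>1 x"] by linarith
      also have "\<dots> \<le> M * (norm (G\<^sub>1 x) + norm (G\<^sub>2 x))"
        unfolding M_def using r by (intro le) auto
      finally show "norm (G\<^sub>1 x - H\<^sub>1 x) \<le> M * (norm (G\<^sub>1 x) + norm (G\<^sub>2 x))" .
    qed
  qed
  have bound2: "AE x in lebesgue_on \<Omega>. norm (H\<^sub>2 x - G\<^sub>2 x) \<le> M * (norm (G\<^sub>2 x) + norm (G\<^sub>1 x))"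
    using H2(3) unfolding AE_lebesgue_on_iff[OF \<Omega>]
  proof eventually_elim
    case (elim x)
    show ?case
    proof
      assume "x \<in> \<Omega>"
      with elim have "norm (H\<^sub>2 x - G\<^sub>2 x) \<le> norm (G\<^sub>2 x) + (r * C' powr (r - 1) * norm (G\<^sub>1 x) + (r - 1) * C' powr r * norm (G\<^sub>2 x))"
        using norm_triangle_ineq4[of "H\<^sub>2 x" "G\<^sub>2 x"] by linarith
      also have "\<dots> \<le> (1 + r * C' powr (r - 1) + (r - 1) * C' powr r + r * C powr (r - 1) + (r - 1) * C powr r) *
          (norm (G\<^sub>2 x) + norm (G\<^sub>1 x))"
        using r by (intro le) auto
      also have "\<dots> = M * (norm (G\<^sub>2 x) + norm (G\<^sub>1 x))" by (simp add: M_def)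
      finally show "norm (H\<^sub>2 x - G\<^sub>2 x) \<le> M * (norm (G\<^sub>2 x) + norm (G\<^sub>1 x))" .
    qed
  qed
  have E1: "integrable (lebesgue_on \<Omega>) E\<^sub>1"
    unfolding E\<^sub>1_def
    by (rule integrable_flux_inner[OF \<Omega> pos meas cont p a\<^sub>0' b growth Gm(1) diff_measurable(1) modular bound1 M])
  have E2: "integrable (lebesgue_on \<Omega>) E\<^sub>2"
    unfolding E\<^sub>2_def
    by (rule integrable_flux_inner[OF \<Omega> pos meas cont p a\<^sub>0' b growth Gm(2) diff_measurable(2) modular(2,1) bound2 M])
  have I1: "(LINT x|lebesgue_on \<Omega>. flux \<Psi> x (weak_grad \<Omega> w\<^sub>1 x) \<bullet> weak_grad \<Omega> ?v\<^sub>1 x) = (LINT x|lebesgue_on \<Omega>. E\<^sub>1 x)"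
  proof -
    have eq: "AE x in lborel. x \<in> \<Omega> \<longrightarrow> E\<^sub>1 x = flux \<Psi> x (weak_grad \<Omega> w\<^sub>1 x) \<bullet> weak_grad \<Omega> ?v\<^sub>1 x"
      using g1 by eventually_elim (simp add: E\<^sub>1_def G\<^sub>1_def)
    show ?thesis
      using E1 integrable_lebesgue_on_cong_AE[OF \<Omega> E1 eq] eq
      by (intro integral_cong_AE) (auto simp: AE_lebesgue_on_iff[OF \<Omega>])
  qed
  have I2: "(LINT x|lebesgue_on \<Omega>. flux \<Psi> x (weak_grad \<Omega> w\<^sub>2 x) \<bullet> weak_grad \<Omega> ?v\<^sub>2 x) = (LINT x|lebesgue_on \<Omega>. E\<^sub>2 x)"
  proof -
    have eq: "AE x in lborel. x \<in> \<Omega> \<longrightarrow> E\<^sub>2 x = flux \<Psi> x (weak_grad \<Omega> w\<^sub>2 x) \<bullet> weak_grad \<Omega> ?v\<^sub>2 x"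
      using g2 by eventually_elim (simp add: E\<^sub>2_def G\<^sub>2_def)
    show ?thesis
      using E2 integrable_lebesgue_on_cong_AE[OF \<Omega> E2 eq] eq
      by (intro integral_cong_AE) (auto simp: AE_lebesgue_on_iff[OF \<Omega>])
  qed
  let ?D = "\<lambda>x. picone_integrand \<Psi> r x (G\<^sub>1 x) (G\<^sub>2 x) (w\<^sub>2 x / w\<^sub>1 x)"
  have D: "AE x in lebesgue_on \<Omega>. E\<^sub>1 x - E\<^sub>2 x = ?D x"
    using w\<^sub>1(2) w\<^sub>2(2)
  proof eventually_elim
    case (elim x)
    have "(w\<^sub>1 x / w\<^sub>2 x) powr s = (w\<^sub>2 x / w\<^sub>1 x) powr (- s)" for s
      using elim by (simp add: powr_divide powr_minus divide_simps)
    from this[of "r - 1"] this[of r] show ?case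
      by (simp add: picone_integrand_def E\<^sub>1_def E\<^sub>2_def H\<^sub>1_def H\<^sub>2_def)
  qed
  have ge: "AE x in lebesgue_on \<Omega>. E\<^sub>1 x - E\<^sub>2 x \<ge> 0"
    using D nonneg w\<^sub>1(2) w\<^sub>2(2) by eventually_elim simp
  have "picone_equality \<Omega> \<Psi> r w\<^sub>1 w\<^sub>2 \<longleftrightarrow> (LINT x|lebesgue_on \<Omega>. E\<^sub>1 x - E\<^sub>2 x) = 0"
    unfolding picone_equality_def I1 I2 using E1 E2 by simp
  also have "\<dots> \<longleftrightarrow> (AE x in lebesgue_on \<Omega>. E\<^sub>1 x - E\<^sub>2 x = 0)"
    using E1 E2 ge by (intro integral_nonneg_eq_0_iff_AE) auto
  also have "\<dots> \<longleftrightarrow> (AE x in lebesgue_on \<Omega>. ?D x = 0)"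
  proof
    assume "AE x in lebesgue_on \<Omega>. E\<^sub>1 x - E\<^sub>2 x = 0"
    with D show "AE x in lebesgue_on \<Omega>. ?D x = 0" by eventually_elim simp
  next
    assume "AE x in lebesgue_on \<Omega>. ?D x = 0"
    with D show "AE x in lebesgue_on \<Omega>. E\<^sub>1 x - E\<^sub>2 x = 0" by eventually_elim simp
  qed
  finally show ?thesis by (simp add: G\<^sub>1_def G\<^sub>2_def)
qed

text \<open>The ratio is a product with exponents -1 and 1; its gradient is the ratio times the
  difference of the logarithmic gradients, which cancels. Boundedness makes the ratio locally
  integrable.\<close>

lemma weak_gradients_proportional_imp_ratio_constant:
  fixes w\<^sub>1 w\<^sub>2 :: "'a::euclidean_space \<Rightarrow> real"
  assumes \<Omega>: "open \<Omega>" "connected \<Omega>" "\<Omega> \<noteq> {}"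
    and w: "has_weak_gradient \<Omega> w\<^sub>1 G\<^sub>1" "has_weak_gradient \<Omega> w\<^sub>2 G\<^sub>2"
    and pos: "AE x in lborel. x \<in> \<Omega> \<longrightarrow> w\<^sub>1 x > 0" "AE x in lborel. x \<in> \<Omega> \<longrightarrow> w\<^sub>2 x > 0"
    and log: "(\<lambda>x. G\<^sub>1 x /\<^sub>R w\<^sub>1 x) \<in> Lebesgue_1_loc \<Omega>" "(\<lambda>x. G\<^sub>2 x /\<^sub>R w\<^sub>2 x) \<in> Lebesgue_1_loc \<Omega>"
    and bounded: "(\<lambda>x. w\<^sub>2 x / w\<^sub>1 x) \<in> Lebesgue_infty \<Omega>"
    and par: "AE x in lborel. x \<in> \<Omega> \<longrightarrow> G\<^sub>2 x = (w\<^sub>2 x / w\<^sub>1 x) *\<^sub>R G\<^sub>1 x"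
  obtains l where "l > 0" "AE x in lborel. x \<in> \<Omega> \<longrightarrow> w\<^sub>2 x = l * w\<^sub>1 x"
proof -
  obtain C where C: "(\<lambda>x. w\<^sub>2 x / w\<^sub>1 x) \<in> borel_measurable (lebesgue_on \<Omega>)"
      "AE x in lborel. x \<in> \<Omega> \<longrightarrow> \<bar>w\<^sub>2 x / w\<^sub>1 x\<bar> \<le> C"
    using bounded unfolding Lebesgue_infty_def AE_lebesgue_on_iff[OF \<Omega>(1)] by blast
  have const: "(\<lambda>x. c) \<in> Lebesgue_1_loc \<Omega>" "(\<lambda>x. 0 :: 'a) \<in> Lebesgue_1_loc \<Omega>" for c :: real
    using weak_gradient_const[OF \<Omega>(1), of c] by (auto simp: has_weak_gradient_def)
  have "has_weak_gradient \<Omega> (\<lambda>x. w\<^sub>2 x / w\<^sub>1 x) (\<lambda>x. 0)"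
  proof (rule weak_gradient_powr_mult[OF \<Omega>(1) w pos log, of _ "- 1" 1])
    show "AE x in lborel. x \<in> \<Omega> \<longrightarrow> w\<^sub>2 x / w\<^sub>1 x = w\<^sub>1 x powr (- 1) * w\<^sub>2 x powr 1"
      using pos by eventually_elim (auto simp: powr_minus divide_inverse)
    show "(\<lambda>x. w\<^sub>2 x / w\<^sub>1 x) \<in> Lebesgue_1_loc \<Omega>"
      using C by (intro Lebesgue_1_loc_bound[OF \<Omega>(1) const(1)[of C]]) auto
    show "AE x in lborel. x \<in> \<Omega> \<longrightarrow>
        0 = (w\<^sub>2 x / w\<^sub>1 x) *\<^sub>R ((- 1) *\<^sub>R (G\<^sub>1 x /\<^sub>R w\<^sub>1 x) + 1 *\<^sub>R (G\<^sub>2 x /\<^sub>R w\<^sub>2 x))"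
      using par pos by eventually_elim (auto simp: divide_inverse)
  qed (rule const)
  then obtain l where l: "AE x in lborel. x \<in> \<Omega> \<longrightarrow> w\<^sub>2 x / w\<^sub>1 x = l"
    by (rule weak_gradient_zero_imp_constant[OF \<Omega>(1,2)]) (rule that)
  have "AE x in lborel. x \<in> \<Omega> \<longrightarrow> l > 0" using l pos by eventually_elim auto
  from AE_lborel_ex_in_open[OF this \<Omega>(1,3)] have "l > 0" by blast
  moreover have "AE x in lborel. x \<in> \<Omega> \<longrightarrow> w\<^sub>2 x = l * w\<^sub>1 x" using l pos by eventually_elim auto
  ultimately show ?thesis by (rule that)
qed

section \<open>Equality in the Picone inequality\<close>

lemma weak_grad_zero_iff_constant:
  fixes u :: "'a::euclidean_space \<Rightarrow> real"
  assumes \<Omega>: "open \<Omega>" "connected \<Omega>" and u: "has_weak_gradient \<Omega> u G"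
  shows "(AE x in lborel. x \<in> \<Omega> \<longrightarrow> G x = 0) \<longleftrightarrow> (\<exists>c. AE x in lborel. x \<in> \<Omega> \<longrightarrow> u x = c)"
proof
  assume "AE x in lborel. x \<in> \<Omega> \<longrightarrow> G x = 0"
  then have "has_weak_gradient \<Omega> u (\<lambda>x. 0)"
    by (intro has_weak_gradient_cong_AE[OF \<Omega>(1) _ _ u]) auto
  then show "\<exists>c. AE x in lborel. x \<in> \<Omega> \<longrightarrow> u x = c"
    by (rule weak_gradient_zero_imp_constant[OF \<Omega>]) blast
next
  assume "\<exists>c. AE x in lborel. x \<in> \<Omega> \<longrightarrow> u x = c"
  then obtain c where "AE x in lborel. x \<in> \<Omega> \<longrightarrow> u x = c" by blast
  then have "AE x in lborel. x \<in> \<Omega> \<longrightarrow> c = u x" by eventually_elim simp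
  then have "has_weak_gradient \<Omega> u (\<lambda>x. 0)"
    by (rule has_weak_gradient_cong_AE[OF \<Omega>(1) _ _ weak_gradient_const[OF \<Omega>(1)]]) simp
  from weak_gradient_unique[OF \<Omega>(1) u this] show "AE x in lborel. x \<in> \<Omega> \<longrightarrow> G x = 0" .
qed

theorem theorem5p1:
  fixes \<Omega> :: "(real ^ 'n) set"
    and p a\<^sub>0 w\<^sub>1 w\<^sub>2 :: "real ^ 'n \<Rightarrow> real"
    and \<Psi> :: "real ^ 'n \<Rightarrow> real \<Rightarrow> real"
    and b \<delta> \<delta>' r :: real
  assumes dim: "CARD('n) \<ge> 2"
    and domain: "bounded_lipschitz_domain \<Omega>"
    and p_gt_1: "\<forall>x\<in>closure \<Omega>. p x > 1"
    and p_regular: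
      "log_hoelder_on (closure \<Omega>) p \<and>
         (INF x\<in>closure \<Omega>. p x) \<ge> 2 * real CARD('n) / (real CARD('n) + 2) \<or>
       continuous_on (closure \<Omega>) p \<and>
         (INF x\<in>closure \<Omega>. p x) > 2 * real CARD('n) / (real CARD('n) + 2)"
    and \<Psi>_pos: "\<forall>x\<in>closure \<Omega>. \<forall>s>0. \<Psi> x s > 0"
    and \<Psi>_measurable: "\<forall>s>0. (\<lambda>x. \<Psi> x s) \<in> borel_measurable (lebesgue_on (closure \<Omega>))"
    and \<Psi>_abs_cont: "AE x in lebesgue_on \<Omega>. locally_absolutely_continuous_pos (\<Psi> x)"
    and \<Psi>_lim: "\<forall>x\<in>\<Omega>. ((\<lambda>s. \<Psi> x s * s) \<longlongrightarrow> 0) (at_right 0)"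
    and \<Psi>_mono: "AE x in lebesgue_on \<Omega>. strict_mono_on {0<..} (\<lambda>s. \<Psi> x s * s)"
    and a\<^sub>0: "a\<^sub>0 \<in> Lebesgue_var \<Omega> (conj_exponent p)" "AE x in lebesgue_on \<Omega>. a\<^sub>0 x \<ge> 0"
    and b: "b \<ge> 0"
    and growth: "AE x in lebesgue_on \<Omega>. \<forall>s\<ge>0.
      flux_mod \<Psi> x s \<le> a\<^sub>0 x + b * \<bar>s\<bar> powr (p x - 1)"
    and \<delta>: "\<delta> > 0" and \<delta>': "\<delta>' \<ge> 0"
    and coercive: "\<forall>v\<in>Sobolev_var \<Omega> p.
      (LINT x|lebesgue_on \<Omega>. flux_potential \<Psi> x (weak_grad \<Omega> v x)) \<ge>
        \<delta> * (LINT x|lebesgue_on \<Omega>. norm (weak_grad \<Omega> v x) powr p x) - \<delta>'"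
    and r: "r \<ge> 1"
    and r_mono: "AE x in lebesgue_on \<Omega>. mono_on {0<..} (\<lambda>s. flux_mod \<Psi> x s / s powr (r - 1))"
    and w\<^sub>1: "w\<^sub>1 \<in> Sobolev_var \<Omega> p" "AE x in lebesgue_on \<Omega>. w\<^sub>1 x > 0"
    and w\<^sub>2: "w\<^sub>2 \<in> Sobolev_var \<Omega> p" "AE x in lebesgue_on \<Omega>. w\<^sub>2 x > 0"
    and ratios: "(\<lambda>x. w\<^sub>2 x / w\<^sub>1 x) \<in> Lebesgue_infty \<Omega>" "(\<lambda>x. w\<^sub>1 x / w\<^sub>2 x) \<in> Lebesgue_infty \<Omega>"
    and log_gradients:
      "(\<lambda>x. weak_grad \<Omega> w\<^sub>1 x /\<^sub>R w\<^sub>1 x) \<in> Lebesgue_1_loc \<Omega>"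
      "(\<lambda>x. weak_grad \<Omega> w\<^sub>2 x /\<^sub>R w\<^sub>2 x) \<in> Lebesgue_1_loc \<Omega>"
  shows
    "(r = 1 \<longrightarrow>
        (picone_equality \<Omega> \<Psi> r w\<^sub>1 w\<^sub>2 \<longleftrightarrow> (\<exists>c. AE x in lebesgue_on \<Omega>. w\<^sub>1 x - w\<^sub>2 x = c))) \<and>
     (r > 1 \<longrightarrow>
        (picone_equality \<Omega> \<Psi> r w\<^sub>1 w\<^sub>2 \<longrightarrow> (\<exists>l>0. AE x in lebesgue_on \<Omega>. w\<^sub>2 x = l * w\<^sub>1 x)) \<and>
        (\<forall>l>0. (AE x in lebesgue_on \<Omega>. w\<^sub>2 x = l * w\<^sub>1 x) \<longrightarrow>
           (l = 1 \<longrightarrow> picone_equality \<Omega> \<Psi> r w\<^sub>1 w\<^sub>2) \<and>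
           (l \<noteq> 1 \<longrightarrow>
              (picone_equality \<Omega> \<Psi> r w\<^sub>1 w\<^sub>2 \<longleftrightarrow>
               (AE x in lebesgue_on \<Omega>.
                  flux_mod \<Psi> x (l * norm (weak_grad \<Omega> w\<^sub>1 x)) =
                  l powr (r - 1) * flux_mod \<Psi> x (norm (weak_grad \<Omega> w\<^sub>1 x)))))) \<and>
        ((AE x in lebesgue_on \<Omega>.
            strict_mono_on {0<..} (\<lambda>s. flux_mod \<Psi> x s / s powr (r - 1))) \<longrightarrow>
           (picone_equality \<Omega> \<Psi> r w\<^sub>1 w\<^sub>2 \<longleftrightarrow>
              (AE x in lebesgue_on \<Omega>. w\<^sub>1 x = w\<^sub>2 x) \<or>
              (\<exists>c\<^sub>1 c\<^sub>2. c\<^sub>1 \<noteq> c\<^sub>2 \<and> (AE x in lebesgue_on \<Omega>. w\<^sub>1 x = c\<^sub>1) \<and>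
                 (AE x in lebesgue_on \<Omega>. w\<^sub>2 x = c\<^sub>2)))))"
proof -
  have \<Omega>: "open \<Omega>" "connected \<Omega>" "\<Omega> \<noteq> {}"
    using domain by (auto simp: bounded_lipschitz_domain_def)
  note ae = AE_lebesgue_on_iff[OF \<Omega>(1)]
  have cl: "x \<in> closure \<Omega>" if "x \<in> \<Omega>" for x using that closure_subset by blast
  have pos: "\<Psi> x s > 0" if "x \<in> \<Omega>" "s > 0" for x s using \<Psi>_pos cl that by blast
  have p: "p x > 1" if "x \<in> \<Omega>" for x using p_gt_1 cl that by blast
  have meas: "(\<lambda>x. \<Psi> x s) \<in> borel_measurable (lebesgue_on \<Omega>)" if "s > 0" for s
    by (rule measurable_restrict_mono[of _ _ "closure \<Omega>"]) (use \<Psi>_measurable that closure_subset in auto)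
  have cont: "AE x in lebesgue_on \<Omega>. \<forall>s>0. isCont (\<Psi> x) s"
    using \<Psi>_abs_cont by eventually_elim (blast intro: absolutely_continuous_imp_isCont)
  define G\<^sub>1 G\<^sub>2 where "G\<^sub>1 = weak_grad \<Omega> w\<^sub>1" and "G\<^sub>2 = weak_grad \<Omega> w\<^sub>2"
  have wg: "has_weak_gradient \<Omega> w\<^sub>1 G\<^sub>1" "has_weak_gradient \<Omega> w\<^sub>2 G\<^sub>2"
    using w\<^sub>1(1) w\<^sub>2(1) unfolding Sobolev_var_def G\<^sub>1_def G\<^sub>2_def by (blast intro: has_weak_gradient_weak_grad)+
  note pos\<^sub>1 = w\<^sub>1(2)[unfolded ae] and pos\<^sub>2 = w\<^sub>2(2)[unfolded ae]
  have nonneg: "AE x in lebesgue_on \<Omega>. \<forall>\<xi> \<eta> t. t > 0 \<longrightarrow> picone_integrand \<Psi> r x \<xi> \<eta> t \<ge> 0"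
  proof (cases "r = 1")
    case True
    from \<Psi>_mono AE_space show ?thesis
    proof eventually_elim
      case (elim x)
      then show ?case using picone_integrand_1(1)[of \<Psi> x] pos[of x] True by simp
    qed
  next
    case False
    from r_mono AE_space show ?thesis
    proof eventually_elim
      case (elim x)
      then show ?case using picone_integrand_nonneg(1)[of \<Psi> x r] pos[of x] False r by simp
    qed
  qed
  let ?D = "\<lambda>x. picone_integrand \<Psi> r x (G\<^sub>1 x) (G\<^sub>2 x) (w\<^sub>2 x / w\<^sub>1 x)"
  have iff: "picone_equality \<Omega> \<Psi> r w\<^sub>1 w\<^sub>2 \<longleftrightarrow> (AE x in lebesgue_on \<Omega>. ?D x = 0)"
    unfolding G\<^sub>1_def G\<^sub>2_def
    by (rule picone_equality_iff[OF \<Omega>(1) pos meas cont p a\<^sub>0(1) b growth r nonneg w\<^sub>1 w\<^sub>2 ratios log_gradients])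
  have case_1: "picone_equality \<Omega> \<Psi> r w\<^sub>1 w\<^sub>2 \<longleftrightarrow> (\<exists>c. AE x in lebesgue_on \<Omega>. w\<^sub>1 x - w\<^sub>2 x = c)" if r1: "r = 1"
  proof -
    have D: "AE x in lebesgue_on \<Omega>. ?D x = 0 \<longleftrightarrow> G\<^sub>1 x - G\<^sub>2 x = 0"
      using \<Psi>_mono w\<^sub>1(2) w\<^sub>2(2) AE_space
    proof eventually_elim
      case (elim x)
      then show ?case using picone_integrand_1(2)[of \<Psi> x] pos[of x] r1 by simp
    qed
    have "picone_equality \<Omega> \<Psi> r w\<^sub>1 w\<^sub>2 \<longleftrightarrow> (AE x in lebesgue_on \<Omega>. G\<^sub>1 x - G\<^sub>2 x = 0)"
      unfolding iff
    proof
      assume "AE x in lebesgue_on \<Omega>. ?D x = 0"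
      with D show "AE x in lebesgue_on \<Omega>. G\<^sub>1 x - G\<^sub>2 x = 0" by eventually_elim simp
    next
      assume "AE x in lebesgue_on \<Omega>. G\<^sub>1 x - G\<^sub>2 x = 0"
      with D show "AE x in lebesgue_on \<Omega>. ?D x = 0" by eventually_elim simp
    qed
    moreover have "has_weak_gradient \<Omega> (\<lambda>x. w\<^sub>1 x - w\<^sub>2 x) (\<lambda>x. G\<^sub>1 x - G\<^sub>2 x)"
      using weak_gradient_linear[OF \<Omega>(1) wg, of 1 "- 1"] by simp
    ultimately show ?thesis
      using weak_grad_zero_iff_constant[OF \<Omega>(1,2)] unfolding ae by blast
  qed
  have proportional: "\<exists>l>0. AE x in lebesgue_on \<Omega>. w\<^sub>2 x = l * w\<^sub>1 x"
    if r1: "r > 1" and eq: "picone_equality \<Omega> \<Psi> r w\<^sub>1 w\<^sub>2"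
  proof -
    have "AE x in lebesgue_on \<Omega>. G\<^sub>2 x = (w\<^sub>2 x / w\<^sub>1 x) *\<^sub>R G\<^sub>1 x"
      using eq[unfolded iff] r_mono w\<^sub>1(2) w\<^sub>2(2) AE_space
    proof eventually_elim
      case (elim x)
      then show ?case using picone_integrand_nonneg(2)[of \<Psi> x r "w\<^sub>2 x / w\<^sub>1 x"] pos[of x] r1 by simp
    qed
    then obtain l where "l > 0" "AE x in lborel. x \<in> \<Omega> \<longrightarrow> w\<^sub>2 x = l * w\<^sub>1 x"
      using weak_gradients_proportional_imp_ratio_constant[OF \<Omega> wg pos\<^sub>1 pos\<^sub>2
          log_gradients[folded G\<^sub>1_def G\<^sub>2_def] ratios(1)] unfolding ae by blast
    then show ?thesis unfolding ae by blast
  qed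
  \<comment> \<open>By uniqueness the gradient of the second function is \<open>l\<close> times that
    of the first, so the integrand takes its parallel form with \<open>t = l\<close>.\<close>
  have multiple: "picone_equality \<Omega> \<Psi> r w\<^sub>1 w\<^sub>2 \<longleftrightarrow> l = 1 \<or>
      (AE x in lebesgue_on \<Omega>. flux_mod \<Psi> x (l * norm (G\<^sub>1 x)) = l powr (r - 1) * flux_mod \<Psi> x (norm (G\<^sub>1 x)))"
    if r1: "r > 1" and l: "l > 0" and w: "AE x in lebesgue_on \<Omega>. w\<^sub>2 x = l * w\<^sub>1 x" for l
  proof -
    have lw: "has_weak_gradient \<Omega> (\<lambda>x. l * w\<^sub>1 x) (\<lambda>x. l *\<^sub>R G\<^sub>1 x)"
      using weak_gradient_linear[OF \<Omega>(1) wg(1,1), of l 0] by simp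
    have "AE x in lborel. x \<in> \<Omega> \<longrightarrow> l * w\<^sub>1 x = w\<^sub>2 x" using w unfolding ae by eventually_elim simp
    then have "has_weak_gradient \<Omega> w\<^sub>2 (\<lambda>x. l *\<^sub>R G\<^sub>1 x)"
      by (rule has_weak_gradient_cong_AE[OF \<Omega>(1) _ _ lw]) simp
    from weak_gradient_unique[OF \<Omega>(1) wg(2) this]
    have "AE x in lebesgue_on \<Omega>. G\<^sub>2 x = l *\<^sub>R G\<^sub>1 x" unfolding ae .
    then have D: "AE x in lebesgue_on \<Omega>. ?D x = 0 \<longleftrightarrow>
        l = 1 \<or> flux_mod \<Psi> x (l * norm (G\<^sub>1 x)) = l powr (r - 1) * flux_mod \<Psi> x (norm (G\<^sub>1 x))"
      using w w\<^sub>1(2) AE_space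
    proof eventually_elim
      case (elim x)
      have "w\<^sub>2 x / w\<^sub>1 x = l" using elim by simp
      then show ?case using elim picone_integrand_parallel[of \<Psi> x r l "G\<^sub>1 x"] pos[of x] r1 l by simp
    qed
    show ?thesis
    proof (cases "l = 1")
      case True
      then show ?thesis using D unfolding iff by simp
    next
      case False
      show ?thesis
        unfolding iff
      proof
        assume "AE x in lebesgue_on \<Omega>. ?D x = 0"
        with D have "AE x in lebesgue_on \<Omega>. flux_mod \<Psi> x (l * norm (G\<^sub>1 x)) = l powr (r - 1) * flux_mod \<Psi> x (norm (G\<^sub>1 x))"
          by eventually_elim (use False in blast)
        then show "l = 1 \<or> (AE x in lebesgue_on \<Omega>.
            flux_mod \<Psi> x (l * norm (G\<^sub>1 x)) = l powr (r - 1) * flux_mod \<Psi> x (norm (G\<^sub>1 x)))" ..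
      next
        assume "l = 1 \<or> (AE x in lebesgue_on \<Omega>.
            flux_mod \<Psi> x (l * norm (G\<^sub>1 x)) = l powr (r - 1) * flux_mod \<Psi> x (norm (G\<^sub>1 x)))"
        with False have "AE x in lebesgue_on \<Omega>.
            flux_mod \<Psi> x (l * norm (G\<^sub>1 x)) = l powr (r - 1) * flux_mod \<Psi> x (norm (G\<^sub>1 x))" by blast
        with D show "AE x in lebesgue_on \<Omega>. ?D x = 0" by eventually_elim blast
      qed
    qed
  qed
  have strict: "picone_equality \<Omega> \<Psi> r w\<^sub>1 w\<^sub>2 \<longleftrightarrow>
      (AE x in lebesgue_on \<Omega>. w\<^sub>1 x = w\<^sub>2 x) \<or>
      (\<exists>c\<^sub>1 c\<^sub>2. c\<^sub>1 \<noteq> c\<^sub>2 \<and> (AE x in lebesgue_on \<Omega>. w\<^sub>1 x = c\<^sub>1) \<and> (AE x in lebesgue_on \<Omega>. w\<^sub>2 x = c\<^sub>2))"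
    if r1: "r > 1"
      and st: "AE x in lebesgue_on \<Omega>. strict_mono_on {0<..} (\<lambda>s. flux_mod \<Psi> x s / s powr (r - 1))"
  proof
    assume eq: "picone_equality \<Omega> \<Psi> r w\<^sub>1 w\<^sub>2"
    obtain l where l: "l > 0" "AE x in lebesgue_on \<Omega>. w\<^sub>2 x = l * w\<^sub>1 x"
      using proportional[OF r1 eq] by blast
    show "(AE x in lebesgue_on \<Omega>. w\<^sub>1 x = w\<^sub>2 x) \<or>
      (\<exists>c\<^sub>1 c\<^sub>2. c\<^sub>1 \<noteq> c\<^sub>2 \<and> (AE x in lebesgue_on \<Omega>. w\<^sub>1 x = c\<^sub>1) \<and> (AE x in lebesgue_on \<Omega>. w\<^sub>2 x = c\<^sub>2))"
    proof (cases "l = 1")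
      case True
      have "AE x in lebesgue_on \<Omega>. w\<^sub>1 x = w\<^sub>2 x" using l(2) by eventually_elim (simp add: True)
      then show ?thesis ..
    next
      case False
      have "AE x in lebesgue_on \<Omega>. flux_mod \<Psi> x (l * norm (G\<^sub>1 x)) = l powr (r - 1) * flux_mod \<Psi> x (norm (G\<^sub>1 x))"
        using multiple[OF r1 l] eq False by blast
      with st have "AE x in lebesgue_on \<Omega>. G\<^sub>1 x = 0"
      proof eventually_elim
        case (elim x)
        show ?case
        proof (rule ccontr)
          assume "G\<^sub>1 x \<noteq> 0"
          then have a: "norm (G\<^sub>1 x) > 0" "l * norm (G\<^sub>1 x) > 0" using l(1) by auto
          \<comment> \<open>After division by the powers the strictly monotone quotient takes equal
            values at \<open>l * norm (G\<^sub>1 x)\<close> and \<open>norm (G\<^sub>1 x)\<close>;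
            injectivity contradicts \<open>l \<noteq> 1\<close> unless the gradient
            vanishes.\<close>
          have "flux_mod \<Psi> x (l * norm (G\<^sub>1 x)) / (l * norm (G\<^sub>1 x)) powr (r - 1) =
              flux_mod \<Psi> x (norm (G\<^sub>1 x)) / norm (G\<^sub>1 x) powr (r - 1)"
            using elim(2) l(1) by (simp add: powr_mult)
          with strict_mono_on_imp_inj_on[OF elim(1)] a have "l * norm (G\<^sub>1 x) = norm (G\<^sub>1 x)"
            by (auto dest: inj_onD)
          with a(1) False show False by simp
        qed
      qed
      then obtain c where c: "AE x in lborel. x \<in> \<Omega> \<longrightarrow> w\<^sub>1 x = c"
        using weak_grad_zero_iff_constant[OF \<Omega>(1,2) wg(1)] unfolding ae by blast
      \<comment> \<open>Positivity of the constant is what makes \<open>c\<close> and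
        \<open>l * c\<close> different.\<close>
      have "AE x in lborel. x \<in> \<Omega> \<longrightarrow> c > 0" using c pos\<^sub>1 by eventually_elim simp
      from AE_lborel_ex_in_open[OF this \<Omega>(1,3)] have "c > 0" by blast
      have "AE x in lebesgue_on \<Omega>. w\<^sub>2 x = l * c" using l(2) c unfolding ae by eventually_elim simp
      moreover have "c \<noteq> l * c" using False \<open>c > 0\<close> by simp
      ultimately show ?thesis using c unfolding ae by blast
    qed
  next
    assume "(AE x in lebesgue_on \<Omega>. w\<^sub>1 x = w\<^sub>2 x) \<or>
      (\<exists>c\<^sub>1 c\<^sub>2. c\<^sub>1 \<noteq> c\<^sub>2 \<and> (AE x in lebesgue_on \<Omega>. w\<^sub>1 x = c\<^sub>1) \<and> (AE x in lebesgue_on \<Omega>. w\<^sub>2 x = c\<^sub>2))"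
    then show "picone_equality \<Omega> \<Psi> r w\<^sub>1 w\<^sub>2"
    proof
      assume "AE x in lebesgue_on \<Omega>. w\<^sub>1 x = w\<^sub>2 x"
      then have "AE x in lebesgue_on \<Omega>. w\<^sub>2 x = 1 * w\<^sub>1 x" by eventually_elim simp
      from multiple[OF r1 _ this] show ?thesis by simp
    next
      assume "\<exists>c\<^sub>1 c\<^sub>2. c\<^sub>1 \<noteq> c\<^sub>2 \<and> (AE x in lebesgue_on \<Omega>. w\<^sub>1 x = c\<^sub>1) \<and> (AE x in lebesgue_on \<Omega>. w\<^sub>2 x = c\<^sub>2)"
      then have "AE x in lborel. x \<in> \<Omega> \<longrightarrow> G\<^sub>1 x = 0" "AE x in lborel. x \<in> \<Omega> \<longrightarrow> G\<^sub>2 x = 0"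
        using weak_grad_zero_iff_constant[OF \<Omega>(1,2) wg(1)] weak_grad_zero_iff_constant[OF \<Omega>(1,2) wg(2)]
        unfolding ae by blast+
      then show ?thesis
        unfolding iff ae by eventually_elim (simp add: picone_integrand_def flux_def)
    qed
  qed
  show ?thesis
    unfolding G\<^sub>1_def[symmetric]
  proof (intro conjI impI allI)
    show "picone_equality \<Omega> \<Psi> r w\<^sub>1 w\<^sub>2" if "1 < r" "0 < l" "AE x in lebesgue_on \<Omega>. w\<^sub>2 x = l * w\<^sub>1 x" "l = 1" for l
      using multiple[OF that(1-3)] that(4) by blast
    show "picone_equality \<Omega> \<Psi> r w\<^sub>1 w\<^sub>2 \<longleftrightarrow> (AE x in lebesgue_on \<Omega>.
        flux_mod \<Psi> x (l * norm (G\<^sub>1 x)) = l powr (r - 1) * flux_mod \<Psi> x (norm (G\<^sub>1 x)))"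
      if "1 < r" "0 < l" "AE x in lebesgue_on \<Omega>. w\<^sub>2 x = l * w\<^sub>1 x" "l \<noteq> 1" for l
      using multiple[OF that(1-3)] that(4) by blast
  qed (fact case_1 proportional strict)+
qed

end
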